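(* Let $M$ be a $2m$-dimensional orientable closed Riemannian manifold, and let $\tau$ be an orientation reversing involutive isometry of $M$. Then $\mathrm{spec}_m(\langle\tau\rangle\backslash M)$ consists precisely of the eigenvalues of $\mathrm{spec}_m(M)$, but with all multiplicities multiplied by $\frac12$.
   Context: $\mathrm{spec}_m(M)$ denotes the spectrum (eigenvalues with multiplicities) of the Hodge Laplacian $dd^*+d^*d$ acting on smooth $m$-forms on $M$. The isometry $\tau$ is not assumed to act freely, so $\langle\tau\rangle\backslash M$ is in general a Riemannian orbifold; $\mathrm{spec}_m(\langle\tau\rangle\backslash M)$ is defined to be the spectrum of the Hodge Laplacian of $M$ acting on the space of $\tau$-invariant smooth $m$-forms on $M$. (If $\tau$ acts freely, this is the usual $m$-form spectrum of the quotient manifold; if the fixed point set of $\tau$ has codimension one, it coincides with the $m$-form spectrum of the underlying manifold with boundary with absolute boundary conditions.) *)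

theory Defs
  imports "HOL-Analysis.Analysis" "HOL-Library.Function_Algebras" "HOL-Library.Extended_Nat"
begin

section \<open>Smooth maps between Euclidean spaces\<close>

text \<open>Meant for an open set \<open>S\<close>.\<close>

primrec Ck_on ::
  "nat \<Rightarrow> 'a::real_normed_vector set \<Rightarrow> ('a \<Rightarrow> 'b::real_normed_vector) \<Rightarrow> bool" where
  "Ck_on 0 S f \<longleftrightarrow> continuous_on S f"
| "Ck_on (Suc k) S f \<longleftrightarrow>
     f differentiable_on S \<and> (\<forall>v. Ck_on k S (\<lambda>x. frechet_derivative f (at x) v))"

definition smooth_on ::
  "'a::real_normed_vector set \<Rightarrow> ('a \<Rightarrow> 'b::real_normed_vector) \<Rightarrow> bool" where
  "smooth_on S f \<longleftrightarrow> (\<forall>k. Ck_on k S f)"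


section \<open>Smooth manifolds\<close>

text \<open>A chart is an open subset of the manifold together with its coordinate map, whose values
  outside that subset are irrelevant.  The dimension is \<open>CARD('n)\<close>.\<close>

type_synonym ('a, 'n) chart = "'a set \<times> ('a \<Rightarrow> real ^ 'n)"

definition chart_dom :: "('a, 'n) chart \<Rightarrow> 'a set" where
  "chart_dom c = fst c"

definition chart_map :: "('a, 'n) chart \<Rightarrow> 'a \<Rightarrow> real ^ 'n" where
  "chart_map c = snd c"

definition chart_img :: "('a, 'n) chart \<Rightarrow> (real ^ 'n) set" where
  "chart_img c = chart_map c ` chart_dom c"

definition chart_inv :: "('a, 'n) chart \<Rightarrow> real ^ 'n \<Rightarrow> 'a" where
  "chart_inv c = inv_into (chart_dom c) (chart_map c)"

text \<open>The coordinate expression of \<open>f\<close> from the chart \<open>c\<close> to the chart \<open>c'\<close>, and the set on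
  which it is meaningful.  For the identity map these are the transition maps.\<close>

definition local_rep ::
  "('a, 'n) chart \<Rightarrow> ('a \<Rightarrow> 'a) \<Rightarrow> ('a, 'n) chart \<Rightarrow> real ^ 'n \<Rightarrow> real ^ 'n" where
  "local_rep c f c' = (\<lambda>y. chart_map c' (f (chart_inv c y)))"

definition local_dom ::
  "('a, 'n) chart \<Rightarrow> ('a \<Rightarrow> 'a) \<Rightarrow> ('a, 'n) chart \<Rightarrow> (real ^ 'n) set" where
  "local_dom c f c' = chart_map c ` {x \<in> chart_dom c. f x \<in> chart_dom c'}"

definition chart_on :: "'a topology \<Rightarrow> ('a, 'n::finite) chart \<Rightarrow> bool" where
  "chart_on X c \<longleftrightarrow> openin X (chart_dom c) \<and> open (chart_img c) \<and>
     homeomorphic_map (subtopology X (chart_dom c)) (top_of_set (chart_img c)) (chart_map c)"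

definition smooth_atlas :: "'a topology \<Rightarrow> ('a, 'n::finite) chart set \<Rightarrow> bool" where
  "smooth_atlas X A \<longleftrightarrow>
     (\<forall>c\<in>A. chart_on X c) \<and> (\<Union>c\<in>A. chart_dom c) = topspace X \<and>
     (\<forall>c\<in>A. \<forall>c'\<in>A. smooth_on (local_dom c id c') (local_rep c id c'))"

definition closed_manifold :: "'a topology \<Rightarrow> ('a, 'n::finite) chart set \<Rightarrow> bool" where
  "closed_manifold X A \<longleftrightarrow>
     Hausdorff_space X \<and> second_countable X \<and> compact_space X \<and> smooth_atlas X A"

definition smooth_map ::
  "'a topology \<Rightarrow> ('a, 'n::finite) chart set \<Rightarrow> ('a \<Rightarrow> 'a) \<Rightarrow> bool" where
  "smooth_map X A f \<longleftrightarrow> continuous_map X X f \<and>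
     (\<forall>c\<in>A. \<forall>c'\<in>A. smooth_on (local_dom c f c') (local_rep c f c'))"

definition diffeomorphism ::
  "'a topology \<Rightarrow> ('a, 'n::finite) chart set \<Rightarrow> ('a \<Rightarrow> 'a) \<Rightarrow> bool" where
  "diffeomorphism X A f \<longleftrightarrow> bij_betw f (topspace X) (topspace X) \<and>
     smooth_map X A f \<and> smooth_map X A (inv_into (topspace X) f)"

text \<open>An orientation is given by the sign, relative to the standard orientation of the coordinate
  space, of the chosen orientation of the tangent space at each point of each chart.  Continuity
  makes this sign locally constant.\<close>

definition orientation ::
  "('a, 'n::finite) chart set \<Rightarrow> (('a, 'n) chart \<Rightarrow> real ^ 'n \<Rightarrow> real) \<Rightarrow> bool" where
  "orientation A ori \<longleftrightarrow>
     (\<forall>c\<in>A. continuous_on (chart_img c) (ori c) \<and> (\<forall>y\<in>chart_img c. ori c y \<in> {1, -1})) \<and>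
     (\<forall>c\<in>A. \<forall>c'\<in>A. \<forall>y\<in>local_dom c id c'.
        ori c y = sgn (det (matrix (frechet_derivative (local_rep c id c') (at y)))) *
                  ori c' (local_rep c id c' y))"

definition orientation_reversing ::
  "('a, 'n::finite) chart set \<Rightarrow> (('a, 'n) chart \<Rightarrow> real ^ 'n \<Rightarrow> real) \<Rightarrow> ('a \<Rightarrow> 'a) \<Rightarrow> bool" where
  "orientation_reversing A ori f \<longleftrightarrow>
     (\<forall>c\<in>A. \<forall>c'\<in>A. \<forall>y\<in>local_dom c f c'.
        ori c y = - (sgn (det (matrix (frechet_derivative (local_rep c f c') (at y)))) *
                     ori c' (local_rep c f c' y)))"


section \<open>Covariant tensor fields, differential forms and Riemannian metrics\<close>

text \<open>A covariant \<open>p\<close>-tensor field is the family of its coordinate expressions: to each chart and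
  each point of its image it assigns a \<open>p\<close>-linear function on lists of \<open>p\<close> coordinate vectors, and
  the expressions in overlapping charts are related by the transition maps.  To make equality of
  tensor fields equality of functions, the value is 0 wherever it is not meaningful.\<close>

type_synonym ('a, 'n) tensor_field =
  "('a, 'n) chart \<Rightarrow> real ^ 'n \<Rightarrow> (real ^ 'n) list \<Rightarrow> real"

definition multilinear :: "nat \<Rightarrow> ((real ^ 'n::finite) list \<Rightarrow> real) \<Rightarrow> bool" where
  "multilinear p T \<longleftrightarrow>
     (\<forall>vs. length vs \<noteq> p \<longrightarrow> T vs = 0) \<and>
     (\<forall>vs i. length vs = p \<longrightarrow> i < p \<longrightarrow> linear (\<lambda>v. T (vs[i := v])))"

definition alternating :: "((real ^ 'n) list \<Rightarrow> real) \<Rightarrow> bool" where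
  "alternating T \<longleftrightarrow>
     (\<forall>vs i j. i < j \<longrightarrow> j < length vs \<longrightarrow> vs ! i = vs ! j \<longrightarrow> T vs = 0)"

text \<open>\<open>is_pullback A f \<eta> \<omega>\<close> says that \<open>\<eta>\<close> is the pullback of \<open>\<omega>\<close> along \<open>f\<close>.\<close>

definition is_pullback ::
  "('a, 'n::finite) chart set \<Rightarrow> ('a \<Rightarrow> 'a) \<Rightarrow>
   ('a, 'n) tensor_field \<Rightarrow> ('a, 'n) tensor_field \<Rightarrow> bool" where
  "is_pullback A f \<eta> \<omega> \<longleftrightarrow>
     (\<forall>c\<in>A. \<forall>c'\<in>A. \<forall>y\<in>local_dom c f c'. \<forall>vs.
        \<eta> c y vs =
        \<omega> c' (local_rep c f c' y) (map (frechet_derivative (local_rep c f c') (at y)) vs))"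

definition tensor_fields ::
  "('a, 'n::finite) chart set \<Rightarrow> nat \<Rightarrow> ('a, 'n) tensor_field set" where
  "tensor_fields A p = {\<omega>.
     (\<forall>c y vs. c \<notin> A \<or> y \<notin> chart_img c \<longrightarrow> \<omega> c y vs = 0) \<and>
     (\<forall>c\<in>A. \<forall>y\<in>chart_img c. multilinear p (\<omega> c y)) \<and>
     (\<forall>c\<in>A. \<forall>vs. smooth_on (chart_img c) (\<lambda>y. \<omega> c y vs)) \<and>
     is_pullback A id \<omega> \<omega>}"

definition forms :: "('a, 'n::finite) chart set \<Rightarrow> nat \<Rightarrow> ('a, 'n) tensor_field set" where
  "forms A p = {\<omega> \<in> tensor_fields A p. \<forall>c\<in>A. \<forall>y\<in>chart_img c. alternating (\<omega> c y)}"

definition invariant_forms ::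
  "('a, 'n::finite) chart set \<Rightarrow> ('a \<Rightarrow> 'a) \<Rightarrow> nat \<Rightarrow> ('a, 'n) tensor_field set" where
  "invariant_forms A f p = {\<omega> \<in> forms A p. is_pullback A f \<omega> \<omega>}"

definition riemannian_metric ::
  "('a, 'n::finite) chart set \<Rightarrow> ('a, 'n) tensor_field \<Rightarrow> bool" where
  "riemannian_metric A g \<longleftrightarrow> g \<in> tensor_fields A 2 \<and>
     (\<forall>c\<in>A. \<forall>y\<in>chart_img c.
        (\<forall>u v. g c y [u, v] = g c y [v, u]) \<and> (\<forall>v. v \<noteq> 0 \<longrightarrow> g c y [v, v] > 0))"

definition isometry ::
  "'a topology \<Rightarrow> ('a, 'n::finite) chart set \<Rightarrow> ('a, 'n) tensor_field \<Rightarrow> ('a \<Rightarrow> 'a) \<Rightarrow> bool" where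
  "isometry X A g f \<longleftrightarrow> diffeomorphism X A f \<and> is_pullback A f g g"

definition gram ::
  "('a, 'n::finite) tensor_field \<Rightarrow> ('a, 'n) chart \<Rightarrow> real ^ 'n \<Rightarrow> real ^ 'n ^ 'n" where
  "gram g c y = (\<chi> i j. g c y [axis i 1, axis j 1])"

text \<open>The Riemannian measure is the Borel measure that in every chart has the density
  \<open>sqrt (det g)\<close> with respect to Lebesgue measure.  Since countably many charts cover the
  manifold, it exists and is determined by the metric.\<close>

definition riemannian_measure ::
  "'a topology \<Rightarrow> ('a, 'n::finite) chart set \<Rightarrow> ('a, 'n) tensor_field \<Rightarrow> 'a measure \<Rightarrow> bool" where
  "riemannian_measure X A g vol \<longleftrightarrow>
     space vol = topspace X \<and>
     sets vol = sigma_sets (topspace X) {U. openin X U} \<and>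
     (\<forall>c\<in>A. \<forall>S\<in>sets vol. S \<subseteq> chart_dom c \<longrightarrow>
        emeasure vol S =
        (\<integral>\<^sup>+y. ennreal (sqrt (det (gram g c y))) * indicator (chart_map c ` S) y \<partial>lborel))"


section \<open>The Hodge Laplacian\<close>

definition ext_d :: "('a, 'n::finite) tensor_field \<Rightarrow> ('a, 'n) tensor_field" where
  "ext_d \<omega> = (\<lambda>c y vs. if y \<in> chart_img c then
     (\<Sum>k<length vs. (-1) ^ k *
        frechet_derivative (\<lambda>z. \<omega> c z (take k vs @ drop (Suc k) vs)) (at y) (vs ! k))
     else 0)"

text \<open>The inner product induced on alternating \<open>p\<close>-linear functions by the inner product with Gram
  matrix \<open>G\<close>.  The sum is over all multi-indices; the factor \<open>1 / p!\<close> is the usual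
  normalisation, in which the wedge products of \<open>p\<close> distinct members of an orthonormal coframe
  have norm 1.\<close>

definition form_inner ::
  "nat \<Rightarrow> real ^ 'n ^ 'n \<Rightarrow> ((real ^ 'n::finite) list \<Rightarrow> real) \<Rightarrow> ((real ^ 'n) list \<Rightarrow> real) \<Rightarrow> real"
  where
  "form_inner p G \<alpha> \<beta> =
     (\<Sum>I\<in>{I. length I = p}. \<Sum>J\<in>{J. length J = p}.
        (\<Prod>k<p. matrix_inv G $ (I ! k) $ (J ! k)) *
        \<alpha> (map (\<lambda>i. axis i 1) I) * \<beta> (map (\<lambda>j. axis j 1) J)) / fact p"

text \<open>The integrand of the \<open>L\<^sup>2\<close> inner product does not depend on the chart used at \<open>x\<close>.\<close>

definition chart_at :: "('a, 'n) chart set \<Rightarrow> 'a \<Rightarrow> ('a, 'n) chart" where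
  "chart_at A x = (SOME c. c \<in> A \<and> x \<in> chart_dom c)"

definition L2_inner ::
  "('a, 'n::finite) chart set \<Rightarrow> ('a, 'n) tensor_field \<Rightarrow> 'a measure \<Rightarrow> nat \<Rightarrow>
   ('a, 'n) tensor_field \<Rightarrow> ('a, 'n) tensor_field \<Rightarrow> real" where
  "L2_inner A g vol p \<alpha> \<beta> =
     (LINT x|vol. (let c = chart_at A x; y = chart_map c x
                   in form_inner p (gram g c y) (\<alpha> c y) (\<beta> c y)))"

text \<open>The formal adjoint of the exterior derivative from \<open>p\<close>-forms to \<open>(p + 1)\<close>-forms, applied
  to a \<open>(p + 1)\<close>-form.\<close>

definition codiff ::
  "('a, 'n::finite) chart set \<Rightarrow> ('a, 'n) tensor_field \<Rightarrow> 'a measure \<Rightarrow> nat \<Rightarrow>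
   ('a, 'n) tensor_field \<Rightarrow> ('a, 'n) tensor_field" where
  "codiff A g vol p \<beta> = (THE \<gamma>. \<gamma> \<in> forms A p \<and>
     (\<forall>\<alpha>\<in>forms A p. L2_inner A g vol (Suc p) (ext_d \<alpha>) \<beta> = L2_inner A g vol p \<alpha> \<gamma>))"

definition hodge_laplacian ::
  "('a, 'n::finite) chart set \<Rightarrow> ('a, 'n) tensor_field \<Rightarrow> 'a measure \<Rightarrow> nat \<Rightarrow>
   ('a, 'n) tensor_field \<Rightarrow> ('a, 'n) tensor_field" where
  "hodge_laplacian A g vol p \<omega> =
     (if p = 0 then 0 else ext_d (codiff A g vol (p - 1) \<omega>)) + codiff A g vol p (ext_d \<omega>)"


section \<open>Spectra\<close>

definition tensor_scale :: "real \<Rightarrow> ('a, 'n) tensor_field \<Rightarrow> ('a, 'n) tensor_field" where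
  "tensor_scale r \<omega> = (\<lambda>c y vs. r * \<omega> c y vs)"

global_interpretation tensor: vector_space tensor_scale
  by standard (auto simp: tensor_scale_def fun_eq_iff algebra_simps)

definition eigenspace ::
  "('a, 'n) tensor_field set \<Rightarrow> (('a, 'n) tensor_field \<Rightarrow> ('a, 'n) tensor_field) \<Rightarrow> real \<Rightarrow>
   ('a, 'n) tensor_field set" where
  "eigenspace V L lam = {\<omega> \<in> V. L \<omega> = tensor_scale lam \<omega>}"

definition eigenvalues ::
  "('a, 'n) tensor_field set \<Rightarrow> (('a, 'n) tensor_field \<Rightarrow> ('a, 'n) tensor_field) \<Rightarrow> real set" where
  "eigenvalues V L = {lam. \<exists>\<omega>\<in>eigenspace V L lam. \<omega> \<noteq> 0}"

definition eigen_multiplicity ::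
  "('a, 'n) tensor_field set \<Rightarrow> (('a, 'n) tensor_field \<Rightarrow> ('a, 'n) tensor_field) \<Rightarrow> real \<Rightarrow> enat"
  where
  "eigen_multiplicity V L lam =
     (if \<exists>B. finite B \<and> eigenspace V L lam \<subseteq> tensor.span B
      then enat (tensor.dim (eigenspace V L lam)) else \<infinity>)"

end

theory Submission
  imports Defs "HOL-Combinatorics.Multiset_Permutations"
begin

text \<open>On a closed oriented Riemannian manifold of even dimension \<open>2 m\<close> Stokes' theorem gives
  \<open>d* = - \<star> d \<star>\<close>, so on \<open>m\<close>-forms the Laplacian is \<open>- (d \<star> d \<star> + \<star> d \<star> d)\<close>.  As \<open>\<star> \<star> = \<plusminus> 1\<close> on \<open>m\<close>-forms,
  it commutes with \<open>\<star>\<close>.  The pullback \<open>\<tau>*\<close> along the isometry commutes with \<open>d\<close> and, as \<open>\<tau>\<close> reverses the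
  orientation, anticommutes with \<open>\<star>\<close>; hence it commutes with the Laplacian, and \<open>\<star>\<close> interchanges the
  eigenspaces of \<open>\<tau>*\<close> for the eigenvalues 1 and -1 inside each eigenspace of the Laplacian.

  The formula for \<open>d*\<close> is proved in charts, where \<open>(\<langle>d \<alpha>, \<beta>\<rangle> + \<langle>\<alpha>, \<star> d \<star> \<beta>\<rangle>) sqrt (det g)\<close> is a
  divergence, and a partition of unity reduces to forms \<open>\<alpha>\<close> with support in a single chart.\<close>

section \<open>Multilinear functions of lists of vectors\<close>

text \<open>As \<open>codiff\<close> is a definite description, the formula for d* has two halves:
  \<star> d \<star> must be a smooth form satisfying the adjoint relation up to sign, and the
  adjoint must be unique, which is definiteness of the L2 product. In general d* carries a sign that
  depends on the degree; in even dimension it is always -1, so both halves of the Laplacian get the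
  same sign and \<star> can interchange them. Since \<star> \<star> may be -1, the exchange of the
  eigenspaces rests on the invertibility of \<star>. Multiplicities are extended natural numbers, so
  the halving also has to carry the existence of a finite spanning set from one eigenspace to the
  other. Multi-indices run over all lists, normalised by factorials, instead of increasing ones:
  contractions with the inverse metric are then full sums, and a matrix moves from one factor to the
  other by interchanging two sums.\<close>

abbreviation axes :: "'n list \<Rightarrow> (real ^ 'n::finite) list" where
  "axes I \<equiv> map (\<lambda>i. axis i 1) I"

abbreviation indices :: "nat \<Rightarrow> 'n::finite list set" where
  "indices p \<equiv> {I. length I = p}"

lemma finite_indices [simp]: "finite (indices p :: 'n::finite list set)"
  using finite_lists_length_eq[of "UNIV :: 'n set" p] by simp

lemma sum_indices_Suc:
  fixes f :: "'n::finite list \<Rightarrow> 'b::comm_monoid_add"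
  shows "(\<Sum>I\<in>indices (Suc p). f I) = (\<Sum>i\<in>UNIV. \<Sum>I\<in>indices p. f (i # I))"
proof -
  have eq: "indices (Suc p) = (\<lambda>(i, I). i # I) ` (UNIV \<times> (indices p :: 'n list set))"
    by (auto simp: length_Suc_conv image_iff)
  have inj: "inj_on (\<lambda>(i, I). i # I) (UNIV \<times> (indices p :: 'n list set))"
    by (auto simp: inj_on_def)
  show ?thesis
    unfolding eq sum.reindex[OF inj] by (simp add: sum.cartesian_product case_prod_beta comp_def)
qed

lemma multilinear_length: "multilinear p T \<Longrightarrow> length vs \<noteq> p \<Longrightarrow> T vs = 0"
  by (auto simp: multilinear_def)

lemma multilinear_update:
  assumes "multilinear p T" "i < length vs"
  shows "linear (\<lambda>v. T (vs[i := v]))"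
proof (cases "length vs = p")
  case True
  then show ?thesis using assms by (auto simp: multilinear_def)
next
  case False
  then have "(\<lambda>v. T (vs[i := v])) = (\<lambda>v. 0)"
    using assms by (auto simp: multilinear_def)
  then show ?thesis by (simp add: linear_zero)
qed

lemma multilinear_middle:
  assumes "multilinear p T"
  shows "linear (\<lambda>v. T (us @ v # ws))"
  using multilinear_update[OF assms, of "length us" "us @ undefined # ws"] by simp

lemma multilinear_head: "multilinear p T \<Longrightarrow> linear (\<lambda>v. T (v # ws))"
  using multilinear_middle[of p T "[]"] by simp

text \<open>The varying slot is written \<open>us @ v # ws\<close> instead of a list update, because
  the later arguments cut and join lists at that slot.\<close>

lemma multilinearI:
  assumes "\<And>vs. length vs \<noteq> p \<Longrightarrow> T vs = 0"
    and "\<And>us ws. Suc (length us + length ws) = p \<Longrightarrow> linear (\<lambda>v. T (us @ v # ws))"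
  shows "multilinear p T"
  unfolding multilinear_def
proof (intro conjI allI impI)
  fix vs :: "(real ^ 'a) list" and i assume "length vs = p" "i < p"
  then have "(\<lambda>v. T (vs[i := v])) = (\<lambda>v. T (take i vs @ v # drop (Suc i) vs))"
    by (simp add: upd_conv_take_nth_drop)
  moreover have "Suc (length (take i vs) + length (drop (Suc i) vs)) = p"
    using \<open>length vs = p\<close> \<open>i < p\<close> by simp
  ultimately show "linear (\<lambda>v. T (vs[i := v]))" using assms(2) by metis
qed (use assms(1) in auto)

lemma multilinear_append:
  assumes "multilinear (p + q) T" "length us = p"
  shows "multilinear q (\<lambda>vs. T (us @ vs))"
proof (rule multilinearI)
  fix vs :: "(real ^ 'a) list" assume "length vs \<noteq> q"
  then show "T (us @ vs) = 0" using assms by (intro multilinear_length[OF assms(1)]) auto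
next
  fix xs ws :: "(real ^ 'a) list"
  show "linear (\<lambda>v. T (us @ xs @ v # ws))"
    using multilinear_middle[OF assms(1), of "us @ xs"] by simp
qed

lemma multilinear_append2:
  assumes "multilinear (p + q) T" "length us = q"
  shows "multilinear p (\<lambda>vs. T (vs @ us))"
proof (rule multilinearI)
  fix vs :: "(real ^ 'a) list" assume "length vs \<noteq> p"
  then show "T (vs @ us) = 0" using assms by (intro multilinear_length[OF assms(1)]) auto
next
  fix xs ws :: "(real ^ 'a) list"
  show "linear (\<lambda>v. T ((xs @ v # ws) @ us))"
    using multilinear_middle[OF assms(1), of "xs" "ws @ us"] by simp
qed

lemma multilinear_Cons: "multilinear (Suc p) T \<Longrightarrow> multilinear p (\<lambda>vs. T (v # vs))"
  using multilinear_append[of 1 p T "[v]"] by simp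

lemma multilinear_map:
  assumes "multilinear p T" "linear L"
  shows "multilinear p (\<lambda>vs. T (map L vs))"
proof (rule multilinearI)
  fix us ws
  have "linear (\<lambda>v. T (map L us @ v # map L ws))" by (rule multilinear_middle[OF assms(1)])
  from linear_compose[OF assms(2) this]
  show "linear (\<lambda>v. T (map L (us @ v # ws)))" by (simp add: o_def)
qed (use assms in \<open>auto simp: multilinear_def\<close>)

lemma multilinear_zero: "multilinear p (\<lambda>_. 0)"
  by (simp add: multilinear_def linear_zero)

lemma multilinear_add:
  "multilinear p S \<Longrightarrow> multilinear p T \<Longrightarrow> multilinear p (\<lambda>vs. S vs + T vs)"
  by (auto simp: multilinear_def intro: linear_compose_add)

lemma multilinear_scale: "multilinear p T \<Longrightarrow> multilinear p (\<lambda>vs. c * T vs)"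
  using linear_compose_scale_right[of "_ :: _ \<Rightarrow> real" c] by (auto simp: multilinear_def)

lemma multilinear_scale_right: "multilinear p T \<Longrightarrow> multilinear p (\<lambda>vs. T vs * c)"
  using multilinear_scale[of p T c] by (simp add: mult.commute)

lemma multilinear_sum:
  "(\<And>i. i \<in> I \<Longrightarrow> multilinear p (T i)) \<Longrightarrow> multilinear p (\<lambda>vs. \<Sum>i\<in>I. T i vs)"
  by (induction I rule: infinite_finite_induct) (auto intro: multilinear_add multilinear_zero)

lemma linear_expand:
  fixes T :: "real ^ 'n::finite \<Rightarrow> real"
  assumes "linear T"
  shows "T v = (\<Sum>i\<in>UNIV. v $ i * T (axis i 1))"
proof -
  have "T v = T (\<Sum>i\<in>UNIV. v $ i *\<^sub>R axis i 1)"
    using basis_expansion[of v] by (simp add: scalar_mult_eq_scaleR)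
  then show ?thesis using assms by (simp add: linear_sum linear_scale)
qed

text \<open>Induction peels off the first argument. The function becomes a polynomial in the
  coordinates of its arguments with the values on \<open>axes J\<close> as coefficients;
  extensionality on axes and smoothness with moving arguments rest on this.\<close>

lemma multilinear_expand:
  assumes "multilinear p T" "length vs = p"
  shows "T vs = (\<Sum>J\<in>indices p. (\<Prod>k<p. vs ! k $ (J ! k)) * T (axes J))"
  using assms
proof (induction p arbitrary: T vs)
  case 0
  then show ?case by simp
next
  case (Suc p)
  then obtain v ws where vs: "vs = v # ws" "length ws = p" by (auto simp: length_Suc_conv)
  have "T vs = (\<Sum>i\<in>UNIV. v $ i * T (axis i 1 # ws))"
    using linear_expand[OF multilinear_head[OF Suc.prems(1), of ws], of v] vs by simp
  also have "\<dots> = (\<Sum>i\<in>UNIV. v $ i *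
      (\<Sum>J\<in>indices p. (\<Prod>k<p. ws ! k $ (J ! k)) * T (axis i 1 # axes J)))"
    using Suc.IH[OF multilinear_Cons[OF Suc.prems(1)] vs(2)] by simp
  finally show ?case
    by (simp add: sum_indices_Suc vs prod.lessThan_Suc_shift sum_distrib_left mult.assoc
        del: prod.lessThan_Suc)
qed

lemma multilinear_eqI:
  assumes "multilinear p S" "multilinear p T" "\<And>I. length I = p \<Longrightarrow> S (axes I) = T (axes I)"
  shows "S = T"
proof
  fix vs show "S vs = T vs"
  proof (cases "length vs = p")
    case True
    show ?thesis
      unfolding multilinear_expand[OF assms(1) True] multilinear_expand[OF assms(2) True]
      by (simp add: assms(3))
  next
    case False
    then show ?thesis using assms by (simp add: multilinear_length)
  qed
qed

lemma multilinear_matrix: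
  assumes "multilinear p T" "length I = p"
  shows "T (map ((*v) M) (axes I)) = (\<Sum>J\<in>indices p. (\<Prod>k<p. M $ (J ! k) $ (I ! k)) * T (axes J))"
proof -
  have "(\<Prod>k<p. map ((*v) M) (axes I) ! k $ (J ! k)) = (\<Prod>k<p. M $ (J ! k) $ (I ! k))" for J
    using assms by (intro prod.cong) (auto simp: matrix_vector_mult_basis column_def)
  then show ?thesis
    using multilinear_expand[OF assms(1), of "map ((*v) M) (axes I)"] assms by simp
qed

text \<open>Expanding \<open>M\<close> in coordinates makes both sides the same double sum over
  \<open>I\<close> and \<open>J\<close>, with the sums interchanged. The inner product and the Hodge
  star below are transformed by moving matrices between factors in this way.\<close>

lemma contraction_transpose:
  assumes "\<And>vs. multilinear p (\<lambda>us. F us vs)" "\<And>us. multilinear p (F us)"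
  shows "(\<Sum>I\<in>indices p. F (axes I) (map ((*v) M) (axes I))) =
         (\<Sum>I\<in>indices p. F (map ((*v) (transpose M)) (axes I)) (axes I))"
proof -
  have "(\<Sum>I\<in>indices p. F (axes I) (map ((*v) M) (axes I))) =
        (\<Sum>I\<in>indices p. \<Sum>J\<in>indices p. (\<Prod>k<p. M $ (J ! k) $ (I ! k)) * F (axes I) (axes J))"
    using multilinear_matrix[OF assms(2)] by (intro sum.cong) auto
  also have "\<dots> = (\<Sum>J\<in>indices p. \<Sum>I\<in>indices p.
      (\<Prod>k<p. transpose M $ (I ! k) $ (J ! k)) * F (axes I) (axes J))"
    by (subst sum.swap) (simp add: transpose_def)
  also have "\<dots> = (\<Sum>I\<in>indices p. F (map ((*v) (transpose M)) (axes I)) (axes I))"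
    using multilinear_matrix[OF assms(1), symmetric] by (intro sum.cong) auto
  finally show ?thesis .
qed

section \<open>Sign rules for alternating functions\<close>

lemma alternating_swap:
  assumes "multilinear p T" "alternating T"
  shows "T (us @ x # y # ws) = - T (us @ y # x # ws)"
proof -
  have 0: "T (us @ z # z # ws) = 0" for z
    using assms(2)[unfolded alternating_def, rule_format, of "length us" "Suc (length us)" "us @ z # z # ws"]
    by (simp add: nth_append)
  have 1: "T (us @ (a + b) # ws) = T (us @ a # ws) + T (us @ b # ws)" for a b us ws
    by (rule linear_add[OF multilinear_middle[OF assms(1)]])
  \<comment> \<open>Polarisation: a sum placed in two neighbouring slots is expanded in
    both.\<close>
  have "0 = T (us @ (x + y) # (x + y) # ws)" by (simp add: 0)
  also have "\<dots> = T (us @ x # (x + y) # ws) + T (us @ y # (x + y) # ws)" by (rule 1)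
  also have "\<dots> = T (us @ x # y # ws) + T (us @ y # x # ws)"
    using 1[of "us @ [x]" x y ws] 1[of "us @ [y]" x y ws] 0 by simp
  finally show ?thesis by simp
qed

text \<open>On its way to the front \<open>x\<close> is exchanged with each of the
  \<open>length us\<close> vectors before it.\<close>

lemma alternating_move:
  assumes "multilinear p T" "alternating T"
  shows "T (us @ x # ws) = (-1) ^ length us * T (x # us @ ws)"
proof (induction us arbitrary: ws rule: rev_induct)
  case Nil
  then show ?case by simp
next
  case (snoc u us)
  have "T ((us @ [u]) @ x # ws) = - T (us @ x # u # ws)"
    using alternating_swap[OF assms, of us u x ws] by simp
  then show ?case using snoc.IH[of "u # ws"] by simp
qed

lemma alternating_append:
  "alternating T \<Longrightarrow> alternating (\<lambda>vs. T (us @ vs))"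
  unfolding alternating_def
proof (intro allI impI)
  fix vs :: "(real ^ 'a) list" and i j
  assume T: "\<forall>vs i j. i < j \<longrightarrow> j < length vs \<longrightarrow> vs ! i = vs ! j \<longrightarrow> T vs = 0"
    and "i < j" "j < length vs" "vs ! i = vs ! j"
  then show "T (us @ vs) = 0"
    using T[rule_format, of "length us + i" "length us + j" "us @ vs"] by (simp add: nth_append)
qed

lemma alternating_map: "alternating T \<Longrightarrow> alternating (\<lambda>vs. T (map L vs))"
  unfolding alternating_def by (metis length_map nth_map order.strict_trans)

lemma alternating_scale: "alternating T \<Longrightarrow> alternating (\<lambda>vs. c * T vs)"
  by (simp add: alternating_def)

lemma alternating_swap_blocks:
  assumes "multilinear p T" "alternating T"
  shows "T (us @ ws) = (-1) ^ (length us * length ws) * T (ws @ us)"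
  using assms
proof (induction ws arbitrary: p T)
  case Nil
  then show ?case by simp
next
  case (Cons w ws)
  show ?case
  proof (cases p)
    case 0
    then show ?thesis using Cons.prems(1) by (simp add: multilinear_length)
  next
    case (Suc q)
    have "T (us @ w # ws) = (-1) ^ length us * T (w # us @ ws)"
      by (rule alternating_move[OF Cons.prems])
    also have "T (w # us @ ws) = (-1) ^ (length us * length ws) * T (w # ws @ us)"
      using Cons.IH[of q "\<lambda>vs. T (w # vs)"] multilinear_Cons Cons.prems(1)
        alternating_append[OF Cons.prems(2), of "[w]"] Suc by auto
    finally show ?thesis by (simp add: power_add mult.assoc)
  qed
qed

lemma alternating_not_distinct: "alternating T \<Longrightarrow> \<not> distinct vs \<Longrightarrow> T vs = 0"
  unfolding alternating_def distinct_conv_nth by (metis linorder_neqE_nat)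

text \<open>Moving single entries to the front generates all permutations. The intended
  \<open>F\<close> is a product of two alternating functions, whose signs cancel.\<close>

lemma symmetric_mset_eq:
  assumes "mset xs = mset ys" "\<And>us x ws. F (us @ x # ws) = F (x # us @ ws)"
  shows "F xs = F ys"
  using assms
proof (induction xs arbitrary: ys F)
  case Nil
  then show ?case by simp
next
  case (Cons x xs)
  have "x \<in> set ys" using Cons.prems(1) by (metis list.set_intros(1) set_mset_mset)
  then obtain us ws where ys: "ys = us @ x # ws" by (auto dest: split_list)
  \<comment> \<open>The function of the tail inherits the invariance: \<open>y\<close> is moved to
    the front past \<open>x\<close>, and then \<open>x\<close> is moved back before it.\<close>
  have swap: "F (x # us @ y # ws) = F (x # y # us @ ws)" for us y ws
    using Cons.prems(2)[of "x # us" y ws] Cons.prems(2)[of "[y]" x "us @ ws"] by simp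
  have "F (x # xs) = F (x # us @ ws)"
    using Cons.IH[of "us @ ws" "\<lambda>vs. F (x # vs)"] Cons.prems(1) swap by (simp add: ys)
  then show ?case using Cons.prems(2) ys by simp
qed

section \<open>The determinant as a function of a list of vectors\<close>

text \<open>Lists are indexed by natural numbers and matrices by \<open>'n\<close>. The bijection is
  arbitrary; another choice changes \<open>vdet\<close> at most by a sign.\<close>

definition enum_index :: "'n::finite \<Rightarrow> nat" where
  "enum_index = (SOME h. bij_betw h UNIV {0..<CARD('n)})"

lemma enum_index_bij: "bij_betw (enum_index :: 'n::finite \<Rightarrow> nat) UNIV {0..<CARD('n)}"
  unfolding enum_index_def
  by (rule someI_ex[OF ex_bij_betw_finite_nat[OF finite]])

lemma enum_index_less [simp]: "enum_index (k :: 'n::finite) < CARD('n)"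
  using bij_betwE[OF enum_index_bij] by auto

lemma enum_index_eq_iff [simp]: "enum_index j = enum_index (k :: 'n::finite) \<longleftrightarrow> j = k"
  using bij_betw_imp_inj_on[OF enum_index_bij] by (auto simp: inj_on_def)

lemma enum_index_surj: "i < CARD('n) \<Longrightarrow> \<exists>k::'n::finite. enum_index k = i"
  using enum_index_bij[where 'n = 'n] unfolding bij_betw_def
  by (metis atLeast0LessThan imageE lessThan_iff)

text \<open>The vectors are the rows of the determinant. On axes this is the Levi-Civita symbol, up
  to the sign fixed by \<open>enum_index\<close>; lists of other lengths give 0, as
  \<open>multilinear\<close> demands.\<close>

definition vdet :: "(real ^ 'n::finite) list \<Rightarrow> real" where
  "vdet vs = (if length vs = CARD('n) then det (\<chi> i. vs ! enum_index i) else 0)"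

lemma multilinear_vdet: "multilinear CARD('n) (vdet :: (real ^ 'n::finite) list \<Rightarrow> real)"
  unfolding multilinear_def
proof (intro conjI allI impI)
  fix vs :: "(real ^ 'n) list" and i assume len: "length vs = CARD('n)" and "i < CARD('n)"
  then obtain k :: 'n where k: "i = enum_index k" using enum_index_surj by metis
  have eq: "vdet (vs[i := v]) = det (\<chi> j. if j = k then v else vs ! enum_index j)" for v
  proof -
    have "(\<chi> j. vs[i := v] ! enum_index j) = (\<chi> j. if j = k then v else vs ! enum_index j)"
      using len by (auto simp: vec_eq_iff k)
    then show ?thesis by (simp add: vdet_def len)
  qed
  show "linear (\<lambda>v. vdet (vs[i := v]))"
  proof (rule linearI)
    fix a b :: "real ^ 'n" and c :: real
    show "vdet (vs[i := a + b]) = vdet (vs[i := a]) + vdet (vs[i := b])"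
      unfolding eq by (rule det_row_add)
    show "vdet (vs[i := c *\<^sub>R a]) = c *\<^sub>R vdet (vs[i := a])"
      unfolding eq using det_row_mul[of k c "\<lambda>_. a" "\<lambda>j. vs ! enum_index j",
          unfolded scalar_mult_eq_scaleR] by simp
  qed
qed (auto simp: vdet_def)

lemma alternating_vdet: "alternating (vdet :: (real ^ 'n::finite) list \<Rightarrow> real)"
  unfolding alternating_def
proof (intro allI impI)
  fix vs :: "(real ^ 'n) list" and i j :: nat
  assume *: "i < j" "j < length vs" "vs ! i = vs ! j"
  show "vdet vs = 0"
  proof (cases "length vs = CARD('n)")
    case True
    then obtain k l :: 'n where kl: "i = enum_index k" "j = enum_index l"
      using enum_index_surj * by (metis order.strict_trans)
    have "det (\<chi> i. vs ! enum_index i) = 0"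
      by (rule det_identical_rows[of k l]) (use * kl in \<open>auto simp: row_def\<close>)
    then show ?thesis by (simp add: vdet_def)
  qed (simp add: vdet_def)
qed

lemma vdet_map: "vdet (map ((*v) M) vs) = det M * vdet (vs :: (real ^ 'n::finite) list)"
proof (cases "length vs = CARD('n)")
  case True
  have "(\<chi> i::'n. map ((*v) M) vs ! enum_index i) = (\<chi> i. vs ! enum_index i) ** transpose M"
    using True
    by (simp add: vec_eq_iff matrix_matrix_mult_def matrix_vector_mult_def transpose_def mult.commute)
  then show ?thesis using True by (simp add: vdet_def det_mul)
qed (simp add: vdet_def)

text \<open>\<open>?P\<close> is a permutation matrix, hence orthogonal. The sign of its determinant
  depends on \<open>enum_index\<close>, the square does not.\<close>

lemma vdet_axes_square:
  assumes "distinct I" "length I = CARD('n::finite)"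
  shows "vdet (axes (I :: 'n list)) * vdet (axes I) = 1"
proof -
  let ?P = "(\<chi> i. axis (I ! enum_index i) 1) :: real ^ 'n ^ 'n"
  have eq: "(\<chi> i. axes I ! enum_index i) = ?P"
    using assms by (simp add: vec_eq_iff)
  have inj: "I ! enum_index i = I ! enum_index j \<longleftrightarrow> i = j" for i j :: 'n
    using assms by (simp add: nth_eq_iff_index_eq)
  have "(?P ** transpose ?P) $ i $ j = mat 1 $ i $ j" for i j
  proof -
    have "(?P ** transpose ?P) $ i $ j =
        axis (I ! enum_index i) (1::real) \<bullet> axis (I ! enum_index j) 1"
      by (simp only: matrix_matrix_mult_def transpose_def inner_vec_def vec_lambda_beta inner_real_def)
    also have "\<dots> = mat 1 $ i $ j"
      by (simp add: inner_axis_axis inj mat_def)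
    finally show ?thesis .
  qed
  then have "?P ** transpose ?P = mat 1" by (simp only: vec_eq_iff) simp
  then have "det ?P * det ?P = 1" by (metis det_I det_mul det_transpose)
  then show ?thesis using assms by (simp add: vdet_def eq)
qed

section \<open>The Hodge star of an inner product space\<close>

text \<open>This is the contraction identity for two Levi-Civita symbols, the source of \<star>
  \<star> = \<plusminus> 1. For distinct \<open>I\<close> only the \<open>J\<close> that enumerate
  the complement of \<open>I\<close> and the \<open>K\<close> that permute \<open>I\<close>
  contribute. There are \<open>fact p * fact q\<close> such pairs, each contributing
  \<open>w (axes I)\<close>; the sign comes from exchanging the blocks \<open>J\<close> and
  \<open>I\<close>.\<close>

lemma double_contraction:
  fixes w :: "(real ^ 'n::finite) list \<Rightarrow> real"
  assumes w: "multilinear p w" "alternating w" and pq: "p + q = CARD('n)" and I: "length I = p"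
  shows "(\<Sum>J\<in>indices q. \<Sum>K\<in>indices p.
            w (axes K) * vdet (axes K @ axes J) * vdet (axes J @ axes I)) =
         (-1) ^ (p * q) * fact p * fact q * w (axes I)"
proof -
  note V = multilinear_vdet[where 'n = 'n] alternating_vdet[where 'n = 'n]
  have *: "(\<Sum>J\<in>indices q. \<Sum>K\<in>indices p. w (axes K) * vdet (axes K @ axes J) * vdet (axes I @ axes J)) =
      fact p * fact q * w (axes I)"
  proof (cases "distinct I")
    case False
    then have nd: "\<not> distinct (axes I :: (real ^ 'n) list)" by (auto simp: distinct_map)
    have "vdet (axes I @ axes J) = 0" for J
      using nd by (intro alternating_not_distinct[OF V(2)]) simp
    then show ?thesis using alternating_not_distinct[OF w(2) nd] by simp
  next
    case True
    let ?PI = "permutations_of_set (set I)" and ?PJ = "permutations_of_set (- set I)"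
    have cardI: "card (set I) = p" using True I by (simp add: distinct_card)
    moreover have "card (set I) + card (- set I) = CARD('n)"
      by (metis Compl_disjoint Compl_partition card_Un_disjoint finite)
    ultimately have cardJ: "card (- set I) = q" using pq by linarith
    have zero: "vdet (axes K @ axes J) = (0::real)" if "\<not> distinct (K @ J)" for K J :: "'n list"
    proof -
      have "\<not> distinct (axes (K @ J) :: (real ^ 'n) list)" using that by (simp only: distinct_map) simp
      from alternating_not_distinct[OF V(2) this] show ?thesis by simp
    qed
    have PJ: "?PJ \<subseteq> indices q" using cardJ by (auto simp: length_finite_permutations_of_set)
    have PI: "?PI \<subseteq> indices p" using cardI by (auto simp: length_finite_permutations_of_set)
    have J0: "vdet (axes I @ axes J) = 0" if "J \<in> indices q - ?PJ" for J
    proof (rule zero, rule)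
      assume d: "distinct (I @ J)"
      then have "card (set J) = q" using that by (simp add: distinct_card)
      moreover have "set J \<subseteq> - set I" using d by auto
      ultimately have "set J = - set I" using cardJ by (intro card_subset_eq) auto
      then show False using that d by (auto simp: permutations_of_set_def)
    qed
    have K0: "vdet (axes K @ axes J) = 0" if "J \<in> ?PJ" "K \<in> indices p - ?PI" for J K
    proof (rule zero, rule)
      assume d: "distinct (K @ J)"
      then have "card (set K) = p" using that by (simp add: distinct_card)
      moreover have "set K \<subseteq> set I" using d that by (auto simp: permutations_of_set_def)
      ultimately have "set K = set I" using cardI by (intro card_subset_eq) auto
      then show False using that d by (auto simp: permutations_of_set_def)
    qed
    \<comment> \<open>Both factors change by the same sign when \<open>K\<close> is
      permuted.\<close>
    have KI: "w (axes K) * vdet (axes K @ axes J) = w (axes I) * vdet (axes I @ axes J)"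
      if "K \<in> ?PI" for K J
    proof (rule symmetric_mset_eq[where F = "\<lambda>L. w (axes L) * vdet (axes L @ axes J)"])
      show "mset K = mset I" using that True set_eq_iff_mset_eq_distinct[of K I]
        by (simp add: permutations_of_set_def)
      fix us ws :: "'n list" and x
      have "w (axes (us @ x # ws)) = (-1) ^ length us * w (axes (x # us @ ws))"
        using alternating_move[OF w, of "axes us"] by simp
      moreover have "vdet (axes (us @ x # ws) @ axes J) =
          (-1) ^ length us * vdet (axes (x # us @ ws) @ axes J)"
        using alternating_move[OF V, of "axes us" _ "axes ws @ axes J"] by simp
      ultimately show "w (axes (us @ x # ws)) * vdet (axes (us @ x # ws) @ axes J) =
          w (axes (x # us @ ws)) * vdet (axes (x # us @ ws) @ axes J)"
        by simp
    qed
    have IJ: "vdet (axes I @ axes J) * vdet (axes I @ axes J) = 1" if "J \<in> ?PJ" for J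
      using vdet_axes_square[of "I @ J"] that True I PJ pq by (auto simp: permutations_of_set_def)
    have "(\<Sum>J\<in>indices q. \<Sum>K\<in>indices p. w (axes K) * vdet (axes K @ axes J) * vdet (axes I @ axes J)) =
        (\<Sum>J\<in>?PJ. \<Sum>K\<in>indices p. w (axes K) * vdet (axes K @ axes J) * vdet (axes I @ axes J))"
      using J0 PJ by (intro sum.mono_neutral_right) auto
    also have "\<dots> = (\<Sum>J\<in>?PJ. \<Sum>K\<in>?PI. w (axes K) * vdet (axes K @ axes J) * vdet (axes I @ axes J))"
      using K0 PI by (intro sum.cong[OF refl] sum.mono_neutral_right) auto
    also have "\<dots> = (\<Sum>J\<in>?PJ. \<Sum>K\<in>?PI. w (axes I))"
    proof (intro sum.cong refl)
      fix J K assume J: "J \<in> ?PJ" and K: "K \<in> ?PI"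
      show "w (axes K) * vdet (axes K @ axes J) * vdet (axes I @ axes J) = w (axes I)"
        unfolding KI[OF K] by (simp add: mult.assoc IJ[OF J])
    qed
    also have "\<dots> = fact p * fact q * w (axes I)"
      by (simp add: cardI cardJ)
    finally show ?thesis .
  qed
  have "vdet (axes J @ axes I) = (-1) ^ (p * q) * vdet (axes I @ axes J)"
    if "J \<in> indices q" for J
    using alternating_swap_blocks[OF V, of "axes J" "axes I"] that I by (simp add: mult.commute)
  then have "(\<Sum>J\<in>indices q. \<Sum>K\<in>indices p.
            w (axes K) * vdet (axes K @ axes J) * vdet (axes J @ axes I)) =
      (\<Sum>J\<in>indices q. \<Sum>K\<in>indices p.
        (-1) ^ (p * q) * (w (axes K) * vdet (axes K @ axes J) * vdet (axes I @ axes J)))"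
    by (intro sum.cong refl) simp
  also have "\<dots> = (-1) ^ (p * q) * (\<Sum>J\<in>indices q. \<Sum>K\<in>indices p.
        w (axes K) * vdet (axes K @ axes J) * vdet (axes I @ axes J))"
    by (simp only: sum_distrib_left)
  finally show ?thesis unfolding * by (simp only: mult.assoc)
qed

section \<open>Positive definite matrices and their orthonormal frames\<close>

lemma matrix_inv_eqI:
  fixes A B :: "real ^ 'n::finite ^ 'n"
  assumes "A ** B = mat 1"
  shows "matrix_inv A = B"
proof -
  have BA: "B ** A = mat 1" using assms by (simp add: matrix_left_right_inverse)
  have "A ** matrix_inv A = mat 1 \<and> matrix_inv A ** A = mat 1"
    unfolding matrix_inv_def by (rule someI[of _ B]) (use assms BA in simp)
  then have "matrix_inv A = B ** A ** matrix_inv A" using BA by simp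
  also have "\<dots> = B"
    using \<open>A ** matrix_inv A = mat 1 \<and> _\<close> by (simp flip: matrix_mul_assoc)
  finally show ?thesis .
qed

definition spd :: "real ^ 'n::finite ^ 'n \<Rightarrow> bool" where
  "spd G \<longleftrightarrow> transpose G = G \<and> (\<forall>v. v \<noteq> 0 \<longrightarrow> 0 < v \<bullet> (G *v v))"

lemma spd_commute: "spd G \<Longrightarrow> u \<bullet> (G *v v) = v \<bullet> (G *v u)"
  by (metis dot_lmul_matrix inner_commute spd_def transpose_matrix_vector)

text \<open>Gram-Schmidt for the inner product with matrix \<open>G\<close>: as long as
  \<open>k < CARD('n)\<close>, some vector lies outside the span of the list, and subtracting its
  projections and normalising gives the next member.\<close>

lemma spd_orthonormal_list:
  fixes G :: "real ^ 'n::finite ^ 'n"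
  assumes "spd G" "k \<le> CARD('n)"
  shows "\<exists>vs. length vs = k \<and>
    (\<forall>i<k. \<forall>j<k. (vs ! i) \<bullet> (G *v (vs ! j)) = (if i = j then 1 else 0))"
  using assms(2)
proof (induction k)
  case 0
  then show ?case by simp
next
  case (Suc k)
  then obtain vs where len: "length vs = k" and
    on: "\<And>i j. i < k \<Longrightarrow> j < k \<Longrightarrow> (vs ! i) \<bullet> (G *v (vs ! j)) = (if i = j then 1 else 0)"
    by auto
  have "dim (span (set vs)) \<le> card (set vs)" by (simp add: dim_le_card')
  also have "\<dots> \<le> k" using len card_length by metis
  also have "k < CARD('n)" using Suc.prems by simp
  finally have "span (set vs) \<noteq> UNIV" by (metis dim_UNIV DIM_cart DIM_real mult.right_neutral order_less_irrefl)
  then obtain v where v: "v \<notin> span (set vs)" by blast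
  define w where "w = v - (\<Sum>i<k. (v \<bullet> (G *v (vs ! i))) *\<^sub>R (vs ! i))"
  have "(\<Sum>i<k. (v \<bullet> (G *v (vs ! i))) *\<^sub>R (vs ! i)) \<in> span (set vs)"
    using len by (intro span_sum span_scale span_base) auto
  then have "w \<noteq> 0" using v unfolding w_def by auto
  then have pos: "0 < w \<bullet> (G *v w)" using assms(1) by (simp add: spd_def)
  have orth: "w \<bullet> (G *v (vs ! j)) = 0" if "j < k" for j
  proof -
    have "w \<bullet> (G *v (vs ! j)) = v \<bullet> (G *v (vs ! j)) -
        (\<Sum>i<k. (v \<bullet> (G *v (vs ! i))) * ((vs ! i) \<bullet> (G *v (vs ! j))))"
      by (simp add: w_def inner_diff_left inner_sum_left)
    also have "(\<Sum>i<k. (v \<bullet> (G *v (vs ! i))) * ((vs ! i) \<bullet> (G *v (vs ! j)))) =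
        (\<Sum>i<k. if i = j then v \<bullet> (G *v (vs ! i)) else 0)"
      using on that by (intro sum.cong) auto
    also have "\<dots> = v \<bullet> (G *v (vs ! j))" using that by simp
    finally show ?thesis by simp
  qed
  define u where "u = (1 / sqrt (w \<bullet> (G *v w))) *\<^sub>R w"
  have uu: "u \<bullet> (G *v u) = 1"
    using pos by (simp add: u_def matrix_vector_mult_scaleR divide_simps)
  have uv: "u \<bullet> (G *v (vs ! j)) = 0" "(vs ! j) \<bullet> (G *v u) = 0" if "j < k" for j
    using orth[OF that] spd_commute[OF assms(1), of "vs ! j" u] by (simp_all add: u_def)
  have "(vs @ [u]) ! i \<bullet> (G *v ((vs @ [u]) ! j)) = (if i = j then 1 else 0)"
    if "i < Suc k" "j < Suc k" for i j
    using that on uu uv len by (auto simp: nth_append less_Suc_eq)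
  then show ?case using len by (intro exI[of _ "vs @ [u]"]) auto
qed

text \<open>The columns of \<open>R\<close> are a \<open>G\<close>-orthonormal basis. Consequently
  \<open>R ** transpose R\<close> is the inverse of \<open>G\<close> and
  \<open>(det R)\<^sup>2 * det G = 1\<close>, from which invertibility and positivity of the
  determinant follow.\<close>

lemma spd_factor:
  fixes G :: "real ^ 'n::finite ^ 'n"
  assumes "spd G"
  obtains R :: "real ^ 'n ^ 'n" where "transpose R ** G ** R = mat 1"
proof -
  obtain vs where vs: "\<And>i j. i < CARD('n) \<Longrightarrow> j < CARD('n) \<Longrightarrow>
      (vs ! i) \<bullet> (G *v (vs ! j)) = (if i = j then 1 else 0)"
    using spd_orthonormal_list[OF assms order_refl] by blast
  define R :: "real ^ 'n ^ 'n" where "R = (\<chi> i j. (vs ! enum_index j) $ i)"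
  have "(transpose R ** G ** R) $ i $ j = mat 1 $ i $ j" for i j
  proof -
    have "(transpose R ** G ** R) $ i $ j = (transpose R ** (G ** R)) $ i $ j"
      by (simp only: matrix_mul_assoc)
    also have "\<dots> = (vs ! enum_index i) \<bullet> (G *v (vs ! enum_index j))"
      by (simp add: R_def matrix_matrix_mult_def matrix_vector_mult_def transpose_def inner_vec_def)
    also have "\<dots> = mat 1 $ i $ j" using vs by (simp add: mat_def)
    finally show ?thesis .
  qed
  then show thesis by (intro that[of R]) (simp add: vec_eq_iff)
qed

lemma matrix_inv_factor:
  fixes G R :: "real ^ 'n::finite ^ 'n"
  assumes "transpose R ** G ** R = mat 1"
  shows "matrix_inv G = R ** transpose R"
proof (rule matrix_inv_eqI)
  have "(G ** R) ** transpose R = mat 1"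
    using assms by (subst matrix_left_right_inverse) (simp add: matrix_mul_assoc)
  then show "G ** (R ** transpose R) = mat 1" by (simp add: matrix_mul_assoc)
qed

lemma spd_det_pos:
  fixes G :: "real ^ 'n::finite ^ 'n"
  assumes "spd G"
  shows "0 < det G"
proof -
  obtain R :: "real ^ 'n ^ 'n" where R: "transpose R ** G ** R = mat 1" by (rule spd_factor[OF assms])
  then have "det R * det G * det R = 1" by (metis det_I det_mul det_transpose)
  then have 1: "(det R)\<^sup>2 * det G = 1" by (simp add: power2_eq_square mult_ac)
  then have "det R \<noteq> 0" by auto
  then show ?thesis using 1 by (metis zero_less_mult_pos zero_less_one zero_less_power2)
qed

lemma spd_inverse:
  fixes G :: "real ^ 'n::finite ^ 'n"
  assumes "spd G"
  shows "G ** matrix_inv G = mat 1" "matrix_inv G ** G = mat 1"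
    "transpose (matrix_inv G) = matrix_inv G"
proof -
  obtain R :: "real ^ 'n ^ 'n" where R: "transpose R ** G ** R = mat 1" by (rule spd_factor[OF assms])
  have "(G ** R) ** transpose R = mat 1"
    using R by (subst matrix_left_right_inverse) (simp add: matrix_mul_assoc)
  then show 1: "G ** matrix_inv G = mat 1"
    by (simp add: matrix_inv_factor[OF R] matrix_mul_assoc)
  then show "matrix_inv G ** G = mat 1" by (simp add: matrix_left_right_inverse)
  show "transpose (matrix_inv G) = matrix_inv G"
    by (simp add: matrix_inv_factor[OF R] matrix_transpose_mul)
qed

lemma map_matrix_vector_assoc: "map ((*v) M) (map ((*v) N) vs) = map ((*v) (M ** N)) vs"
  by (simp add: matrix_vector_mul_assoc)

lemma map_matrix_one: "map ((*v) (mat 1 :: real ^ 'n::finite ^ 'n)) vs = vs"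
  by (simp add: map_idI)

lemma spd_pullback:
  fixes G G' L :: "real ^ 'n::finite ^ 'n"
  assumes "spd G" "spd G'" "G = transpose L ** G' ** L"
  shows "det L \<noteq> 0" "sqrt (det G) = \<bar>det L\<bar> * sqrt (det G')"
    "matrix_inv G' = L ** matrix_inv G ** transpose L"
proof -
  have d: "det G = (det L)\<^sup>2 * det G'"
    unfolding assms(3) by (simp add: det_mul power2_eq_square mult_ac)
  then show L0: "det L \<noteq> 0" using spd_det_pos[OF assms(1)] by auto
  show "sqrt (det G) = \<bar>det L\<bar> * sqrt (det G')" by (simp add: d real_sqrt_mult)
  have "transpose L ** (G' ** L ** matrix_inv G) = mat 1"
    using spd_inverse(1)[OF assms(1)] assms(3) by (simp add: matrix_mul_assoc)
  \<comment> \<open>One-sided inverses of square matrices are two-sided; this carries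
    \<open>transpose L\<close> from the left end of the product to the right end.\<close>
  then have "(G' ** L ** matrix_inv G) ** transpose L = mat 1"
    by (simp only: matrix_left_right_inverse)
  then show "matrix_inv G' = L ** matrix_inv G ** transpose L"
    by (intro matrix_inv_eqI) (simp add: matrix_mul_assoc)
qed

text \<open>Summing over \<open>J\<close> evaluates \<open>\<beta>\<close> on vectors raised by the
  inverse Gram matrix. The double sum of the definition becomes a single contraction, to which
  \<open>contraction_transpose\<close> applies.\<close>

lemma form_inner_eq:
  fixes \<beta> :: "(real ^ 'n::finite) list \<Rightarrow> real"
  assumes "spd G" "multilinear p \<beta>"
  shows "form_inner p G \<alpha> \<beta> =
    (\<Sum>I\<in>indices p. \<alpha> (axes I) * \<beta> (map ((*v) (matrix_inv G)) (axes I))) / fact p"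
proof -
  have sym: "matrix_inv G $ i $ j = matrix_inv G $ j $ i" for i j
    using spd_inverse(3)[OF assms(1)] by (metis transpose_def vec_lambda_beta)
  have "(\<Sum>J\<in>indices p. (\<Prod>k<p. matrix_inv G $ (I ! k) $ (J ! k)) * \<alpha> (axes I) * \<beta> (axes J)) =
      \<alpha> (axes I) * \<beta> (map ((*v) (matrix_inv G)) (axes I))" if "I \<in> indices p" for I
  proof -
    have "\<beta> (map ((*v) (matrix_inv G)) (axes I)) =
        (\<Sum>J\<in>indices p. (\<Prod>k<p. matrix_inv G $ (I ! k) $ (J ! k)) * \<beta> (axes J))"
      using multilinear_matrix[OF assms(2)] that sym by simp
    then show ?thesis by (simp add: sum_distrib_left mult_ac)
  qed
  then show ?thesis unfolding form_inner_def by simp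
qed

lemma form_inner_add_left:
  "form_inner p G (\<lambda>vs. \<alpha> vs + \<alpha>' vs) \<beta> = form_inner p G \<alpha> \<beta> + form_inner p G \<alpha>' \<beta>"
  by (simp add: form_inner_def ring_distribs sum.distrib add_divide_distrib)

lemma form_inner_add_right:
  "form_inner p G \<alpha> (\<lambda>vs. \<beta> vs + \<beta>' vs) = form_inner p G \<alpha> \<beta> + form_inner p G \<alpha> \<beta>'"
  by (simp add: form_inner_def ring_distribs sum.distrib add_divide_distrib)

lemma form_inner_scale_right: "form_inner p G \<alpha> (\<lambda>vs. c * \<beta> vs) = c * form_inner p G \<alpha> \<beta>"
  by (simp add: form_inner_def sum_distrib_left mult_ac)

lemma form_inner_zero: "(\<And>vs. \<alpha> vs = 0) \<Longrightarrow> form_inner p G \<alpha> \<beta> = 0"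
  by (simp add: form_inner_def)

text \<open>By \<open>spd_pullback\<close> the inverse Gram matrices satisfy
  \<open>matrix_inv G' = L ** matrix_inv G ** transpose L\<close>; the factor
  \<open>transpose L\<close> moves over to \<open>\<alpha>\<close> and becomes
  \<open>L\<close>.\<close>

lemma form_inner_pullback:
  fixes G G' L :: "real ^ 'n::finite ^ 'n" and \<alpha> \<beta> :: "(real ^ 'n::finite) list \<Rightarrow> real"
  assumes "spd G" "spd G'" "G = transpose L ** G' ** L" "multilinear p \<alpha>" "multilinear p \<beta>"
  shows "form_inner p G (\<lambda>vs. \<alpha> (map ((*v) L) vs)) (\<lambda>vs. \<beta> (map ((*v) L) vs)) =
    form_inner p G' \<alpha> \<beta>"
proof -
  let ?H = "matrix_inv G"
  have lin: "linear ((*v) M)" for M :: "real ^ 'n ^ 'n" by (rule matrix_vector_mul_linear)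
  have "(\<Sum>I\<in>indices p. \<alpha> (axes I) * \<beta> (map ((*v) (L ** ?H)) (map ((*v) (transpose L)) (axes I)))) =
      (\<Sum>I\<in>indices p. \<alpha> (map ((*v) (transpose (transpose L))) (axes I)) *
        \<beta> (map ((*v) (L ** ?H)) (axes I)))"
    by (rule contraction_transpose[where F = "\<lambda>us vs. \<alpha> us * \<beta> (map ((*v) (L ** ?H)) vs)"])
       (rule multilinear_scale_right[OF assms(4)] multilinear_scale[OF multilinear_map[OF assms(5) lin]])+
  then have "(\<Sum>I\<in>indices p. \<alpha> (axes I) * \<beta> (map ((*v) (matrix_inv G')) (axes I))) =
      (\<Sum>I\<in>indices p. \<alpha> (map ((*v) L) (axes I)) * \<beta> (map ((*v) L) (map ((*v) ?H) (axes I))))"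
    by (simp only: map_matrix_vector_assoc transpose_transpose spd_pullback(3)[OF assms(1-3)])
  then show ?thesis
    unfolding form_inner_eq[OF assms(2,5)] form_inner_eq[OF assms(1) multilinear_map[OF assms(5) lin]]
    by (simp only:)
qed

text \<open>With \<open>R ** transpose R\<close> for the inverse of \<open>G\<close>, moving one
  factor to the other side leaves a sum of squares of the values of \<open>\<alpha>\<close> on the
  orthonormal frame formed by the columns of \<open>R\<close>.\<close>

lemma form_inner_pos:
  fixes \<alpha> :: "(real ^ 'n::finite) list \<Rightarrow> real"
  assumes "spd G" "multilinear p \<alpha>"
  shows "0 \<le> form_inner p G \<alpha> \<alpha>" "form_inner p G \<alpha> \<alpha> = 0 \<Longrightarrow> \<alpha> = (\<lambda>_. 0)"
proof -
  obtain R :: "real ^ 'n ^ 'n" where R: "transpose R ** G ** R = mat 1" by (rule spd_factor[OF assms(1)])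
  have lin: "linear ((*v) M)" for M :: "real ^ 'n ^ 'n" by (rule matrix_vector_mul_linear)
  have "(\<Sum>I\<in>indices p. \<alpha> (axes I) * \<alpha> (map ((*v) R) (map ((*v) (transpose R)) (axes I)))) =
      (\<Sum>I\<in>indices p. \<alpha> (map ((*v) (transpose (transpose R))) (axes I)) * \<alpha> (map ((*v) R) (axes I)))"
    by (rule contraction_transpose[where F = "\<lambda>us vs. \<alpha> us * \<alpha> (map ((*v) R) vs)"])
       (intro multilinear_scale multilinear_scale_right assms multilinear_map[OF assms(2) lin])+
  then have eq: "form_inner p G \<alpha> \<alpha> = (\<Sum>I\<in>indices p. (\<alpha> (map ((*v) R) (axes I)))\<^sup>2) / fact p"
    unfolding form_inner_eq[OF assms] matrix_inv_factor[OF R] map_matrix_vector_assoc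
    by (simp only: transpose_transpose power2_eq_square)
  then show "0 \<le> form_inner p G \<alpha> \<alpha>" by (simp add: sum_nonneg)
  assume "form_inner p G \<alpha> \<alpha> = 0"
  then have "\<forall>I\<in>indices p. (\<alpha> (map ((*v) R) (axes I)))\<^sup>2 = 0"
    unfolding eq by (subst sum_nonneg_eq_0_iff[symmetric]) auto
  then have 0: "(\<lambda>vs. \<alpha> (map ((*v) R) vs)) = (\<lambda>_. 0)"
    by (intro multilinear_eqI[OF multilinear_map[OF assms(2) lin] multilinear_zero]) auto
  \<comment> \<open>\<open>R\<close> is invertible, so the values on the frame determine
    \<open>\<alpha>\<close>.\<close>
  have "R ** (transpose R ** G) = mat 1" using R by (simp only: matrix_left_right_inverse)
  then have "\<alpha> vs = \<alpha> (map ((*v) R) (map ((*v) (transpose R ** G)) vs))" for vs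
    by (simp only: map_matrix_vector_assoc map_matrix_one)
  then show "\<alpha> = (\<lambda>_. 0)" using 0 by (metis (no_types))
qed

text \<open>In index notation (\<star>w)_J = s sqrt(det G) / p! w^I \<epsilon>_IJ, where w^I has its
  indices raised by the inverse Gram matrix and \<open>s\<close> is the orientation sign of the
  coordinates. The sum runs over all \<open>I\<close>, hence the division by p!.\<close>

definition star_at ::
  "nat \<Rightarrow> real ^ 'n::finite ^ 'n \<Rightarrow> real \<Rightarrow> ((real ^ 'n) list \<Rightarrow> real) \<Rightarrow> (real ^ 'n) list \<Rightarrow> real" where
  "star_at p G s w vs = s * sqrt (det G) / fact p *
     (\<Sum>I\<in>indices p. w (map ((*v) (matrix_inv G)) (axes I)) * vdet (axes I @ vs))"

lemma multilinear_star_at: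
  fixes G :: "real ^ 'n::finite ^ 'n"
  assumes "p + q = CARD('n)"
  shows "multilinear q (star_at p G s w)"
proof -
  have "multilinear q (\<lambda>vs. vdet (axes I @ vs))" if "length I = p" for I :: "'n list"
    using multilinear_append[of p q vdet "axes I"] multilinear_vdet[where 'n = 'n] assms that by simp
  then show ?thesis
    unfolding star_at_def by (intro multilinear_scale multilinear_sum) auto
qed

lemma alternating_star_at: "alternating (star_at p G s w)"
proof -
  have "vdet (axes I @ vs) = 0" if "i < j" "j < length vs" "vs ! i = vs ! j"
    for I i j and vs :: "(real ^ 'a) list"
    using alternating_append[OF alternating_vdet, of "axes I"] that unfolding alternating_def by blast
  then show ?thesis unfolding alternating_def star_at_def by auto
qed

text \<open>Raising the indices \<open>J\<close> in \<open>vdet\<close> costs the factor 1 / det G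
  and lowers the indices \<open>K\<close>, which undoes the raising in \<open>w\<close>. That factor
  absorbs the two square roots of the determinant, and \<open>double_contraction\<close> does the
  rest.\<close>

lemma star_at_star_at:
  fixes G :: "real ^ 'n::finite ^ 'n"
  assumes G: "spd G" and pq: "p + q = CARD('n)" and s: "s * s = 1"
    and w: "multilinear p w" "alternating w"
  shows "star_at q G s (star_at p G s w) = (\<lambda>vs. (-1) ^ (p * q) * w vs)"
proof (rule multilinear_eqI[of p])
  show "multilinear p (star_at q G s (star_at p G s w))"
    using pq by (intro multilinear_star_at) simp
  show "multilinear p (\<lambda>vs. (-1) ^ (p * q) * w vs)" by (rule multilinear_scale[OF w(1)])
  fix I :: "'n list" assume I: "length I = p"
  let ?H = "matrix_inv G"
  have lin: "linear ((*v) M)" for M :: "real ^ 'n ^ 'n" by (rule matrix_vector_mul_linear)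
  note V = multilinear_vdet[where 'n = 'n]
  have HG: "?H ** G = mat 1" by (rule spd_inverse[OF G])
  \<comment> \<open>\<open>?H\<close> is taken out of the whole list, so that \<open>us\<close>
    picks up \<open>G\<close> as compensation.\<close>
  have raise: "vdet (us @ map ((*v) ?H) vs) = vdet (map ((*v) G) us @ vs) / det G" for us vs
  proof -
    have "us @ map ((*v) ?H) vs = map ((*v) ?H) (map ((*v) G) us @ vs)"
      by (simp only: map_append map_matrix_vector_assoc HG map_matrix_one)
    then have "vdet (us @ map ((*v) ?H) vs) = det ?H * vdet (map ((*v) G) us @ vs)"
      by (simp only: vdet_map)
    moreover have "det ?H * det G = 1" using HG by (metis det_I det_mul)
    ultimately show ?thesis using spd_det_pos[OF G] by (simp add: field_simps)
  qed
  have inner: "(\<Sum>K\<in>indices p. w (map ((*v) ?H) (axes K)) * vdet (axes K @ map ((*v) ?H) (axes J))) =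
      (\<Sum>K\<in>indices p. w (axes K) * vdet (axes K @ axes J)) / det G" if J: "length J = q" for J
  proof -
    have "(\<Sum>K\<in>indices p. w (map ((*v) ?H) (axes K)) * vdet (map ((*v) G) (axes K) @ axes J)) =
        (\<Sum>K\<in>indices p. w (map ((*v) ?H) (map ((*v) (transpose G)) (axes K))) * vdet (axes K @ axes J))"
    proof (rule contraction_transpose[where F = "\<lambda>us vs. w (map ((*v) ?H) us) * vdet (vs @ axes J)"])
      have "multilinear p (\<lambda>vs. vdet (vs @ axes J))"
        using multilinear_append2[of p q vdet "axes J"] V pq J by simp
      then show "multilinear p (\<lambda>vs. w (map ((*v) ?H) us) * vdet (vs @ axes J))" for us
        by (rule multilinear_scale)
      show "multilinear p (\<lambda>us. w (map ((*v) ?H) us) * vdet (vs @ axes J))" for vs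
        by (rule multilinear_scale_right[OF multilinear_map[OF w(1) lin]])
    qed
    also have "transpose G = G" using G by (simp add: spd_def)
    finally show ?thesis
      by (simp only: raise map_matrix_vector_assoc HG map_matrix_one times_divide_eq_right
          flip: sum_divide_distrib)
  qed
  define r where "r = sqrt (det G)"
  have rr: "r * r = det G" using spd_det_pos[OF G] by (simp add: r_def)
  have "star_at q G s (star_at p G s w) (axes I) = s * sqrt (det G) / fact q *
      (\<Sum>J\<in>indices q. s * sqrt (det G) / fact p *
        ((\<Sum>K\<in>indices p. w (axes K) * vdet (axes K @ axes J)) / det G) * vdet (axes J @ axes I))"
    unfolding star_at_def by (intro arg_cong2[where f = "(*)"] sum.cong) (auto simp only: inner mem_Collect_eq)
  also have "\<dots> = s * s * (r * r) / det G / (fact p * fact q) *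
      (\<Sum>J\<in>indices q. \<Sum>K\<in>indices p. w (axes K) * vdet (axes K @ axes J) * vdet (axes J @ axes I))"
    unfolding r_def[symmetric]
    by (simp add: sum_distrib_left sum_distrib_right sum_divide_distrib field_simps)
  also have "\<dots> = (-1) ^ (p * q) * w (axes I)"
    unfolding double_contraction[OF w pq I] rr using spd_det_pos[OF G] s by simp
  finally show "star_at q G s (star_at p G s w) (axes I) = (-1) ^ (p * q) * w (axes I)" .
qed

text \<open>\<open>sqrt (det G)\<close> contributes the absolute value of \<open>det L\<close> and
  \<open>vdet\<close> the reciprocal of \<open>det L\<close>; the factor \<open>sgn (det L)\<close>
  in the third argument cancels the remaining sign. Later \<open>c\<close> is 1 for changes of chart
  and -1 for an orientation reversing isometry.\<close>

lemma star_at_pullback: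
  fixes G G' L :: "real ^ 'n::finite ^ 'n"
  assumes G: "spd G" "spd G'" "G = transpose L ** G' ** L" and pq: "p + q = CARD('n)"
    and w: "multilinear p w" and len: "length vs = q"
  shows "star_at p G (c * sgn (det L) * s) (\<lambda>us. w (map ((*v) L) us)) vs =
    c * star_at p G' s w (map ((*v) L) vs)"
proof -
  let ?H = "matrix_inv G"
  have lin: "linear ((*v) M)" for M :: "real ^ 'n ^ 'n" by (rule matrix_vector_mul_linear)
  note L = spd_pullback[OF G]
  have v: "vdet (us @ vs) = vdet (map ((*v) L) us @ map ((*v) L) vs) / det L" for us
    using vdet_map[of L "us @ vs"] L(1) by (simp add: field_simps)
  have "(\<Sum>I\<in>indices p. vdet (axes I @ map ((*v) L) vs) *
          w (map ((*v) (L ** ?H)) (map ((*v) (transpose L)) (axes I)))) =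
        (\<Sum>I\<in>indices p. vdet (map ((*v) (transpose (transpose L))) (axes I) @ map ((*v) L) vs) *
          w (map ((*v) (L ** ?H)) (axes I)))"
  proof (rule contraction_transpose[where
        F = "\<lambda>us ws. vdet (us @ map ((*v) L) vs) * w (map ((*v) (L ** ?H)) ws)"])
    have "multilinear p (\<lambda>us. vdet (us @ map ((*v) L) vs))"
      using multilinear_append2[of p q vdet "map ((*v) L) vs"] multilinear_vdet[where 'n = 'n] pq len
      by simp
    from multilinear_scale_right[OF this]
    show "multilinear p (\<lambda>us. vdet (us @ map ((*v) L) vs) * w (map ((*v) (L ** ?H)) ws))" for ws .
    show "multilinear p (\<lambda>ws. vdet (us @ map ((*v) L) vs) * w (map ((*v) (L ** ?H)) ws))" for us
      by (rule multilinear_scale[OF multilinear_map[OF w lin]])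
  qed
  then have eq: "(\<Sum>I\<in>indices p. w (map ((*v) L) (map ((*v) ?H) (axes I))) *
        vdet (map ((*v) L) (axes I) @ map ((*v) L) vs)) =
      (\<Sum>I\<in>indices p. w (map ((*v) (matrix_inv G')) (axes I)) * vdet (axes I @ map ((*v) L) vs))"
    by (simp only: map_matrix_vector_assoc L(3) transpose_transpose mult.commute)
  have "star_at p G (c * sgn (det L) * s) (\<lambda>us. w (map ((*v) L) us)) vs =
      c * sgn (det L) * s * (\<bar>det L\<bar> * sqrt (det G')) / fact p *
      ((\<Sum>I\<in>indices p. w (map ((*v) L) (map ((*v) ?H) (axes I))) *
        vdet (map ((*v) L) (axes I) @ map ((*v) L) vs)) / det L)"
    unfolding star_at_def L(2) v[of "axes _"] by (simp only: times_divide_eq_right flip: sum_divide_distrib)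
  also have "\<dots> = c * star_at p G' s w (map ((*v) L) vs)"
    unfolding eq star_at_def using L(1) by (simp add: sgn_if field_simps)
  finally show ?thesis .
qed

section \<open>Coordinate form of the codifferential\<close>

abbreviation remove_nth :: "nat \<Rightarrow> 'b list \<Rightarrow> 'b list" where
  "remove_nth k xs \<equiv> take k xs @ drop (Suc k) xs"

lemma sum_indices_remove:
  fixes f :: "'n::finite \<Rightarrow> 'n list \<Rightarrow> 'b::comm_monoid_add"
  assumes "k \<le> q"
  shows "(\<Sum>L\<in>indices (Suc q). f (L ! k) (remove_nth k L)) = (\<Sum>i\<in>UNIV. \<Sum>J\<in>indices q. f i J)"
proof -
  have "(\<Sum>L\<in>indices (Suc q). f (L ! k) (remove_nth k L)) =
      (\<Sum>(i, J)\<in>UNIV \<times> indices q. f i J)"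
    by (rule sum.reindex_bij_witness[where
          i = "\<lambda>(i, J). take k J @ i # drop k J" and j = "\<lambda>L. (L ! k, remove_nth k L)"])
       (use assms in \<open>auto simp: nth_append min_def simp flip: id_take_nth_drop\<close>)
  then show ?thesis by (simp add: sum.cartesian_product)
qed

text \<open>The sign \<open>(-1) ^ k\<close> in an exterior derivative equals the sign of moving
  argument \<open>k\<close> of \<open>B\<close> to the front. All \<open>Suc q\<close> terms
  therefore contribute the same.\<close>

lemma alternating_sum_remove:
  fixes B :: "(real ^ 'n::finite) list \<Rightarrow> real"
  assumes B: "multilinear p B" "alternating B"
  shows "(\<Sum>L\<in>indices (Suc q). (\<Sum>k<Suc q. (-1) ^ k * f (L ! k) (remove_nth k L)) * B (axes L @ vs)) =
    real (Suc q) * (\<Sum>i\<in>UNIV. \<Sum>J\<in>indices q. f i J * B (axis i 1 # axes J @ vs))"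
proof -
  have move: "B (axes L @ vs) = (-1) ^ k * B (axis (L ! k) 1 # axes (remove_nth k L) @ vs)"
    if "length L = Suc q" "k < Suc q" for L k
  proof -
    have "L = take k L @ (L ! k) # drop (Suc k) L" using that by (simp add: id_take_nth_drop)
    then have "axes L = axes (take k L) @ axis (L ! k) 1 # axes (drop (Suc k) L)"
      by (metis list.simps(9) map_append)
    then show ?thesis
      using alternating_move[OF B, of "axes (take k L)" "axis (L ! k) 1" "axes (drop (Suc k) L) @ vs"]
        that by (simp add: min_def)
  qed
  have "(\<Sum>L\<in>indices (Suc q). (\<Sum>k<Suc q. (-1) ^ k * f (L ! k) (remove_nth k L)) * B (axes L @ vs)) =
      (\<Sum>L\<in>indices (Suc q). \<Sum>k<Suc q. f (L ! k) (remove_nth k L) *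
        B (axis (L ! k) 1 # axes (remove_nth k L) @ vs))"
    unfolding sum_distrib_right
  proof (intro sum.cong refl)
    fix L :: "'n list" and k assume "L \<in> indices (Suc q)" "k \<in> {..<Suc q}"
    then have "B (axes L @ vs) = (-1) ^ k * B (axis (L ! k) 1 # axes (remove_nth k L) @ vs)"
      by (intro move) auto
    then show "(-1) ^ k * f (L ! k) (remove_nth k L) * B (axes L @ vs) =
      f (L ! k) (remove_nth k L) * B (axis (L ! k) 1 # axes (remove_nth k L) @ vs)"
      by (simp flip: power_mult_distrib)
  qed
  also have "\<dots> = (\<Sum>k<Suc q. \<Sum>L\<in>indices (Suc q). f (L ! k) (remove_nth k L) *
        B (axis (L ! k) 1 # axes (remove_nth k L) @ vs))"
    by (rule sum.swap)
  also have "\<dots> = (\<Sum>k<Suc q. \<Sum>i\<in>UNIV. \<Sum>J\<in>indices q. f i J * B (axis i 1 # axes J @ vs))"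
    by (intro sum.cong refl
        sum_indices_remove[where f = "\<lambda>i J. f i J * B (axis i 1 # axes J @ vs)"]) simp
  finally show ?thesis by simp
qed

text \<open>Raising all \<open>CARD('n)\<close> indices of \<open>vdet\<close> costs the determinant
  of the inverse Gram matrix, which cancels the two square roots. The right side is free of the
  metric: up to \<open>s\<close> it is the wedge product of \<open>e\<close> and \<open>a\<close> in
  coordinates.\<close>

lemma form_inner_star_at:
  fixes G :: "real ^ 'n::finite ^ 'n"
  assumes G: "spd G" and pq: "q + p = CARD('n)" and a: "multilinear p a" and e: "multilinear q e"
  shows "sqrt (det G) * form_inner p G a (star_at q G s e) =
    s / (fact p * fact q) * (\<Sum>I\<in>indices p. \<Sum>L\<in>indices q. a (axes I) * e (axes L) * vdet (axes L @ axes I))"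
proof -
  let ?H = "matrix_inv G"
  have lin: "linear ((*v) M)" for M :: "real ^ 'n ^ 'n" by (rule matrix_vector_mul_linear)
  have "det ?H * det G = 1" by (metis det_I det_mul spd_inverse(2)[OF G])
  then have dH: "det ?H = 1 / det G" using spd_det_pos[OF G] by (simp add: field_simps)
  have inner: "(\<Sum>L\<in>indices q. e (map ((*v) ?H) (axes L)) * vdet (axes L @ map ((*v) ?H) (axes I))) =
      (\<Sum>L\<in>indices q. e (axes L) * vdet (axes L @ axes I)) / det G" if I: "length I = p" for I
  proof -
    have "multilinear q (\<lambda>vs. vdet (vs @ map ((*v) ?H) (axes I)))"
      using multilinear_append2[of q p vdet "map ((*v) ?H) (axes I)"] multilinear_vdet[where 'n = 'n] pq I
      by simp
    note m = multilinear_scale[OF this] multilinear_scale_right[OF e]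
    have "(\<Sum>L\<in>indices q. e (axes L) * vdet (map ((*v) ?H) (axes L) @ map ((*v) ?H) (axes I))) =
      (\<Sum>L\<in>indices q. e (map ((*v) (transpose ?H)) (axes L)) * vdet (axes L @ map ((*v) ?H) (axes I)))"
      by (rule contraction_transpose[where F = "\<lambda>us vs. e us * vdet (vs @ map ((*v) ?H) (axes I))"])
         (rule m)+
    then have "(\<Sum>L\<in>indices q. e (map ((*v) ?H) (axes L)) * vdet (axes L @ map ((*v) ?H) (axes I))) =
      (\<Sum>L\<in>indices q. e (axes L) * vdet (map ((*v) ?H) (axes L @ axes I)))"
      by (simp add: spd_inverse(3)[OF G])
    then show ?thesis
      unfolding vdet_map dH by (simp add: sum_divide_distrib)
  qed
  define r where "r = sqrt (det G)"
  have rr: "r * r = det G" using spd_det_pos[OF G] by (simp add: r_def)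
  have "sqrt (det G) * form_inner p G a (star_at q G s e) = sqrt (det G) *
     ((\<Sum>I\<in>indices p. a (axes I) * (s * sqrt (det G) / fact q *
       ((\<Sum>L\<in>indices q. e (axes L) * vdet (axes L @ axes I)) / det G))) / fact p)"
    unfolding form_inner_eq[OF G multilinear_star_at[OF pq]] star_at_def
    by (intro arg_cong2[where f = "(*)"] arg_cong2[where f = "(/)"] sum.cong) (auto simp only: inner mem_Collect_eq)
  also have "\<dots> = (r * r) / det G * (s / (fact p * fact q) *
     (\<Sum>I\<in>indices p. \<Sum>L\<in>indices q. a (axes I) * e (axes L) * vdet (axes L @ axes I)))"
    unfolding r_def[symmetric] by (simp add: sum_distrib_left sum_divide_distrib field_simps)
  finally show ?thesis unfolding rr using spd_det_pos[OF G] by simp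
qed

text \<open>Here \<open>w i\<close> stands for the \<open>i\<close>-th partial derivative of the density obtained by raising the
  indices of a form and multiplying with \<open>sqrt (det g)\<close>; then \<open>xi\<close> and \<open>e\<close> are the partial derivatives
  and the exterior derivative of the Hodge star of the form, and \<open>\<star> d \<star>\<close> turns out to be a divergence.\<close>

lemma star_d_star_divergence:
  fixes w :: "'n::finite \<Rightarrow> (real ^ 'n) list \<Rightarrow> real"
  assumes w: "\<And>i. multilinear (Suc p) (w i)" "\<And>i. alternating (w i)"
    and pq: "Suc p + q = CARD('n)" and ev: "even CARD('n)" and s: "s * s = 1"
    and xi: "\<And>i J. xi i J = s / fact (Suc p) * (\<Sum>K\<in>indices (Suc p). w i (axes K) * vdet (axes K @ axes J))"
    and e: "\<And>L. length L = Suc q \<Longrightarrow> e (axes L) = (\<Sum>k<Suc q. (-1) ^ k * xi (L ! k) (remove_nth k L))"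
  shows "s / (fact p * fact (Suc q)) *
      (\<Sum>I\<in>indices p. \<Sum>L\<in>indices (Suc q). a (axes I) * e (axes L) * vdet (axes L @ axes I)) =
    (\<Sum>I\<in>indices p. \<Sum>i\<in>UNIV. a (axes I) * w i (axis i 1 # axes I)) / fact p"
proof -
  note V = multilinear_vdet[where 'n = 'n] alternating_vdet[where 'n = 'n]
  \<comment> \<open>The exponent has the parity of \<open>p * q\<close>. Since
    \<open>p + 1 + q\<close> is even, one of \<open>p\<close> and \<open>q\<close> is even; here
    even dimension removes the sign depending on the degree.\<close>
  have sgn: "(-1) ^ q * (-1) ^ (Suc p * q) = (1::real)"
  proof -
    have "even (q + Suc p * q)" using pq ev by (cases "even p"; cases "even q") (auto simp: algebra_simps; presburger)+
    then show ?thesis by (simp flip: power_add)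
  qed
  have main: "(\<Sum>L\<in>indices (Suc q). e (axes L) * vdet (axes L @ axes I)) =
      s * fact (Suc q) * (\<Sum>i\<in>UNIV. w i (axis i 1 # axes I))" if I: "length I = p" for I
  proof -
    have "(\<Sum>L\<in>indices (Suc q). e (axes L) * vdet (axes L @ axes I)) =
      (\<Sum>L\<in>indices (Suc q). (\<Sum>k<Suc q. (-1) ^ k * xi (L ! k) (remove_nth k L)) * vdet (axes L @ axes I))"
      by (intro sum.cong refl) (simp only: mem_Collect_eq e)
    also have "\<dots> = real (Suc q) * (\<Sum>i\<in>UNIV. \<Sum>J\<in>indices q. xi i J * vdet (axis i 1 # axes J @ axes I))"
      by (rule alternating_sum_remove[OF V])
    also have "(\<Sum>i\<in>UNIV. \<Sum>J\<in>indices q. xi i J * vdet (axis i 1 # axes J @ axes I)) =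
        (\<Sum>i\<in>UNIV. s * fact q * w i (axis i 1 # axes I))"
    proof (intro sum.cong refl)
      fix i :: 'n
      have "(\<Sum>J\<in>indices q. xi i J * vdet (axis i 1 # axes J @ axes I)) =
        (\<Sum>J\<in>indices q. s / fact (Suc p) * (-1) ^ q * (\<Sum>K\<in>indices (Suc p).
          w i (axes K) * vdet (axes K @ axes J) * vdet (axes J @ axes (i # I))))"
      proof (intro sum.cong refl)
        fix J :: "'n list" assume "J \<in> indices q"
        then have J: "length J = q" by simp
        \<comment> \<open>The index \<open>i\<close> of the derivative joins \<open>I\<close>, so
          that \<open>double_contraction\<close> applies in degree \<open>Suc p\<close> to
          \<open>i # I\<close>.\<close>
        have "vdet (axes J @ axis i 1 # axes I) = (-1) ^ q * vdet (axis i 1 # axes J @ axes I)"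
          using alternating_move[OF V, of "axes J" "axis i 1" "axes I"] J by simp
        then have "vdet (axis i 1 # axes J @ axes I) = (-1) ^ q * vdet (axes J @ axes (i # I))"
          by (simp flip: power_mult_distrib)
        then show "xi i J * vdet (axis i 1 # axes J @ axes I) =
          s / fact (Suc p) * (-1) ^ q * (\<Sum>K\<in>indices (Suc p).
            w i (axes K) * vdet (axes K @ axes J) * vdet (axes J @ axes (i # I)))"
          unfolding xi by (simp add: sum_distrib_left sum_distrib_right mult_ac)
      qed
      also have "\<dots> = s / fact (Suc p) * (-1) ^ q *
          ((-1) ^ (Suc p * q) * fact (Suc p) * fact q * w i (axes (i # I)))"
        using double_contraction[OF w pq, of "i # I" i] I by (simp only: flip: sum_distrib_left) simp
      also have "\<dots> = ((-1) ^ q * (-1) ^ (Suc p * q)) * (s * fact q * w i (axis i 1 # axes I))"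
        by (simp del: fact_Suc)
      finally show "(\<Sum>J\<in>indices q. xi i J * vdet (axis i 1 # axes J @ axes I)) =
          s * fact q * w i (axis i 1 # axes I)"
        unfolding sgn by simp
    qed
    finally show ?thesis by (simp add: sum_distrib_left mult_ac)
  qed
  have "(\<Sum>L\<in>indices (Suc q). a (axes I) * e (axes L) * vdet (axes L @ axes I)) =
      s * fact (Suc q) * (\<Sum>i\<in>UNIV. a (axes I) * w i (axis i 1 # axes I))" if "I \<in> indices p" for I
  proof -
    have "(\<Sum>L\<in>indices (Suc q). a (axes I) * e (axes L) * vdet (axes L @ axes I)) =
        a (axes I) * (\<Sum>L\<in>indices (Suc q). e (axes L) * vdet (axes L @ axes I))"
      by (simp add: sum_distrib_left mult.assoc)
    also have "\<dots> = a (axes I) * (s * fact (Suc q) * (\<Sum>i\<in>UNIV. w i (axis i 1 # axes I)))"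
      using main[of I] that by (simp del: fact_Suc)
    finally show ?thesis by (simp add: sum_distrib_left mult_ac)
  qed
  then have "(\<Sum>I\<in>indices p. \<Sum>L\<in>indices (Suc q). a (axes I) * e (axes L) * vdet (axes L @ axes I)) =
      s * fact (Suc q) * (\<Sum>I\<in>indices p. \<Sum>i\<in>UNIV. a (axes I) * w i (axis i 1 # axes I))"
    by (simp add: sum_distrib_left)
  then show ?thesis using s by (simp add: field_simps del: fact_Suc)
qed

section \<open>Smooth functions\<close>

text \<open>On an open set the derivative at a point depends only on nearby values, so every level
  of the recursion sees only the values on \<open>S\<close>.\<close>

lemma Ck_on_cong:
  assumes "open S" "\<And>x. x \<in> S \<Longrightarrow> f x = g x" "Ck_on k S f"
  shows "Ck_on k S g"
  using assms(2,3)
proof (induction k arbitrary: f g)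
  case 0
  then show ?case by (simp cong: continuous_on_cong)
next
  case (Suc k)
  have der: "(g has_derivative frechet_derivative f (at x)) (at x)" if "x \<in> S" for x
  proof -
    have "f differentiable (at x)"
      using Suc.prems(2) that assms(1) by (simp add: differentiable_on_eq_differentiable_at)
    then have "(f has_derivative frechet_derivative f (at x)) (at x)"
      by (simp add: frechet_derivative_works)
    then show ?thesis
      by (rule has_derivative_transform_within_open[OF _ assms(1) that]) (rule Suc.prems(1))
  qed
  then have "g differentiable_on S"
    using assms(1) by (auto simp: differentiable_on_eq_differentiable_at differentiable_def)
  moreover have "Ck_on k S (\<lambda>x. frechet_derivative g (at x) v)" for v
  proof (rule Suc.IH)
    show "Ck_on k S (\<lambda>x. frechet_derivative f (at x) v)" using Suc.prems(2) by simp
    show "frechet_derivative f (at x) v = frechet_derivative g (at x) v" if "x \<in> S" for x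
      using frechet_derivative_at[OF der[OF that]] by simp
  qed
  ultimately show ?case by simp
qed

text \<open>Replaces the chosen \<open>frechet_derivative\<close> by any explicit formula for the
  derivative; the inductions below all enter through it.\<close>

lemma Ck_on_SucI:
  assumes "open S" "\<And>x. x \<in> S \<Longrightarrow> (f has_derivative f' x) (at x)" "\<And>v. Ck_on k S (\<lambda>x. f' x v)"
  shows "Ck_on (Suc k) S f"
proof -
  have "f differentiable_on S"
    using assms by (auto simp: differentiable_on_eq_differentiable_at differentiable_def)
  moreover have "Ck_on k S (\<lambda>x. frechet_derivative f (at x) v)" for v
    by (rule Ck_on_cong[OF assms(1) _ assms(3)[of v]])
       (use frechet_derivative_at[OF assms(2)] in simp)
  ultimately show ?thesis by simp
qed

lemma Ck_on_Suc_has_derivative: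
  assumes "Ck_on (Suc k) S f" "open S" "x \<in> S"
  shows "(f has_derivative frechet_derivative f (at x)) (at x)"
  using assms by (simp add: differentiable_on_eq_differentiable_at frechet_derivative_works)

lemma Ck_on_SucD: "Ck_on (Suc k) S f \<Longrightarrow> Ck_on k S f"
proof (induction k arbitrary: f)
  case 0
  then show ?case by (simp add: differentiable_imp_continuous_on)
next
  case (Suc k)
  have "Ck_on (Suc k) S (\<lambda>x. frechet_derivative f (at x) v)" for v
    using Suc.prems by (simp only: Ck_on.simps(2)[of "Suc k"])
  then have "Ck_on k S (\<lambda>x. frechet_derivative f (at x) v)" for v
    by (rule Suc.IH)
  then show ?case using Suc.prems by simp
qed

lemma Ck_on_continuous_on: "Ck_on k S f \<Longrightarrow> continuous_on S f"
  by (induction k) (auto dest: differentiable_imp_continuous_on)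

text \<open>Fields and functions on the manifold have explicit formulas only near each point, after
  an auxiliary chart has been fixed there.\<close>

lemma Ck_on_local:
  assumes "open S" "\<And>x. x \<in> S \<Longrightarrow> \<exists>U. open U \<and> x \<in> U \<and> Ck_on k U f"
  shows "Ck_on k S f"
  using assms(2)
proof (induction k arbitrary: f)
  case 0
  have "isCont f x" if "x \<in> S" for x
    using 0[OF that] by (auto simp: continuous_on_eq_continuous_at)
  then show ?case by (simp add: continuous_at_imp_continuous_on)
next
  case (Suc k)
  have "f differentiable (at x)" if "x \<in> S" for x
    using Suc.prems[OF that] by (auto simp: differentiable_on_eq_differentiable_at)
  then have "f differentiable_on S" using assms(1) by (simp add: differentiable_on_eq_differentiable_at)
  moreover have "Ck_on k S (\<lambda>x. frechet_derivative f (at x) v)" for v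
  proof (rule Suc.IH)
    fix x assume "x \<in> S"
    from Suc.prems[OF this] show "\<exists>U. open U \<and> x \<in> U \<and> Ck_on k U (\<lambda>x. frechet_derivative f (at x) v)"
      by auto
  qed
  ultimately show ?case by simp
qed

lemma Ck_on_const [simp]: "open S \<Longrightarrow> Ck_on k S (\<lambda>x. c)"
  by (induction k arbitrary: c) (auto intro!: Ck_on_SucI[where f' = "\<lambda>_ _. 0"])

lemma Ck_on_bounded_linear_compose:
  assumes "bounded_linear L" "open S" "Ck_on k S f"
  shows "Ck_on k S (\<lambda>x. L (f x))"
  using assms(3)
proof (induction k arbitrary: f)
  case 0
  then show ?case using bounded_linear.continuous_on[OF assms(1)] by simp
next
  case (Suc k)
  show ?case
  proof (rule Ck_on_SucI[OF assms(2)])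
    show "((\<lambda>x. L (f x)) has_derivative (\<lambda>v. L (frechet_derivative f (at x) v))) (at x)"
      if "x \<in> S" for x
      by (rule bounded_linear.has_derivative[OF assms(1)
            Ck_on_Suc_has_derivative[OF Suc.prems assms(2) that]])
    show "Ck_on k S (\<lambda>x. L (frechet_derivative f (at x) v))" for v
      by (rule Suc.IH) (use Suc.prems in simp)
  qed
qed

lemma Ck_on_ident: "open S \<Longrightarrow> Ck_on k S (\<lambda>x. x)"
  by (cases k) (auto intro!: Ck_on_SucI[where f' = "\<lambda>_ v. v"])

lemma Ck_on_add:
  assumes "open S" "Ck_on k S f" "Ck_on k S g"
  shows "Ck_on k S (\<lambda>x. f x + g x)"
  using assms(2,3)
proof (induction k arbitrary: f g)
  case 0
  then show ?case by (simp add: continuous_on_add)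
next
  case (Suc k)
  show ?case
  proof (rule Ck_on_SucI[OF assms(1)])
    show "((\<lambda>x. f x + g x) has_derivative
        (\<lambda>v. frechet_derivative f (at x) v + frechet_derivative g (at x) v)) (at x)" if "x \<in> S" for x
      by (intro has_derivative_add Ck_on_Suc_has_derivative[OF Suc.prems(1) assms(1) that]
          Ck_on_Suc_has_derivative[OF Suc.prems(2) assms(1) that])
    show "Ck_on k S (\<lambda>x. frechet_derivative f (at x) v + frechet_derivative g (at x) v)" for v
      by (rule Suc.IH) (use Suc.prems in simp_all)
  qed
qed

lemma Ck_on_sum:
  assumes "open S" "\<And>i. i \<in> I \<Longrightarrow> Ck_on k S (f i)"
  shows "Ck_on k S (\<lambda>x. \<Sum>i\<in>I. f i x)"
  using assms(2) by (induction I rule: infinite_finite_induct) (auto intro: Ck_on_add assms(1) simp: assms(1))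

lemma Ck_on_bilinear:
  assumes "bounded_bilinear B" "open S" "Ck_on k S f" "Ck_on k S g"
  shows "Ck_on k S (\<lambda>x. B (f x) (g x))"
  using assms(3,4)
proof (induction k arbitrary: f g)
  case 0
  then show ?case using bounded_bilinear.continuous_on[OF assms(1)] by simp
next
  case (Suc k)
  show ?case
  proof (rule Ck_on_SucI[OF assms(2)])
    show "((\<lambda>x. B (f x) (g x)) has_derivative
        (\<lambda>v. B (f x) (frechet_derivative g (at x) v) + B (frechet_derivative f (at x) v) (g x))) (at x)"
      if "x \<in> S" for x
      by (rule bounded_bilinear.FDERIV[OF assms(1)
          Ck_on_Suc_has_derivative[OF Suc.prems(1) assms(2) that]
          Ck_on_Suc_has_derivative[OF Suc.prems(2) assms(2) that]])
    show "Ck_on k S (\<lambda>x. B (f x) (frechet_derivative g (at x) v) + B (frechet_derivative f (at x) v) (g x))" for v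
      by (intro Ck_on_add Suc.IH assms(2) Ck_on_SucD[OF Suc.prems(1)] Ck_on_SucD[OF Suc.prems(2)])
         (use Suc.prems in simp_all)
  qed
qed

lemma Ck_on_mult:
  fixes f g :: "'a::real_normed_vector \<Rightarrow> real"
  shows "open S \<Longrightarrow> Ck_on k S f \<Longrightarrow> Ck_on k S g \<Longrightarrow> Ck_on k S (\<lambda>x. f x * g x)"
  by (rule Ck_on_bilinear[OF bounded_bilinear_mult])

lemma Ck_on_prod:
  fixes f :: "'i \<Rightarrow> 'a::real_normed_vector \<Rightarrow> real"
  assumes "open S" "\<And>i. i \<in> I \<Longrightarrow> Ck_on k S (f i)"
  shows "Ck_on k S (\<lambda>x. \<Prod>i\<in>I. f i x)"
  using assms(2) by (induction I rule: infinite_finite_induct) (auto intro: Ck_on_mult assms(1) simp: assms(1))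

text \<open>The recursion differentiates in fixed directions, whereas the chain rule produces the
  moving direction \<open>frechet_derivative g (at x) v\<close>. Expanding it in
  \<open>Basis\<close> leaves fixed directions with coefficients of the right order, and the
  induction goes through.\<close>

lemma Ck_on_compose:
  fixes g :: "'a::real_normed_vector \<Rightarrow> 'b::euclidean_space" and f :: "'b \<Rightarrow> 'c::real_normed_vector"
  assumes "open S" "open T" "g ` S \<subseteq> T" "Ck_on k S g" "Ck_on k T f"
  shows "Ck_on k S (\<lambda>x. f (g x))"
  using assms(4,5)
proof (induction k arbitrary: f)
  case 0
  then show ?case using assms(3) by (auto intro: continuous_on_compose2)
next
  case (Suc k)
  show ?case
  proof (rule Ck_on_SucI[OF assms(1)])
    fix x assume x: "x \<in> S"
    then have gx: "g x \<in> T" using assms(3) by auto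
    have lin: "linear (frechet_derivative f (at (g x)))"
      using Ck_on_Suc_has_derivative[OF Suc.prems(2) assms(2) gx] by (rule has_derivative_linear)
    have "frechet_derivative f (at (g x)) (frechet_derivative g (at x) v) =
      (\<Sum>b\<in>Basis. (frechet_derivative g (at x) v \<bullet> b) *\<^sub>R frechet_derivative f (at (g x)) b)" for v
      by (subst (1) euclidean_representation[of "frechet_derivative g (at x) v", symmetric])
         (simp only: linear_sum[OF lin] linear_scale[OF lin])
    moreover have "((\<lambda>x. f (g x)) has_derivative
        (\<lambda>v. frechet_derivative f (at (g x)) (frechet_derivative g (at x) v))) (at x)"
      by (rule has_derivative_compose[OF Ck_on_Suc_has_derivative[OF Suc.prems(1) assms(1) x]
            Ck_on_Suc_has_derivative[OF Suc.prems(2) assms(2) gx]])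
    ultimately show "((\<lambda>x. f (g x)) has_derivative
      (\<lambda>v. \<Sum>b\<in>Basis. (frechet_derivative g (at x) v \<bullet> b) *\<^sub>R frechet_derivative f (at (g x)) b)) (at x)"
      by simp
  next
    fix v
    have "Ck_on k S (\<lambda>x. frechet_derivative g (at x) v \<bullet> b)" for b
      by (rule Ck_on_bounded_linear_compose[OF bounded_linear_inner_left assms(1)])
         (use Suc.prems(1) in simp)
    moreover have "Ck_on k S (\<lambda>x. frechet_derivative f (at (g x)) b)" for b
      by (rule Suc.IH[OF Ck_on_SucD[OF Suc.prems(1)]]) (use Suc.prems(2) in simp)
    ultimately show "Ck_on k S (\<lambda>x. \<Sum>b\<in>Basis. (frechet_derivative g (at x) v \<bullet> b) *\<^sub>R
        frechet_derivative f (at (g x)) b)"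
      by (intro Ck_on_sum Ck_on_bilinear[OF bounded_bilinear_scaleR] assms(1))
  qed
qed

text \<open>The derivative is a polynomial in \<open>inverse\<close> itself, so the induction
  closes.\<close>

lemma Ck_on_inverse_real: "Ck_on k (- {0}) (inverse :: real \<Rightarrow> real)"
proof (induction k)
  case 0
  then show ?case by (auto intro!: continuous_intros)
next
  case (Suc k)
  show ?case
  proof (rule Ck_on_SucI[where f' = "\<lambda>x v. - (inverse x * v * inverse x)"])
    show "(inverse has_derivative (\<lambda>v. - (inverse x * v * inverse x))) (at x)"
      if "x \<in> - {0}" for x :: real
      using that by (auto intro!: derivative_eq_intros)
    show "Ck_on k (- {0}) (\<lambda>x::real. - (inverse x * v * inverse x))" for v
      by (intro Ck_on_bounded_linear_compose[OF bounded_linear_minus[OF bounded_linear_ident]]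
          Ck_on_mult Suc.IH Ck_on_const) auto
  qed auto
qed

lemma Ck_on_inverse:
  fixes f :: "'a::real_normed_vector \<Rightarrow> real"
  assumes "open S" "Ck_on k S f" "\<And>x. x \<in> S \<Longrightarrow> f x \<noteq> 0"
  shows "Ck_on k S (\<lambda>x. inverse (f x))"
  by (rule Ck_on_compose[OF assms(1) _ _ assms(2) Ck_on_inverse_real]) (use assms(3) in auto)

text \<open>The derivative is a multiple of the inverse of \<open>sqrt\<close>, so the induction
  closes by means of \<open>Ck_on_inverse\<close>.\<close>

lemma Ck_on_sqrt_real: "Ck_on k {0<..} sqrt"
proof (induction k)
  case 0
  then show ?case by (auto intro!: continuous_intros)
next
  case (Suc k)
  show ?case
  proof (rule Ck_on_SucI[where f' = "\<lambda>x v. (v / 2) * inverse (sqrt x)"])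
    show "(sqrt has_derivative (\<lambda>v. v / 2 * inverse (sqrt x))) (at x)" if "x \<in> {0<..}" for x
      using that by (auto intro!: derivative_eq_intros simp: field_simps)
    show "Ck_on k {0<..} (\<lambda>x. v / 2 * inverse (sqrt x))" for v
      by (intro Ck_on_mult Ck_on_inverse Suc.IH Ck_on_const) auto
  qed auto
qed

section \<open>Closure properties of smooth functions\<close>

lemma smooth_on_cong: "open S \<Longrightarrow> (\<And>x. x \<in> S \<Longrightarrow> f x = g x) \<Longrightarrow> smooth_on S f \<Longrightarrow> smooth_on S g"
  using Ck_on_cong unfolding smooth_on_def by blast

lemma smooth_on_local:
  assumes "open S" "\<And>x. x \<in> S \<Longrightarrow> \<exists>U. open U \<and> x \<in> U \<and> smooth_on U f"
  shows "smooth_on S f"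
  unfolding smooth_on_def
proof
  fix k show "Ck_on k S f"
    by (rule Ck_on_local[OF assms(1)]) (use assms(2) in \<open>auto simp: smooth_on_def\<close>)
qed

lemma smooth_on_const: "open S \<Longrightarrow> smooth_on S (\<lambda>x. c)"
  by (simp add: smooth_on_def)

lemma smooth_on_bounded_linear_compose:
  "bounded_linear L \<Longrightarrow> open S \<Longrightarrow> smooth_on S f \<Longrightarrow> smooth_on S (\<lambda>x. L (f x))"
  by (simp add: smooth_on_def Ck_on_bounded_linear_compose)

lemma smooth_on_add: "open S \<Longrightarrow> smooth_on S f \<Longrightarrow> smooth_on S g \<Longrightarrow> smooth_on S (\<lambda>x. f x + g x)"
  by (simp add: smooth_on_def Ck_on_add)

lemma smooth_on_sum: "open S \<Longrightarrow> (\<And>i. i \<in> I \<Longrightarrow> smooth_on S (f i)) \<Longrightarrow> smooth_on S (\<lambda>x. \<Sum>i\<in>I. f i x)"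
  by (simp add: smooth_on_def Ck_on_sum)

lemma smooth_on_mult:
  fixes f g :: "'a::real_normed_vector \<Rightarrow> real"
  shows "open S \<Longrightarrow> smooth_on S f \<Longrightarrow> smooth_on S g \<Longrightarrow> smooth_on S (\<lambda>x. f x * g x)"
  by (simp add: smooth_on_def Ck_on_mult)

lemma smooth_on_prod:
  fixes f :: "'i \<Rightarrow> 'a::real_normed_vector \<Rightarrow> real"
  shows "open S \<Longrightarrow> (\<And>i. i \<in> I \<Longrightarrow> smooth_on S (f i)) \<Longrightarrow> smooth_on S (\<lambda>x. \<Prod>i\<in>I. f i x)"
  by (simp add: smooth_on_def Ck_on_prod)

lemma smooth_on_inverse:
  fixes f :: "'a::real_normed_vector \<Rightarrow> real"
  shows "open S \<Longrightarrow> smooth_on S f \<Longrightarrow> (\<And>x. x \<in> S \<Longrightarrow> f x \<noteq> 0) \<Longrightarrow> smooth_on S (\<lambda>x. inverse (f x))"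
  by (simp add: smooth_on_def Ck_on_inverse)

lemma smooth_on_compose:
  fixes g :: "'a::real_normed_vector \<Rightarrow> 'b::euclidean_space"
  shows "open S \<Longrightarrow> open T \<Longrightarrow> g ` S \<subseteq> T \<Longrightarrow> smooth_on S g \<Longrightarrow> smooth_on T f \<Longrightarrow> smooth_on S (\<lambda>x. f (g x))"
  by (simp add: smooth_on_def Ck_on_compose)

lemma smooth_on_sqrt:
  fixes f :: "'a::real_normed_vector \<Rightarrow> real"
  assumes "open S" "smooth_on S f" "\<And>x. x \<in> S \<Longrightarrow> 0 < f x"
  shows "smooth_on S (\<lambda>x. sqrt (f x))"
  by (rule smooth_on_compose[OF assms(1) _ _ assms(2), of "{0<..}"])
     (use assms(3) Ck_on_sqrt_real in \<open>auto simp: smooth_on_def\<close>)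

lemma smooth_on_frechet_derivative:
  "smooth_on S f \<Longrightarrow> smooth_on S (\<lambda>x. frechet_derivative f (at x) v)"
  unfolding smooth_on_def by (metis Ck_on.simps(2))

lemma smooth_on_has_derivative:
  "smooth_on S f \<Longrightarrow> open S \<Longrightarrow> x \<in> S \<Longrightarrow> (f has_derivative frechet_derivative f (at x)) (at x)"
  unfolding smooth_on_def using Ck_on_Suc_has_derivative by blast

lemma smooth_on_continuous_on: "smooth_on S f \<Longrightarrow> continuous_on S f"
  unfolding smooth_on_def using Ck_on_continuous_on by blast

lemma smooth_on_vec_nth: "open S \<Longrightarrow> smooth_on S f \<Longrightarrow> smooth_on S (\<lambda>x. f x $ i)"
  by (rule smooth_on_bounded_linear_compose[OF bounded_linear_vec_nth])

lemma smooth_on_det: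
  fixes M :: "'a::real_normed_vector \<Rightarrow> real ^ 'n::finite ^ 'n"
  assumes "open S" "\<And>i j. smooth_on S (\<lambda>x. M x $ i $ j)"
  shows "smooth_on S (\<lambda>x. det (M x))"
  unfolding det_def by (intro smooth_on_sum smooth_on_mult smooth_on_prod smooth_on_const assms)

text \<open>Both the function and its arguments move with \<open>z\<close>. Expansion in coordinates
  turns the value into a finite sum of products of smooth functions.\<close>

lemma smooth_on_multilinear:
  fixes T :: "'a::real_normed_vector \<Rightarrow> (real ^ 'n::finite) list \<Rightarrow> real"
  assumes "open S" "\<And>z. z \<in> S \<Longrightarrow> multilinear p (T z)" "\<And>ws. smooth_on S (\<lambda>z. T z ws)"
    and "\<And>b j. b \<in> set bs \<Longrightarrow> smooth_on S (\<lambda>z. U b z $ j)"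
  shows "smooth_on S (\<lambda>z. T z (map (\<lambda>b. U b z) bs))"
proof (cases "length bs = p")
  case True
  have "smooth_on S (\<lambda>z. \<Sum>J\<in>indices p. (\<Prod>k<p. U (bs ! k) z $ (J ! k)) * T z (axes J))"
    using True by (intro smooth_on_sum smooth_on_mult smooth_on_prod assms) auto
  then show ?thesis
  proof (rule smooth_on_cong[OF assms(1), rotated])
    fix z assume "z \<in> S"
    have "(\<Prod>k<p. U (bs ! k) z $ (J ! k)) = (\<Prod>k<p. map (\<lambda>b. U b z) bs ! k $ (J ! k))" for J
      using True by (intro prod.cong) auto
    then show "(\<Sum>J\<in>indices p. (\<Prod>k<p. U (bs ! k) z $ (J ! k)) * T z (axes J)) = T z (map (\<lambda>b. U b z) bs)"
      using multilinear_expand[OF assms(2)[OF \<open>z \<in> S\<close>], of "map (\<lambda>b. U b z) bs"] True by simp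
  qed
next
  case False
  show ?thesis
    by (rule smooth_on_cong[OF assms(1) _ smooth_on_const[OF assms(1), of 0]])
       (use False multilinear_length[OF assms(2)] in simp)
qed

text \<open>Each linear relation between the values holds identically in \<open>z\<close>, and
  uniqueness of the derivative transfers it to \<open>T'\<close>.\<close>

lemma multilinear_derivative:
  fixes T :: "'a::real_normed_vector \<Rightarrow> (real ^ 'n::finite) list \<Rightarrow> real"
  assumes "\<And>z. multilinear p (T z)" "\<And>ws. ((\<lambda>z. T z ws) has_derivative T' ws) (at y)"
  shows "multilinear p (\<lambda>ws. T' ws h)"
proof (rule multilinearI)
  fix vs :: "(real ^ 'n) list" assume "length vs \<noteq> p"
  then have "(\<lambda>z. T z vs) = (\<lambda>z. 0)" using multilinear_length[OF assms(1)] by auto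
  then have "((\<lambda>z. T z vs) has_derivative (\<lambda>_. 0)) (at y)" by simp
  then have "T' vs = (\<lambda>_. 0)" using assms(2) has_derivative_unique by blast
  then show "T' vs h = 0" by simp
next
  fix us ws :: "(real ^ 'n) list"
  note lin = multilinear_middle[OF assms(1), where us = us and ws = ws]
  show "linear (\<lambda>v. T' (us @ v # ws) h)"
  proof (rule linearI)
    fix a b :: "real ^ 'n" and c :: real
    have "(\<lambda>z. T z (us @ (a + b) # ws)) = (\<lambda>z. T z (us @ a # ws) + T z (us @ b # ws))"
      using linear_add[OF lin] by simp
    then have "((\<lambda>z. T z (us @ (a + b) # ws)) has_derivative
        (\<lambda>h. T' (us @ a # ws) h + T' (us @ b # ws) h)) (at y)"
      using has_derivative_add[OF assms(2) assms(2)] by simp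
    then show "T' (us @ (a + b) # ws) h = T' (us @ a # ws) h + T' (us @ b # ws) h"
      using has_derivative_unique[OF assms(2)] by metis
    have "(\<lambda>z. T z (us @ (c *\<^sub>R a) # ws)) = (\<lambda>z. c * T z (us @ a # ws))"
      using linear_scale[OF lin] by simp
    then have "((\<lambda>z. T z (us @ (c *\<^sub>R a) # ws)) has_derivative (\<lambda>h. c * T' (us @ a # ws) h)) (at y)"
      using has_derivative_mult_right[OF assms(2), of c] by simp
    then show "T' (us @ c *\<^sub>R a # ws) h = c *\<^sub>R T' (us @ a # ws) h"
      using has_derivative_unique[OF assms(2)] by (metis real_scaleR_def)
  qed
qed

text \<open>The first argument is expanded in coordinates, which gives products of real functions.
  With \<open>axis i 1\<close> fixed in the first slot the induction hypothesis covers the other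
  arguments, and afterwards the expansion is undone.\<close>

lemma has_derivative_multilinear:
  fixes T :: "'a::real_normed_vector \<Rightarrow> (real ^ 'n::finite) list \<Rightarrow> real"
  assumes "\<And>z. multilinear p (T z)" "\<And>ws. ((\<lambda>z. T z ws) has_derivative T' ws) (at y)"
    and "\<And>b. b \<in> set bs \<Longrightarrow> (U b has_derivative U' b) (at y)"
  shows "((\<lambda>z. T z (map (\<lambda>b. U b z) bs)) has_derivative
     (\<lambda>h. T' (map (\<lambda>b. U b y) bs) h +
       (\<Sum>l<length bs. T y ((map (\<lambda>b. U b y) bs)[l := U' (bs ! l) h])))) (at y)"
  using assms
proof (induction bs arbitrary: p T T')
  case Nil
  then show ?case by simp
next
  case (Cons b bs)
  show ?case
  proof (cases p)
    case 0
    then have z: "T z (v # ws) = 0" for z v ws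
      by (intro multilinear_length[OF Cons.prems(1)]) simp
    have "T' (v # ws) h = 0" for v ws h
      using multilinear_length[OF multilinear_derivative[OF Cons.prems(1,2)], of "v # ws" h] 0 by simp
    then show ?thesis using z by (simp add: lessThan_Suc_eq_insert_0 sum.reindex)
  next
    case (Suc q)
    define ws where "ws z = map (\<lambda>b. U b z) bs" for z
    have m: "multilinear q (\<lambda>vs. T z (v # vs))" for z v
      using Cons.prems(1) Suc multilinear_Cons by blast
    have IH: "((\<lambda>z. T z (axis i 1 # ws z)) has_derivative
       (\<lambda>h. T' (axis i 1 # ws y) h + (\<Sum>l<length bs. T y (axis i 1 # (ws y)[l := U' (bs ! l) h])))) (at y)" for i
      unfolding ws_def
      by (rule Cons.IH[where T = "\<lambda>z vs. T z (axis i 1 # vs)" and T' = "\<lambda>vs. T' (axis i 1 # vs)", OF m])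
         (use Cons.prems in auto)
    have U: "((\<lambda>z. U b z $ i) has_derivative (\<lambda>h. U' b h $ i)) (at y)" for i
      using bounded_linear.has_derivative[OF bounded_linear_vec_nth Cons.prems(3)[of b]] by simp
    have expand: "(\<Sum>i\<in>UNIV. v $ i * T z (axis i 1 # vs)) = T z (v # vs)" for z v vs
      by (rule linear_expand[OF multilinear_head[OF Cons.prems(1)], symmetric])
    have expand': "(\<Sum>i\<in>UNIV. v $ i * T' (axis i 1 # vs) h) = T' (v # vs) h" for v vs h
      by (rule linear_expand[OF multilinear_head[OF multilinear_derivative[OF Cons.prems(1,2)]], symmetric])
    have "((\<lambda>z. \<Sum>i\<in>UNIV. U b z $ i * T z (axis i 1 # ws z)) has_derivative
      (\<lambda>h. \<Sum>i\<in>UNIV. U b y $ i * (T' (axis i 1 # ws y) h +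
          (\<Sum>l<length bs. T y (axis i 1 # (ws y)[l := U' (bs ! l) h]))) +
        U' b h $ i * T y (axis i 1 # ws y))) (at y)"
      by (intro has_derivative_sum has_derivative_mult U IH)
    moreover have "(\<Sum>i\<in>UNIV. U b y $ i * (T' (axis i 1 # ws y) h +
          (\<Sum>l<length bs. T y (axis i 1 # (ws y)[l := U' (bs ! l) h]))) +
        U' b h $ i * T y (axis i 1 # ws y)) =
      T' (U b y # ws y) h + (T y (U' b h # ws y) +
        (\<Sum>l<length bs. T y (U b y # (ws y)[l := U' (bs ! l) h])))" for h
    proof -
      have "(\<Sum>i\<in>UNIV. U b y $ i * (\<Sum>l<length bs. T y (axis i 1 # (ws y)[l := U' (bs ! l) h]))) =
          (\<Sum>l<length bs. T y (U b y # (ws y)[l := U' (bs ! l) h]))"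
        by (simp only: sum_distrib_left expand sum.swap[of _ _ UNIV])
      then show ?thesis by (simp only: distrib_left sum.distrib expand expand')
    qed
    ultimately show ?thesis
      by (simp add: expand ws_def sum.lessThan_Suc_shift del: sum.lessThan_Suc)
  qed
qed

section \<open>Symmetry of second derivatives\<close>

text \<open>The mean value theorem is applied to the increment in direction \<open>w\<close> as a
  function of the step along \<open>v\<close>, and then to the resulting first derivative along
  \<open>w\<close>.\<close>

lemma second_difference:
  fixes f :: "'a::real_normed_vector \<Rightarrow> real"
  assumes "open S" "Ck_on 2 S f" "0 < h"
    and S: "\<And>s t. s \<in> {0..h} \<Longrightarrow> t \<in> {0..h} \<Longrightarrow> y + s *\<^sub>R v + t *\<^sub>R w \<in> S"
  shows "\<exists>s\<in>{0..h}. \<exists>t\<in>{0..h}.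
    f (y + h *\<^sub>R v + h *\<^sub>R w) - f (y + h *\<^sub>R v) - f (y + h *\<^sub>R w) + f y =
    h * h * frechet_derivative (\<lambda>z. frechet_derivative f (at z) v) (at (y + s *\<^sub>R v + t *\<^sub>R w)) w"
proof -
  have C: "Ck_on (Suc 1) S f" using assms(2) by (simp add: numeral_2_eq_2)
  have der: "((\<lambda>s. f (p + s *\<^sub>R u)) has_real_derivative f' u) (at s)"
    if "(f has_derivative f') (at (p + s *\<^sub>R u))" for f :: "'a \<Rightarrow> real" and f' p s u
  proof -
    have "((\<lambda>s. p + s *\<^sub>R u) has_derivative (\<lambda>h. h *\<^sub>R u)) (at s)"
      by (auto intro!: derivative_eq_intros)
    from has_derivative_compose[OF this that]
    have "((\<lambda>s. f (p + s *\<^sub>R u)) has_derivative (\<lambda>h. f' (h *\<^sub>R u))) (at s)" .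
    moreover have "f' (h *\<^sub>R u) = f' u * h" for h
      using linear_scale[OF has_derivative_linear[OF that]] by simp
    ultimately show ?thesis by (simp add: has_field_derivative_def)
  qed
  let ?D = "\<lambda>z. frechet_derivative f (at z) v"
  have "\<exists>s>0. s < h \<and> (f (y + h *\<^sub>R w + h *\<^sub>R v) - f (y + h *\<^sub>R v)) - (f (y + h *\<^sub>R w + 0 *\<^sub>R v) - f (y + 0 *\<^sub>R v)) =
      (h - 0) * (?D (y + h *\<^sub>R w + s *\<^sub>R v) - ?D (y + s *\<^sub>R v))"
  proof (rule MVT2[OF assms(3)])
    fix s assume s: "0 \<le> s" "s \<le> h"
    have "y + h *\<^sub>R w + s *\<^sub>R v \<in> S" "y + s *\<^sub>R v \<in> S"
      using S[of s h] S[of s 0] s assms(3) by (simp_all add: add_ac)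
    then show "((\<lambda>s. f (y + h *\<^sub>R w + s *\<^sub>R v) - f (y + s *\<^sub>R v)) has_real_derivative
        ?D (y + h *\<^sub>R w + s *\<^sub>R v) - ?D (y + s *\<^sub>R v)) (at s)"
      by (intro DERIV_diff der Ck_on_Suc_has_derivative[OF C assms(1)])
  qed
  then obtain s where s: "0 < s" "s < h" and 1:
    "(f (y + h *\<^sub>R w + h *\<^sub>R v) - f (y + h *\<^sub>R v)) - (f (y + h *\<^sub>R w) - f y) =
      h * (?D (y + h *\<^sub>R w + s *\<^sub>R v) - ?D (y + s *\<^sub>R v))"
    by auto
  have "\<exists>t>0. t < h \<and> ?D (y + s *\<^sub>R v + h *\<^sub>R w) - ?D (y + s *\<^sub>R v + 0 *\<^sub>R w) =
      (h - 0) * frechet_derivative ?D (at (y + s *\<^sub>R v + t *\<^sub>R w)) w"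
  proof (rule MVT2[OF assms(3)])
    fix t assume "0 \<le> t" "t \<le> h"
    then have "y + s *\<^sub>R v + t *\<^sub>R w \<in> S" using S[of s t] s by simp
    moreover have "Ck_on (Suc 0) S ?D" using C by simp
    ultimately show "((\<lambda>t. ?D (y + s *\<^sub>R v + t *\<^sub>R w)) has_real_derivative
        frechet_derivative ?D (at (y + s *\<^sub>R v + t *\<^sub>R w)) w) (at t)"
      by (intro der Ck_on_Suc_has_derivative[OF _ assms(1)])
  qed
  then obtain t where t: "0 < t" "t < h" and
    "?D (y + s *\<^sub>R v + h *\<^sub>R w) - ?D (y + s *\<^sub>R v) =
      h * frechet_derivative ?D (at (y + s *\<^sub>R v + t *\<^sub>R w)) w"
    by auto
  with 1 have "f (y + h *\<^sub>R v + h *\<^sub>R w) - f (y + h *\<^sub>R v) - f (y + h *\<^sub>R w) + f y =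
      h * h * frechet_derivative ?D (at (y + s *\<^sub>R v + t *\<^sub>R w)) w"
    by (simp add: algebra_simps)
  then show ?thesis using s t by (intro bexI[of _ s] bexI[of _ t]) auto
qed

text \<open>The second difference is symmetric in \<open>v\<close> and \<open>w\<close>. By
  \<open>second_difference\<close> it is the squared step times either mixed derivative at a point
  near \<open>y\<close>; shrinking steps and continuity give equality at \<open>y\<close>.\<close>

lemma frechet_derivative_symmetric:
  fixes f :: "'a::real_normed_vector \<Rightarrow> real"
  assumes "open S" "Ck_on 2 S f" "y \<in> S"
  shows "frechet_derivative (\<lambda>z. frechet_derivative f (at z) v) (at y) w =
    frechet_derivative (\<lambda>z. frechet_derivative f (at z) w) (at y) v"
proof -
  define D where "D v w z = frechet_derivative (\<lambda>z. frechet_derivative f (at z) v) (at z) w" for v w z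
  have C: "Ck_on (Suc (Suc 0)) S f" using assms(2) by (simp add: numeral_2_eq_2)
  have cont: "isCont (D v w) y" for v w
    using C assms(1,3) unfolding D_def by (simp add: continuous_on_eq_continuous_at)
  obtain r where r: "0 < r" "ball y r \<subseteq> S" using assms(1,3) openE by blast
  \<comment> \<open>The summand 1 keeps \<open>B\<close> positive when \<open>v\<close> and
    \<open>w\<close> are both zero.\<close>
  define B where "B = norm v + norm w + 1"
  have B: "0 < B" by (simp add: B_def add_nonneg_pos)
  \<comment> \<open>Displacements with coefficients up to \<open>h n\<close> then have norm at most
    r / (n + 2), which is strictly below \<open>r\<close> for every \<open>n\<close>.\<close>
  define h where "h n = r / (B * real (n + 2))" for n
  have h: "0 < h n" for n using r B by (simp add: h_def)
  have h0: "h \<longlonglongrightarrow> 0"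
  proof -
    have "(\<lambda>n. (r / B) * (1 / real (n + 2))) \<longlonglongrightarrow> (r / B) * 0"
      by (intro tendsto_mult tendsto_const LIMSEQ_ignore_initial_segment[OF lim_1_over_n])
    then show ?thesis by (simp add: h_def[abs_def])
  qed
  have near: "norm (s *\<^sub>R v + t *\<^sub>R w) \<le> h n * B" if "s \<in> {0..h n}" "t \<in> {0..h n}" for s t n
  proof -
    have "norm (s *\<^sub>R v + t *\<^sub>R w) \<le> s * norm v + t * norm w"
      using that norm_triangle_ineq[of "s *\<^sub>R v" "t *\<^sub>R w"] by simp
    also have "\<dots> \<le> h n * norm v + h n * norm w"
      using that by (intro add_mono mult_right_mono) auto
    also have "\<dots> \<le> h n * B" using h[of n] by (simp add: B_def algebra_simps)
    finally show ?thesis .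
  qed
  have hB: "h n * B < r" for n
  proof -
    have "h n * B = r / real (n + 2)" using B by (simp add: h_def)
    also have "\<dots> < r" using r by (simp add: field_simps add_pos_nonneg)
    finally show ?thesis .
  qed
  have inS: "y + s *\<^sub>R v + t *\<^sub>R w \<in> S" if "s \<in> {0..h n}" "t \<in> {0..h n}" for s t n
  proof -
    have "dist y (y + (s *\<^sub>R v + t *\<^sub>R w)) = norm (s *\<^sub>R v + t *\<^sub>R w)"
      by (metis add_diff_cancel_left' dist_commute dist_norm)
    also have "\<dots> < r" using near[OF that] hB[of n] by (rule order.strict_trans1)
    finally show ?thesis using r(2) by (auto simp only: add.assoc mem_ball subset_iff)
  qed
  have "\<exists>s t s' t'. s \<in> {0..h n} \<and> t \<in> {0..h n} \<and> s' \<in> {0..h n} \<and> t' \<in> {0..h n} \<and>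
      D v w (y + s *\<^sub>R v + t *\<^sub>R w) = D w v (y + s' *\<^sub>R v + t' *\<^sub>R w)" for n
  proof -
    have "\<exists>s\<in>{0..h n}. \<exists>t\<in>{0..h n}.
      f (y + h n *\<^sub>R v + h n *\<^sub>R w) - f (y + h n *\<^sub>R v) - f (y + h n *\<^sub>R w) + f y =
        h n * h n * D v w (y + s *\<^sub>R v + t *\<^sub>R w)"
      unfolding D_def by (rule second_difference[OF assms(1,2) h inS])
    then obtain s t where 1: "s \<in> {0..h n}" "t \<in> {0..h n}"
      "f (y + h n *\<^sub>R v + h n *\<^sub>R w) - f (y + h n *\<^sub>R v) - f (y + h n *\<^sub>R w) + f y =
        h n * h n * D v w (y + s *\<^sub>R v + t *\<^sub>R w)"
      by auto
    have inS': "y + s *\<^sub>R w + t *\<^sub>R v \<in> S" if "s \<in> {0..h n}" "t \<in> {0..h n}" for s t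
      using inS[OF that(2,1)] by (simp only: add_ac)
    have "\<exists>s\<in>{0..h n}. \<exists>t\<in>{0..h n}.
      f (y + h n *\<^sub>R w + h n *\<^sub>R v) - f (y + h n *\<^sub>R w) - f (y + h n *\<^sub>R v) + f y =
        h n * h n * D w v (y + s *\<^sub>R w + t *\<^sub>R v)"
      unfolding D_def by (rule second_difference[OF assms(1,2) h inS'])
    then obtain s' t' where 2: "s' \<in> {0..h n}" "t' \<in> {0..h n}"
      "f (y + h n *\<^sub>R w + h n *\<^sub>R v) - f (y + h n *\<^sub>R w) - f (y + h n *\<^sub>R v) + f y =
        h n * h n * D w v (y + s' *\<^sub>R w + t' *\<^sub>R v)"
      by auto
    have e: "y + h n *\<^sub>R w + h n *\<^sub>R v = y + h n *\<^sub>R v + h n *\<^sub>R w"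
      "y + s' *\<^sub>R w + t' *\<^sub>R v = y + t' *\<^sub>R v + s' *\<^sub>R w" by simp_all
    have "h n * h n * D v w (y + s *\<^sub>R v + t *\<^sub>R w) = h n * h n * D w v (y + t' *\<^sub>R v + s' *\<^sub>R w)"
      using 1(3) 2(3) unfolding e by linarith
    then have "D v w (y + s *\<^sub>R v + t *\<^sub>R w) = D w v (y + t' *\<^sub>R v + s' *\<^sub>R w)"
      using h[of n] by simp
    then show ?thesis using 1 2 by blast
  qed
  then obtain s t s' t' where st: "\<And>n. s n \<in> {0..h n}" "\<And>n. t n \<in> {0..h n}"
      "\<And>n. s' n \<in> {0..h n}" "\<And>n. t' n \<in> {0..h n}"
    and eq: "\<And>n. D v w (y + s n *\<^sub>R v + t n *\<^sub>R w) = D w v (y + s' n *\<^sub>R v + t' n *\<^sub>R w)"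
    by metis
  have zero: "a \<longlonglongrightarrow> 0" if "\<And>n. a n \<in> {0..h n}" for a
    by (rule tendsto_sandwich[OF _ _ tendsto_const h0]) (use that in auto)
  have lim: "(\<lambda>n. y + a n *\<^sub>R v + b n *\<^sub>R w) \<longlonglongrightarrow> y" if "a \<longlonglongrightarrow> 0" "b \<longlonglongrightarrow> 0" for a b
    using tendsto_add[OF tendsto_add[OF tendsto_const[of y] tendsto_scaleR[OF that(1) tendsto_const]]
        tendsto_scaleR[OF that(2) tendsto_const]] by simp
  have "(\<lambda>n. D v w (y + s n *\<^sub>R v + t n *\<^sub>R w)) \<longlonglongrightarrow> D v w y"
    using st by (intro isCont_tendsto_compose[OF cont] lim zero) auto
  moreover have "(\<lambda>n. D w v (y + s' n *\<^sub>R v + t' n *\<^sub>R w)) \<longlonglongrightarrow> D w v y"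
    using st by (intro isCont_tendsto_compose[OF cont] lim zero) auto
  ultimately have "D v w y = D w v y" unfolding eq by (rule LIMSEQ_unique)
  then show ?thesis by (simp add: D_def)
qed

section \<open>Smooth bump functions\<close>

text \<open>Derivatives of exp(-1/t) acquire powers of 1/t. With the exponent \<open>j\<close> as a
  parameter, the linear combinations of these functions are closed under differentiation.\<close>

definition flat_exp :: "nat \<Rightarrow> real \<Rightarrow> real" where
  "flat_exp j t = (if 0 < t then inverse t ^ j * exp (- inverse t) else 0)"

text \<open>With u = 1/t this is the decay of u^j exp(-u) at infinity.\<close>

lemma flat_exp_tendsto_0: "(flat_exp j \<longlongrightarrow> 0) (at 0)"
proof -
  have "((\<lambda>t. inverse t ^ j / exp (inverse t)) \<longlongrightarrow> (0::real)) (at_right 0)"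
    by (rule filterlim_compose[OF tendsto_power_div_exp_0 filterlim_inverse_at_top_right])
  moreover have "eventually (\<lambda>t. inverse t ^ j / exp (inverse t) = flat_exp j t) (at_right 0)"
    by (rule eventually_at_rightI[of 0 1]) (auto simp: flat_exp_def exp_minus field_simps)
  ultimately have "(flat_exp j \<longlongrightarrow> 0) (at_right 0)" by (rule Lim_transform_eventually)
  moreover have "(flat_exp j \<longlongrightarrow> 0) (at_left 0)"
    by (rule Lim_transform_eventually[OF tendsto_const])
       (rule eventually_at_leftI[of "-1"], auto simp: flat_exp_def)
  ultimately show ?thesis by (simp add: filterlim_split_at)
qed

lemma flat_exp_has_derivative:
  "(flat_exp j has_real_derivative (flat_exp (j + 2) t - real j * flat_exp (j + 1) t)) (at t)"
proof (cases t "0::real" rule: linorder_cases)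
  case less
  have "((\<lambda>_. 0) has_real_derivative 0) (at t)" by simp
  then have "(flat_exp j has_real_derivative 0) (at t)"
    by (rule has_field_derivative_transform_within_open[of _ _ _ "{..<0}"])
       (use less in \<open>auto simp: flat_exp_def\<close>)
  then show ?thesis using less by (simp add: flat_exp_def)
next
  case equal
  \<comment> \<open>At 0 the difference quotient of \<open>flat_exp j\<close> is
    \<open>flat_exp (Suc j)\<close>.\<close>
  have "((\<lambda>h. flat_exp j h / h) \<longlongrightarrow> 0) (at 0)"
    by (rule Lim_transform_eventually[OF flat_exp_tendsto_0[of "Suc j"]])
       (auto simp: flat_exp_def field_simps eventually_at intro: exI[of _ 1])
  then show ?thesis using equal by (simp add: DERIV_def flat_exp_def)
next
  case greater
  have "((\<lambda>t. inverse t ^ j * exp (- inverse t)) has_real_derivative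
      (flat_exp (j + 2) t - real j * flat_exp (j + 1) t)) (at t)"
    using greater
    by (auto intro!: derivative_eq_intros simp: flat_exp_def power2_eq_square)
       (cases j; simp add: field_simps)
  then show ?thesis
    by (rule has_field_derivative_transform_within_open[of _ _ _ "{0<..}"])
       (use greater in \<open>auto simp: flat_exp_def\<close>)
qed

lemma smooth_on_flat_exp: "smooth_on UNIV (flat_exp j)"
proof -
  have "Ck_on k UNIV (flat_exp j)" for k
  proof (induction k arbitrary: j)
    case 0
    show ?case using DERIV_isCont[OF flat_exp_has_derivative]
      by (auto intro!: continuous_at_imp_continuous_on)
  next
    case (Suc k)
    show ?case
    proof (rule Ck_on_SucI[where f' = "\<lambda>t v. (flat_exp (j + 2) t + (- real j) * flat_exp (j + 1) t) * v"])
      show "(flat_exp j has_derivative (\<lambda>v. (flat_exp (j + 2) t + (- real j) * flat_exp (j + 1) t) * v)) (at t)" for t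
        using flat_exp_has_derivative[of j t] by (simp add: has_field_derivative_def)
      show "Ck_on k UNIV (\<lambda>t. (flat_exp (j + 2) t + (- real j) * flat_exp (j + 1) t) * v)" for v
        by (intro Ck_on_mult Ck_on_add Suc.IH Ck_on_const) auto
    qed auto
  qed
  then show ?thesis by (simp add: smooth_on_def)
qed

text \<open>The squared distance is a polynomial, so the function is smooth at the centre as
  well.\<close>

definition bump :: "'a::euclidean_space \<Rightarrow> real \<Rightarrow> 'a \<Rightarrow> real" where
  "bump x r z = flat_exp 0 (r\<^sup>2 - (z - x) \<bullet> (z - x))"

lemma smooth_on_bump: "smooth_on UNIV (bump x r)"
proof -
  have "Ck_on k UNIV (\<lambda>z. r\<^sup>2 + (- 1) * ((z + (- x)) \<bullet> (z + (- x))))" for k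
    by (intro Ck_on_add Ck_on_mult Ck_on_bilinear[OF bounded_bilinear_inner] Ck_on_ident Ck_on_const) auto
  then have "smooth_on UNIV (\<lambda>z. r\<^sup>2 - (z - x) \<bullet> (z - x))" by (simp add: smooth_on_def)
  from smooth_on_compose[OF _ _ _ this smooth_on_flat_exp] show ?thesis
    unfolding bump_def[abs_def] by simp
qed

lemma bump_nonneg: "0 \<le> bump x r z"
  by (simp add: bump_def flat_exp_def)

lemma bump_pos_iff: "0 < r \<Longrightarrow> 0 < bump x r z \<longleftrightarrow> z \<in> ball x r"
proof -
  assume r: "0 < r"
  have "(z - x) \<bullet> (z - x) < r\<^sup>2 \<longleftrightarrow> norm (z - x) < r"
    using r by (metis norm_ge_zero norm_lt_square power2_eq_square dot_square_norm abs_le_square_iff not_less power_mono_iff less_imp_le zero_less_numeral pos2)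
  then show ?thesis by (simp add: bump_def flat_exp_def dist_norm norm_minus_commute)
qed

section \<open>Charts\<close>

locale manifold =
  fixes X :: "'a topology" and A :: "('a, 'n::finite) chart set"
  assumes closed_manifold: "closed_manifold X A"
begin

lemma chart_on: "c \<in> A \<Longrightarrow> chart_on X c"
  using closed_manifold by (simp add: closed_manifold_def smooth_atlas_def)

lemma chart_dom_openin: "c \<in> A \<Longrightarrow> openin X (chart_dom c)"
  using chart_on by (auto simp: chart_on_def)

lemma chart_dom_subset: "c \<in> A \<Longrightarrow> chart_dom c \<subseteq> topspace X"
  using chart_dom_openin openin_subset by blast

lemma chart_img_open: "c \<in> A \<Longrightarrow> open (chart_img c)"
  using chart_on by (auto simp: chart_on_def)

lemma chart_homeomorphic:
  "c \<in> A \<Longrightarrow> homeomorphic_map (subtopology X (chart_dom c)) (top_of_set (chart_img c)) (chart_map c)"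
  using chart_on by (auto simp: chart_on_def)

lemma chart_inj: "c \<in> A \<Longrightarrow> inj_on (chart_map c) (chart_dom c)"
  using homeomorphic_imp_injective_map[OF chart_homeomorphic] chart_dom_subset
  by (simp add: topspace_subtopology inf.absorb2)

lemma chart_inv_map [simp]: "c \<in> A \<Longrightarrow> x \<in> chart_dom c \<Longrightarrow> chart_inv c (chart_map c x) = x"
  unfolding chart_inv_def by (rule inv_into_f_f[OF chart_inj])

lemma chart_map_inv [simp]: "y \<in> chart_img c \<Longrightarrow> chart_map c (chart_inv c y) = y"
  unfolding chart_inv_def chart_img_def by (rule f_inv_into_f)

lemma chart_inv_in_dom [simp]: "y \<in> chart_img c \<Longrightarrow> chart_inv c y \<in> chart_dom c"
  unfolding chart_inv_def chart_img_def by (rule inv_into_into)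

lemma chart_map_in_img [simp]: "x \<in> chart_dom c \<Longrightarrow> chart_map c x \<in> chart_img c"
  by (simp add: chart_img_def)

lemma chart_inv_in_topspace: "c \<in> A \<Longrightarrow> y \<in> chart_img c \<Longrightarrow> chart_inv c y \<in> topspace X"
  using chart_dom_subset chart_inv_in_dom by blast

lemma chart_at: "x \<in> topspace X \<Longrightarrow> chart_at A x \<in> A \<and> x \<in> chart_dom (chart_at A x)"
proof -
  assume "x \<in> topspace X"
  then have "\<exists>c. c \<in> A \<and> x \<in> chart_dom c"
    using closed_manifold unfolding closed_manifold_def smooth_atlas_def by blast
  then show ?thesis unfolding chart_at_def by (rule someI_ex)
qed

lemma chart_image_open:
  assumes "c \<in> A" "openin X U" "U \<subseteq> chart_dom c"
  shows "open (chart_map c ` U)"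
proof -
  have "openin (subtopology X (chart_dom c)) U" using assms by (auto simp: openin_subtopology)
  then have "openin (top_of_set (chart_img c)) (chart_map c ` U)"
    using chart_homeomorphic[OF assms(1)]
    by (metis homeomorphic_imp_open_map open_map_def)
  then show ?thesis using chart_img_open[OF assms(1)] openin_open_trans by blast
qed

lemma chart_vimage_openin:
  assumes "c \<in> A" "open V"
  shows "openin X {x \<in> chart_dom c. chart_map c x \<in> V}"
proof -
  have "continuous_map (subtopology X (chart_dom c)) (top_of_set (chart_img c)) (chart_map c)"
    by (rule homeomorphic_imp_continuous_map[OF chart_homeomorphic[OF assms(1)]])
  moreover have "openin (top_of_set (chart_img c)) (chart_img c \<inter> V)" using assms by auto
  ultimately have "openin (subtopology X (chart_dom c))
      {x \<in> topspace (subtopology X (chart_dom c)). chart_map c x \<in> chart_img c \<inter> V}"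
    by (rule openin_continuous_map_preimage)
  moreover have "{x \<in> topspace (subtopology X (chart_dom c)). chart_map c x \<in> chart_img c \<inter> V} =
      {x \<in> chart_dom c. chart_map c x \<in> V}"
    using chart_dom_subset[OF assms(1)] by auto
  ultimately show ?thesis
    using openin_trans_full[OF _ chart_dom_openin[OF assms(1)]] by simp
qed

lemma chart_inv_image_openin:
  assumes "c \<in> A" "open V" "V \<subseteq> chart_img c"
  shows "openin X (chart_inv c ` V)"
proof -
  have "chart_inv c ` V = {x \<in> chart_dom c. chart_map c x \<in> V}"
    using assms by (force simp: image_iff subset_iff)
  then show ?thesis using chart_vimage_openin[OF assms(1,2)] by simp
qed

lemma local_dom_eq:
  assumes "c \<in> A"
  shows "local_dom c f c' = {y \<in> chart_img c. f (chart_inv c y) \<in> chart_dom c'}"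
  unfolding local_dom_def using assms by (force simp: image_iff)

lemma local_dom_open:
  assumes "c \<in> A" "c' \<in> A" "continuous_map X X f"
  shows "open (local_dom c f c')"
proof -
  have "openin X {x \<in> topspace X. f x \<in> chart_dom c'}"
    by (rule openin_continuous_map_preimage[OF assms(3) chart_dom_openin[OF assms(2)]])
  then have "openin X (chart_dom c \<inter> {x \<in> topspace X. f x \<in> chart_dom c'})"
    using chart_dom_openin[OF assms(1)] by blast
  moreover have "chart_dom c \<inter> {x \<in> topspace X. f x \<in> chart_dom c'} = {x \<in> chart_dom c. f x \<in> chart_dom c'}"
    using chart_dom_subset[OF assms(1)] by auto
  ultimately show ?thesis unfolding local_dom_def by (intro chart_image_open assms) auto
qed

lemma local_rep_in_img: "c \<in> A \<Longrightarrow> y \<in> local_dom c f c' \<Longrightarrow> local_rep c f c' y \<in> chart_img c'"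
  by (auto simp: local_dom_eq local_rep_def)

lemma local_dom_subset: "c \<in> A \<Longrightarrow> local_dom c f c' \<subseteq> chart_img c"
  by (auto simp: local_dom_eq)

lemma smooth_map_id: "smooth_map X A id"
  using closed_manifold by (auto simp: smooth_map_def closed_manifold_def smooth_atlas_def)

lemma smooth_map_continuous: "smooth_map X A f \<Longrightarrow> continuous_map X X f"
  by (simp add: smooth_map_def)

lemma smooth_local_rep:
  "smooth_map X A f \<Longrightarrow> c \<in> A \<Longrightarrow> c' \<in> A \<Longrightarrow> smooth_on (local_dom c f c') (local_rep c f c')"
  by (simp add: smooth_map_def)

lemma local_rep_has_derivative:
  assumes "smooth_map X A f" "c \<in> A" "c' \<in> A" "y \<in> local_dom c f c'"
  shows "(local_rep c f c' has_derivative frechet_derivative (local_rep c f c') (at y)) (at y)"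
  by (rule smooth_on_has_derivative[OF smooth_local_rep[OF assms(1-3)] _ assms(4)])
     (intro local_dom_open assms smooth_map_continuous)

text \<open>The chart \<open>c1\<close> catches the intermediate point only on the open set
  \<open>W\<close>. The two coordinate expressions agree there, which is enough for the derivative
  at \<open>y\<close>.\<close>

lemma local_rep_compose:
  assumes f: "smooth_map X A f" and h: "smooth_map X A h" and c: "c \<in> A" "c1 \<in> A" "c2 \<in> A"
    and k: "\<And>x. x \<in> topspace X \<Longrightarrow> k x = h (f x)"
    and y: "y \<in> local_dom c f c1" "local_rep c f c1 y \<in> local_dom c1 h c2"
  shows "y \<in> local_dom c k c2"
    and "local_rep c k c2 y = local_rep c1 h c2 (local_rep c f c1 y)"
    and "frechet_derivative (local_rep c k c2) (at y) =
      (\<lambda>v. frechet_derivative (local_rep c1 h c2) (at (local_rep c f c1 y))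
        (frechet_derivative (local_rep c f c1) (at y) v))"
proof -
  define W where "W = {z \<in> local_dom c f c1. local_rep c f c1 z \<in> local_dom c1 h c2}"
  have W: "z \<in> local_dom c k c2 \<and> local_rep c k c2 z = local_rep c1 h c2 (local_rep c f c1 z)"
    if "z \<in> W" for z
    using that c chart_inv_in_topspace[OF c(1), of z] k[of "chart_inv c z"]
    by (auto simp: W_def local_dom_eq local_rep_def)
  have yW: "y \<in> W" using y by (simp add: W_def)
  from W[OF yW] show "y \<in> local_dom c k c2"
    "local_rep c k c2 y = local_rep c1 h c2 (local_rep c f c1 y)" by auto
  have open1: "open (local_dom c f c1)" and open2: "open (local_dom c1 h c2)"
    using c f h by (auto intro: local_dom_open smooth_map_continuous)
  have "W = local_rep c f c1 -` local_dom c1 h c2 \<inter> local_dom c f c1" by (auto simp: W_def)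
  then have "open W"
    using continuous_on_open_vimage[OF open1] smooth_on_continuous_on[OF smooth_local_rep[OF f c(1,2)]] open2
    by (metis)
  have "((\<lambda>z. local_rep c1 h c2 (local_rep c f c1 z)) has_derivative
    (\<lambda>v. frechet_derivative (local_rep c1 h c2) (at (local_rep c f c1 y))
        (frechet_derivative (local_rep c f c1) (at y) v))) (at y)"
    by (rule has_derivative_compose[OF local_rep_has_derivative[OF f c(1,2) y(1)]
          local_rep_has_derivative[OF h c(2,3) y(2)]])
  then have "(local_rep c k c2 has_derivative
    (\<lambda>v. frechet_derivative (local_rep c1 h c2) (at (local_rep c f c1 y))
        (frechet_derivative (local_rep c f c1) (at y) v))) (at y)"
    by (rule has_derivative_transform_within_open[OF _ \<open>open W\<close> yW]) (use W in auto)
  from frechet_derivative_at[OF this, symmetric]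
  show "frechet_derivative (local_rep c k c2) (at y) =
      (\<lambda>v. frechet_derivative (local_rep c1 h c2) (at (local_rep c f c1 y))
        (frechet_derivative (local_rep c f c1) (at y) v))" .
qed

section \<open>Tensor fields and pullback\<close>

lemma tensor_field_zero:
  "\<omega> \<in> tensor_fields A p \<Longrightarrow> c \<notin> A \<or> y \<notin> chart_img c \<Longrightarrow> \<omega> c y vs = 0"
  unfolding tensor_fields_def mem_Collect_eq by blast

lemma tensor_field_multilinear:
  assumes "\<omega> \<in> tensor_fields A p"
  shows "multilinear p (\<omega> c y)"
proof (cases "c \<in> A \<and> y \<in> chart_img c")
  case False
  then have "\<omega> c y = (\<lambda>_. 0)" by (intro ext tensor_field_zero[OF assms]) blast
  then show ?thesis by (simp add: multilinear_zero)
qed (use assms in \<open>auto simp: tensor_fields_def\<close>)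

lemma tensor_field_smooth:
  "\<omega> \<in> tensor_fields A p \<Longrightarrow> c \<in> A \<Longrightarrow> smooth_on (chart_img c) (\<lambda>y. \<omega> c y vs)"
  by (simp add: tensor_fields_def)

lemma tensor_field_is_pullback: "\<omega> \<in> tensor_fields A p \<Longrightarrow> is_pullback A id \<omega> \<omega>"
  by (simp add: tensor_fields_def)

lemma tensor_field_has_derivative:
  assumes "\<omega> \<in> tensor_fields A p" "y \<in> chart_img c"
  shows "((\<lambda>z. \<omega> c z ws) has_derivative frechet_derivative (\<lambda>z. \<omega> c z ws) (at y)) (at y)"
proof (cases "c \<in> A")
  case True
  show ?thesis
    by (rule smooth_on_has_derivative[OF tensor_field_smooth[OF assms(1) True] chart_img_open[OF True] assms(2)])
next
  case False
  then have "(\<lambda>z. \<omega> c z ws) = (\<lambda>z. 0)" by (intro ext tensor_field_zero[OF assms(1)]) blast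
  then show ?thesis by simp
qed

lemma is_pullbackD:
  "is_pullback A f \<eta> \<omega> \<Longrightarrow> c \<in> A \<Longrightarrow> c' \<in> A \<Longrightarrow> y \<in> local_dom c f c' \<Longrightarrow>
   \<eta> c y vs = \<omega> c' (local_rep c f c' y) (map (frechet_derivative (local_rep c f c') (at y)) vs)"
  by (simp add: is_pullback_def)

text \<open>Choosing a chart around the image point turns the relation \<open>is_pullback\<close>
  into an operator. For tensor fields \<open>pull_eq\<close> shows that the choice does not affect
  the value.\<close>

definition pull :: "('a \<Rightarrow> 'a) \<Rightarrow> ('a, 'n) tensor_field \<Rightarrow> ('a, 'n) tensor_field" where
  "pull f \<omega> c y vs = (if c \<in> A \<and> y \<in> chart_img c then
     let c' = chart_at A (f (chart_inv c y)) in
     \<omega> c' (local_rep c f c' y) (map (frechet_derivative (local_rep c f c') (at y)) vs) else 0)"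

lemma chart_at_local_dom:
  assumes "smooth_map X A f" "c \<in> A" "y \<in> chart_img c"
  shows "chart_at A (f (chart_inv c y)) \<in> A" "y \<in> local_dom c f (chart_at A (f (chart_inv c y)))"
proof -
  have "f (chart_inv c y) \<in> topspace X"
    using smooth_map_continuous[OF assms(1)] chart_inv_in_topspace[OF assms(2,3)]
    by (auto simp: continuous_map_def Pi_iff)
  from chart_at[OF this] show "chart_at A (f (chart_inv c y)) \<in> A"
    "y \<in> local_dom c f (chart_at A (f (chart_inv c y)))"
    using assms by (auto simp: local_dom_eq)
qed

text \<open>The transition rule for \<open>\<omega>\<close> carries the value in the chosen chart
  \<open>?c\<close> to \<open>c'\<close>, and the chain rule combines the two derivatives.\<close>

lemma pull_eq:
  assumes f: "smooth_map X A f" and w: "is_pullback A id \<omega> \<omega>"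
    and c: "c \<in> A" "c' \<in> A" and y: "y \<in> local_dom c f c'"
  shows "pull f \<omega> c y vs =
    \<omega> c' (local_rep c f c' y) (map (frechet_derivative (local_rep c f c') (at y)) vs)"
proof -
  let ?c = "chart_at A (f (chart_inv c y))"
  have img: "y \<in> chart_img c" using y c by (auto simp: local_dom_eq)
  note ca = chart_at_local_dom[OF f c(1) img]
  have y2: "local_rep c f ?c y \<in> local_dom ?c id c'"
    using y ca c by (auto simp: local_dom_eq local_rep_def)
  note comp = local_rep_compose[OF f smooth_map_id c(1) ca(1) c(2) _ ca(2) y2, of f]
  have "pull f \<omega> c y vs =
      \<omega> ?c (local_rep c f ?c y) (map (frechet_derivative (local_rep c f ?c) (at y)) vs)"
    using c img by (simp add: pull_def Let_def)
  also have "\<dots> = \<omega> c' (local_rep c f c' y) (map (frechet_derivative (local_rep c f c') (at y)) vs)"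
    unfolding is_pullbackD[OF w ca(1) c(2) y2] by (simp add: comp(2,3) comp_def)
  finally show ?thesis .
qed

lemma is_pullback_pull:
  "smooth_map X A f \<Longrightarrow> is_pullback A id \<omega> \<omega> \<Longrightarrow> is_pullback A f (pull f \<omega>) \<omega>"
  unfolding is_pullback_def using pull_eq[unfolded is_pullback_def] by blast

text \<open>The default value 0 outside the charts makes the pullback unique as a function.
  Statements about pullbacks thereby become equations for the operator
  \<open>pull f\<close>.\<close>

lemma is_pullback_iff_pull:
  assumes "smooth_map X A f" "is_pullback A id \<omega> \<omega>"
    and "\<And>c y vs. c \<notin> A \<or> y \<notin> chart_img c \<Longrightarrow> \<eta> c y vs = 0"
  shows "is_pullback A f \<eta> \<omega> \<longleftrightarrow> \<eta> = pull f \<omega>"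
proof
  assume p: "is_pullback A f \<eta> \<omega>"
  show "\<eta> = pull f \<omega>"
  proof (intro ext)
    fix c y vs
    show "\<eta> c y vs = pull f \<omega> c y vs"
    proof (cases "c \<in> A \<and> y \<in> chart_img c")
      case True
      then show ?thesis
        using is_pullbackD[OF p _ chart_at_local_dom[OF assms(1)]] by (simp add: pull_def Let_def)
    next
      case False
      then show ?thesis using assms(3) by (auto simp: pull_def)
    qed
  qed
qed (use is_pullback_pull[OF assms(1,2)] in simp)

lemma is_pullback_compose:
  assumes f: "smooth_map X A f" and h: "smooth_map X A h"
    and k: "\<And>x. x \<in> topspace X \<Longrightarrow> k x = h (f x)"
    and p: "is_pullback A f \<eta> \<theta>" "is_pullback A h \<theta> \<omega>"
    and w: "smooth_map X A k" "is_pullback A id \<omega> \<omega>"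
  shows "is_pullback A k \<eta> \<omega>"
  unfolding is_pullback_def
proof (intro ballI allI)
  fix c c2 y vs assume c: "c \<in> A" "c2 \<in> A" and y: "y \<in> local_dom c k c2"
  let ?c1 = "chart_at A (f (chart_inv c y))"
  have img: "y \<in> chart_img c" using y c by (auto simp: local_dom_eq)
  note ca = chart_at_local_dom[OF f c(1) img]
  have y2: "local_rep c f ?c1 y \<in> local_dom ?c1 h c2"
    using y ca c k[OF chart_inv_in_topspace[OF c(1) img]] by (auto simp: local_dom_eq local_rep_def)
  note comp = local_rep_compose[OF f h c(1) ca(1) c(2) k ca(2) y2]
  show "\<eta> c y vs = \<omega> c2 (local_rep c k c2 y) (map (frechet_derivative (local_rep c k c2) (at y)) vs)"
    unfolding is_pullbackD[OF p(1) c(1) ca(1) ca(2)] is_pullbackD[OF p(2) ca(1) c(2) y2]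
    by (simp add: comp(2,3) comp_def)
qed

text \<open>\<open>chart_at\<close> may jump from point to point. Near a given \<open>y\<close> one
  target chart \<open>c'\<close> serves all points, by \<open>pull_eq\<close>, and there the formula
  is a multilinear expression with smooth ingredients.\<close>

lemma pull_smooth:
  assumes f: "smooth_map X A f" and w: "\<omega> \<in> tensor_fields A p" and c: "c \<in> A"
  shows "smooth_on (chart_img c) (\<lambda>y. pull f \<omega> c y vs)"
proof (rule smooth_on_local[OF chart_img_open[OF c]])
  fix y assume y: "y \<in> chart_img c"
  define c' where "c' = chart_at A (f (chart_inv c y))"
  note ca = chart_at_local_dom[OF f c y, folded c'_def]
  define U where "U = local_dom c f c'"
  have U: "open U" "y \<in> U" unfolding U_def
    using ca c f by (auto intro: local_dom_open smooth_map_continuous)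
  note rep = smooth_local_rep[OF f c ca(1), folded U_def]
  have "smooth_on U (\<lambda>z. \<omega> c' (local_rep c f c' z)
      (map (\<lambda>v. frechet_derivative (local_rep c f c') (at z) v) vs))"
  proof (rule smooth_on_multilinear[OF U(1), where p = p])
    show "multilinear p (\<omega> c' (local_rep c f c' z))" for z by (rule tensor_field_multilinear[OF w])
    show "smooth_on U (\<lambda>z. \<omega> c' (local_rep c f c' z) ws)" for ws
      by (rule smooth_on_compose[OF U(1) chart_img_open[OF ca(1)] _ rep tensor_field_smooth[OF w ca(1)]])
         (use local_rep_in_img[OF c] in \<open>unfold U_def, blast\<close>)
    show "smooth_on U (\<lambda>z. frechet_derivative (local_rep c f c') (at z) b $ j)" for b j
      by (rule smooth_on_vec_nth[OF U(1) smooth_on_frechet_derivative[OF rep]])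
  qed
  then have "smooth_on U (\<lambda>y. pull f \<omega> c y vs)"
    by (rule smooth_on_cong[OF U(1), rotated])
       (simp add: pull_eq[OF f tensor_field_is_pullback[OF w] c ca(1)] U_def)
  then show "\<exists>U. open U \<and> y \<in> U \<and> smooth_on U (\<lambda>y. pull f \<omega> c y vs)" using U by blast
qed

lemma pull_tensor_field:
  assumes f: "smooth_map X A f" and w: "\<omega> \<in> tensor_fields A p"
  shows "pull f \<omega> \<in> tensor_fields A p"
proof -
  have "multilinear p (pull f \<omega> c y)" if c: "c \<in> A" and y: "y \<in> chart_img c" for c y
  proof -
    note ca = chart_at_local_dom[OF f c y]
    have "pull f \<omega> c y = (\<lambda>vs. \<omega> (chart_at A (f (chart_inv c y))) (local_rep c f (chart_at A (f (chart_inv c y))) y)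
      (map (frechet_derivative (local_rep c f (chart_at A (f (chart_inv c y)))) (at y)) vs))"
      by (rule ext) (rule pull_eq[OF f tensor_field_is_pullback[OF w] c ca])
    then show ?thesis
      using multilinear_map[OF tensor_field_multilinear[OF w]
          has_derivative_linear[OF local_rep_has_derivative[OF f c ca]]] by simp
  qed
  moreover have "is_pullback A id (pull f \<omega>) (pull f \<omega>)"
    unfolding is_pullback_def
  proof (intro ballI allI)
    fix c c' y vs assume c: "c \<in> A" "c' \<in> A" and y: "y \<in> local_dom c id c'"
    let ?c2 = "chart_at A (f (chart_inv c y))"
    have img: "y \<in> chart_img c" using y c by (auto simp: local_dom_eq)
    note ca = chart_at_local_dom[OF f c(1) img]
    have y2: "local_rep c id c' y \<in> local_dom c' f ?c2"
      using y ca c by (auto simp: local_dom_eq local_rep_def)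
    note comp = local_rep_compose[OF smooth_map_id f c ca(1) _ y y2, of f]
    show "pull f \<omega> c y vs = pull f \<omega> c' (local_rep c id c' y)
        (map (frechet_derivative (local_rep c id c') (at y)) vs)"
      unfolding pull_eq[OF f tensor_field_is_pullback[OF w] c(1) ca]
        pull_eq[OF f tensor_field_is_pullback[OF w] c(2) ca(1) y2]
      by (simp add: comp(2,3) comp_def)
  qed
  moreover have "pull f \<omega> c y vs = 0" if "c \<notin> A \<or> y \<notin> chart_img c" for c y vs
    using that by (auto simp: pull_def)
  ultimately show ?thesis
    unfolding tensor_fields_def using pull_smooth[OF f w] by simp
qed

lemma pull_forms:
  assumes f: "smooth_map X A f" and w: "\<omega> \<in> forms A p"
  shows "pull f \<omega> \<in> forms A p"
proof -
  have wt: "\<omega> \<in> tensor_fields A p" using w by (simp add: forms_def)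
  have "alternating (pull f \<omega> c y)" if c: "c \<in> A" and y: "y \<in> chart_img c" for c y
  proof -
    let ?c = "chart_at A (f (chart_inv c y))"
    note ca = chart_at_local_dom[OF f c y]
    have "pull f \<omega> c y = (\<lambda>vs. \<omega> ?c (local_rep c f ?c y)
      (map (frechet_derivative (local_rep c f ?c) (at y)) vs))"
      by (rule ext) (rule pull_eq[OF f tensor_field_is_pullback[OF wt] c ca])
    moreover have "alternating (\<omega> ?c (local_rep c f ?c y))"
      using w ca local_rep_in_img[OF c] by (auto simp: forms_def)
    ultimately show ?thesis by (simp add: alternating_map)
  qed
  then show ?thesis using pull_tensor_field[OF f wt] by (simp add: forms_def)
qed

lemma pull_id: "\<omega> \<in> tensor_fields A p \<Longrightarrow> pull id \<omega> = \<omega>"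
  using is_pullback_iff_pull[OF smooth_map_id, of \<omega> \<omega>] tensor_field_is_pullback tensor_field_zero
  by metis

lemma pull_involution:
  assumes f: "smooth_map X A f" "\<And>x. x \<in> topspace X \<Longrightarrow> f (f x) = x" and w: "\<omega> \<in> tensor_fields A p"
  shows "pull f (pull f \<omega>) = \<omega>"
proof -
  have "is_pullback A id (pull f (pull f \<omega>)) \<omega>"
    by (rule is_pullback_compose[OF f(1) f(1) _ is_pullback_pull is_pullback_pull smooth_map_id])
       (use f pull_tensor_field[OF f(1) w] tensor_field_is_pullback w in auto)
  then have "pull f (pull f \<omega>) = pull id \<omega>"
    by (subst (asm) is_pullback_iff_pull[OF smooth_map_id tensor_field_is_pullback[OF w]])
       (auto simp: pull_def)
  then show ?thesis using pull_id[OF w] by simp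
qed

section \<open>Forms as a vector space, and their products with functions\<close>

lemma form_tensor_field: "\<omega> \<in> forms A p \<Longrightarrow> \<omega> \<in> tensor_fields A p"
  by (simp add: forms_def)

lemma form_alternating:
  assumes "\<omega> \<in> forms A p"
  shows "alternating (\<omega> c y)"
proof (cases "c \<in> A \<and> y \<in> chart_img c")
  case False
  then have "\<omega> c y = (\<lambda>_. 0)"
    by (intro ext tensor_field_zero[OF form_tensor_field[OF assms]]) blast
  then show ?thesis by (simp add: alternating_def)
qed (use assms in \<open>auto simp: forms_def\<close>)

lemma forms_add:
  assumes "\<omega> \<in> forms A p" "\<eta> \<in> forms A p"
  shows "\<omega> + \<eta> \<in> forms A p"
proof -
  note t = assms[THEN form_tensor_field]
  have "smooth_on (chart_img c) (\<lambda>y. \<omega> c y vs + \<eta> c y vs)" if "c \<in> A" for c vs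
    by (rule smooth_on_add[OF chart_img_open[OF that] tensor_field_smooth[OF t(1) that]
          tensor_field_smooth[OF t(2) that]])
  moreover have "multilinear p (\<omega> c y + \<eta> c y)" for c y
    using multilinear_add[OF tensor_field_multilinear[OF t(1)] tensor_field_multilinear[OF t(2)]]
    by (simp add: plus_fun_def)
  moreover have "alternating (\<omega> c y + \<eta> c y)" for c y
    using form_alternating[OF assms(1)] form_alternating[OF assms(2)] by (simp add: alternating_def)
  moreover have "is_pullback A id (\<omega> + \<eta>) (\<omega> + \<eta>)"
    using t[THEN tensor_field_is_pullback] by (simp add: is_pullback_def)
  ultimately show ?thesis
    using t[THEN tensor_field_zero] by (simp add: forms_def tensor_fields_def)
qed

text \<open>Here \<open>u\<close> is a function on the manifold; with the members of a partition of
  unity this cuts a form into pieces supported in single charts.\<close>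

lemma forms_mult:
  assumes w: "\<omega> \<in> forms A p"
    and u: "\<And>c. c \<in> A \<Longrightarrow> smooth_on (chart_img c) (\<lambda>y. u (chart_inv c y))"
  shows "(\<lambda>c y vs. u (chart_inv c y) * \<omega> c y vs) \<in> forms A p"
proof -
  note t = form_tensor_field[OF w]
  have "smooth_on (chart_img c) (\<lambda>y. u (chart_inv c y) * \<omega> c y vs)" if "c \<in> A" for c vs
    by (rule smooth_on_mult[OF chart_img_open[OF that] u[OF that] tensor_field_smooth[OF t that]])
  moreover have "is_pullback A id (\<lambda>c y vs. u (chart_inv c y) * \<omega> c y vs)
      (\<lambda>c y vs. u (chart_inv c y) * \<omega> c y vs)"
    unfolding is_pullback_def
  proof (intro ballI allI)
    fix c c' y vs assume c: "c \<in> A" "c' \<in> A" and y: "y \<in> local_dom c id c'"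
    then have "chart_inv c' (local_rep c id c' y) = chart_inv c y"
      by (simp add: local_rep_def local_dom_eq)
    then show "u (chart_inv c y) * \<omega> c y vs = u (chart_inv c' (local_rep c id c' y)) *
        \<omega> c' (local_rep c id c' y) (map (frechet_derivative (local_rep c id c') (at y)) vs)"
      using is_pullbackD[OF tensor_field_is_pullback[OF t] c y] by simp
  qed
  moreover have "alternating (\<lambda>vs. u (chart_inv c y) * \<omega> c y vs)" for c y
    using form_alternating[OF w] by (simp add: alternating_def)
  ultimately show ?thesis
    using tensor_field_zero[OF t] multilinear_scale[OF tensor_field_multilinear[OF t]]
    by (simp add: forms_def tensor_fields_def)
qed

lemma forms_scale: "\<omega> \<in> forms A p \<Longrightarrow> tensor_scale r \<omega> \<in> forms A p"
  unfolding tensor_scale_def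
  using forms_mult[of \<omega> p "\<lambda>_. r"] smooth_on_const chart_img_open by auto

lemma forms_zero: "0 \<in> forms A p"
  using smooth_on_const[OF chart_img_open]
  by (auto simp: forms_def tensor_fields_def zero_fun_def multilinear_zero alternating_def is_pullback_def)

end

section \<open>The exterior derivative\<close>

lemma remove_nth_append_left: "k < length us \<Longrightarrow> remove_nth k (us @ ws) = remove_nth k us @ ws"
  by simp

lemma remove_nth_append_right:
  "length us < k \<Longrightarrow> remove_nth k (us @ v # ws) = us @ v # remove_nth (k - Suc (length us)) ws"
  by (auto simp: less_iff_Suc_add)

lemma remove_nth_append_middle: "remove_nth (length us) (us @ v # ws) = us @ ws"
  by simp

lemma map_remove_nth: "map f (remove_nth k xs) = remove_nth k (map f xs)"
  by (simp add: take_map drop_map)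

lemma length_remove_nth: "k < length xs \<Longrightarrow> length (remove_nth k xs) = length xs - 1"
  by simp

lemma nth_remove_nth:
  "k < length xs \<Longrightarrow> l < length xs - 1 \<Longrightarrow> remove_nth k xs ! l = xs ! (if l < k then l else Suc l)"
  by (auto simp: nth_append)

text \<open>The simplicial identity: once position \<open>k\<close> is deleted, the entry that stood
  at \<open>Suc l\<close> stands at \<open>l\<close>.\<close>

lemma remove_nth_remove_nth:
  assumes "k \<le> l" "Suc l < length xs"
  shows "remove_nth l (remove_nth k xs) = remove_nth k (remove_nth (Suc l) xs)"
  by (rule nth_equalityI)
     (use assms in \<open>auto simp: nth_append\<close>)

text \<open>Positions in a list without entry \<open>k\<close> are renamed as positions in the full
  list, where \<open>k\<close> itself contributes 0.\<close>

lemma sum_skip: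
  fixes a b :: "nat \<Rightarrow> real"
  assumes "k < N"
  shows "(\<Sum>l<N - 1. if l < k then a l else b (Suc l)) =
    (\<Sum>j<N. if j < k then a j else if k < j then b j else 0)"
proof -
  have "(\<Sum>j<N. if j < k then a j else if k < j then b j else 0) =
      (\<Sum>j\<in>{..<N} - {k}. if j < k then a j else if k < j then b j else 0)"
    by (rule sum.mono_neutral_right) auto
  also have "\<dots> = (\<Sum>l<N - 1. if l < k then a l else b (Suc l))"
    by (rule sum.reindex_bij_witness[where i = "\<lambda>l. if l < k then l else Suc l"
          and j = "\<lambda>j. if j < k then j else j - 1"])
       (use assms in \<open>auto split: if_splits\<close>)
  finally show ?thesis by simp
qed

lemma alternating_update:
  fixes T :: "(real ^ 'n::finite) list \<Rightarrow> real"
  assumes T: "multilinear p T" "alternating T" and l: "l < length ws"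
  shows "T (ws[l := h]) = (-1) ^ l * T (h # remove_nth l ws)"
proof -
  have "T (ws[l := h]) = T (take l ws @ h # drop (Suc l) ws)"
    using l by (simp only: upd_conv_take_nth_drop)
  also have "\<dots> = (-1) ^ length (take l ws) * T (h # take l ws @ drop (Suc l) ws)"
    by (rule alternating_move[OF T])
  finally show ?thesis using l by simp
qed

text \<open>The sum collects the second derivatives \<open>H\<close> of a coordinate change with differential \<open>D\<close> in the
  exterior derivative of a pullback.\<close>

lemma alternating_symmetric_sum:
  fixes T :: "(real ^ 'n::finite) list \<Rightarrow> real"
  assumes T: "multilinear p T" "alternating T" and H: "\<And>i j. H i j = H j i"
  shows "(\<Sum>k<length vs. (-1) ^ k * (\<Sum>l<length vs - 1.
    T ((remove_nth k (map D vs))[l := H (remove_nth k vs ! l) (vs ! k)]))) = 0"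
proof -
  define N where "N = length vs"
  \<comment> \<open>The entry \<open>H\<close> stands in front and the positions \<open>k\<close>
    and \<open>j\<close> are deleted, the larger one first so that the smaller one is not shifted.
    Symmetry of \<open>H\<close> makes \<open>P\<close> symmetric.\<close>
  define P where "P k j = T (H (vs ! j) (vs ! k) #
    remove_nth (min k j) (remove_nth (max k j) (map D vs)))" for k j
  have P_sym: "P k j = P j k" for k j
    by (simp add: P_def H[of "vs ! j"] min.commute max.commute)
  \<comment> \<open>After deletion of \<open>k\<close>, a position \<open>j > k\<close> has become
    \<open>j - 1\<close>, which costs an extra sign. This makes \<open>S\<close> antisymmetric, and
    its double sum vanishes.\<close>
  define S where "S k j = (if j < k then (-1) ^ (k + j) * P k j
    else if k < j then - ((-1) ^ (k + j) * P k j) else 0)" for k j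
  have S_anti: "S j k = - S k j" for k j
    by (auto simp: S_def P_sym[of j k] add.commute)
  have inner: "(-1) ^ k * (\<Sum>l<N - 1. T ((remove_nth k (map D vs))[l := H (remove_nth k vs ! l) (vs ! k)])) =
      (\<Sum>j<N. S k j)" if k: "k < N" for k
  proof -
    have summand: "(-1) ^ k * T ((remove_nth k (map D vs))[l := H (remove_nth k vs ! l) (vs ! k)]) =
        (if l < k then (-1) ^ (k + l) * P k l else - ((-1) ^ (k + Suc l) * P k (Suc l)))"
      if l: "l < N - 1" for l
    proof -
      let ?ws = "remove_nth k (map D vs)" and ?h = "H (remove_nth k vs ! l) (vs ! k)"
      have len: "length ?ws = N - 1" using k by (simp add: N_def)
      have "T (?ws[l := ?h]) = (-1) ^ l * T (?h # remove_nth l ?ws)"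
        by (rule alternating_update[OF T]) (use l len in linarith)
      moreover have "T (?h # remove_nth l ?ws) = (if l < k then P k l else P k (Suc l))"
      proof (cases "l < k")
        case True
        then show ?thesis using k l by (simp add: P_def nth_append N_def)
      next
        case False
        have "remove_nth l ?ws = remove_nth k (remove_nth (Suc l) (map D vs))"
          by (rule remove_nth_remove_nth) (use False l in \<open>auto simp: N_def\<close>)
        moreover have "remove_nth k vs ! l = vs ! Suc l"
          using nth_remove_nth[of k vs l] k l False by (simp add: N_def)
        ultimately show ?thesis using False unfolding P_def by (simp add: min_def max_def)
      qed
      ultimately show ?thesis by (simp add: power_add)
    qed
    have "(-1) ^ k * (\<Sum>l<N - 1. T ((remove_nth k (map D vs))[l := H (remove_nth k vs ! l) (vs ! k)])) =
        (\<Sum>l<N - 1. if l < k then (-1) ^ (k + l) * P k l else - ((-1) ^ (k + Suc l) * P k (Suc l)))"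
      unfolding sum_distrib_left by (intro sum.cong refl summand) simp
    also have "\<dots> = (\<Sum>j<N. S k j)"
      unfolding S_def by (rule sum_skip[OF k])
    finally show ?thesis .
  qed
  have "(\<Sum>k<N. \<Sum>j<N. S k j) = (\<Sum>k<N. \<Sum>j<N. - S k j)"
    by (subst sum.swap) (intro sum.cong refl S_anti)
  then have "(\<Sum>k<N. \<Sum>j<N. S k j) = 0" by (simp add: sum_negf)
  then show ?thesis using inner by (simp add: N_def)
qed

context manifold begin

lemma ext_d_outside: "y \<notin> chart_img c \<Longrightarrow> ext_d \<omega> c y vs = 0"
  by (simp add: ext_d_def)

lemma ext_d_multilinear:
  assumes w: "\<omega> \<in> tensor_fields A p"
  shows "multilinear (Suc p) (ext_d \<omega> c y)"
proof (cases "y \<in> chart_img c")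
  case False
  then have "ext_d \<omega> c y = (\<lambda>_. 0)" by (auto simp: ext_d_def)
  then show ?thesis by (simp add: multilinear_zero)
next
  case True
  note m = tensor_field_multilinear[OF w]
  note D = tensor_field_has_derivative[OF w True]
  note mD = multilinear_derivative[OF m D]
  show ?thesis
  proof (rule multilinearI)
    fix vs :: "(real ^ 'n) list" assume len: "length vs \<noteq> Suc p"
    have "frechet_derivative (\<lambda>z. \<omega> c z (remove_nth k vs)) (at y) (vs ! k) = 0" if "k < length vs" for k
      by (rule multilinear_length[OF mD]) (use len that in auto)
    then show "ext_d \<omega> c y vs = 0" by (simp add: ext_d_def)
  next
    fix us ws :: "(real ^ 'n) list" assume len: "Suc (length us + length ws) = Suc p"
    have "linear (\<lambda>v. frechet_derivative (\<lambda>z. \<omega> c z (remove_nth k (us @ v # ws))) (at y) ((us @ v # ws) ! k))"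
      if "k < Suc p" for k
    proof (cases k "length us" rule: linorder_cases)
      case less
      then show ?thesis
        using multilinear_middle[OF mD[of "us ! k"], where us = "remove_nth k us" and ws = ws]
        by (simp only: remove_nth_append_left nth_append if_True append_assoc)
    next
      case equal
      then show ?thesis
        using has_derivative_linear[OF D, of "us @ ws"] by (simp add: remove_nth_append_middle)
    next
      case greater
      have "(us @ v # ws) ! k = ws ! (k - Suc (length us))" for v
        using greater by (simp add: nth_append nth_Cons')
      then show ?thesis
        using multilinear_middle[OF mD[of "ws ! (k - Suc (length us))"], where us = us
            and ws = "remove_nth (k - Suc (length us)) ws"]
        by (simp only: remove_nth_append_right[OF greater])
    qed
    then have "linear (\<lambda>v. \<Sum>k<Suc p. (-1) ^ k *
        frechet_derivative (\<lambda>z. \<omega> c z (remove_nth k (us @ v # ws))) (at y) ((us @ v # ws) ! k))"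
      by (intro linear_compose_sum ballI linear_compose_scale_right[of "_ :: _ \<Rightarrow> real", unfolded real_scaleR_def]) auto
    then show "linear (\<lambda>v. ext_d \<omega> c y (us @ v # ws))"
      using len True by (simp add: ext_d_def)
  qed
qed

text \<open>Suppose the entries at \<open>i\<close> and \<open>j\<close> agree. Deleting any other
  entry leaves a repetition, so only the terms \<open>k = i\<close> and \<open>k = j\<close> remain.
  Their argument lists differ by moving the common vector across \<open>mid\<close>, and the parity
  of \<open>j - i\<close>, which is \<open>length mid + 1\<close>, makes the two terms
  cancel.\<close>

lemma ext_d_alternating:
  assumes w: "\<omega> \<in> forms A p"
  shows "alternating (ext_d \<omega> c y)"
  unfolding alternating_def
proof (intro allI impI)
  fix vs :: "(real ^ 'n) list" and i j assume ij: "i < j" "j < length vs" and eq: "vs ! i = vs ! j"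
  note m = tensor_field_multilinear[OF form_tensor_field[OF w]]
  note alt = form_alternating[OF w]
  show "ext_d \<omega> c y vs = 0"
  proof (cases "y \<in> chart_img c")
    case False
    then show ?thesis by (simp add: ext_d_def)
  next
    case True
    note D = tensor_field_has_derivative[OF form_tensor_field[OF w] True]
    define us where "us = take i vs"
    define mid where "mid = drop (Suc i) (take j vs)"
    define ws where "ws = drop (Suc j) vs"
    define x where "x = vs ! i"
    have vs: "vs = us @ x # mid @ x # ws"
    proof -
      have "vs = take j vs @ x # ws"
        using ij eq by (simp add: ws_def x_def id_take_nth_drop)
      moreover have "take j vs = us @ x # mid"
        using id_take_nth_drop[of i "take j vs"] ij by (simp add: us_def mid_def x_def min_def)
      ultimately show ?thesis by simp
    qed
    have i: "i = length us" and j: "j = Suc (length us + length mid)"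
      using ij by (auto simp: us_def mid_def)
    let ?t = "\<lambda>k. (-1) ^ k * frechet_derivative (\<lambda>z. \<omega> c z (remove_nth k vs)) (at y) (vs ! k)"
    have zero: "?t k = 0" if k: "k < length vs" "k \<noteq> i" "k \<noteq> j" for k
    proof -
      have "\<not> distinct (remove_nth k vs)"
      proof -
        \<comment> \<open>\<open>a\<close> and \<open>b\<close> are the positions of the two equal
          entries after the deletion of \<open>k\<close>.\<close>
        define a where "a = (if i < k then i else i - 1)"
        define b where "b = (if j < k then j else j - 1)"
        have ab: "a \<noteq> b" "a < length vs - 1" "b < length vs - 1"
          using k ij by (auto simp: a_def b_def)
        have ai: "(if a < k then a else Suc a) = i" and bj: "(if b < k then b else Suc b) = j"
          using k ij by (auto simp: a_def b_def)
        have "remove_nth k vs ! a = x" "remove_nth k vs ! b = x"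
          by (simp_all only: nth_remove_nth[OF k(1) ab(2)] nth_remove_nth[OF k(1) ab(3)] ai bj x_def eq)
        then show ?thesis
          using ab nth_eq_iff_index_eq[of "remove_nth k vs" a b] length_remove_nth[OF k(1)] by auto
      qed
      then have "(\<lambda>z. \<omega> c z (remove_nth k vs)) = (\<lambda>z. 0)"
        using alternating_not_distinct[OF alt] by blast
      then show ?thesis by simp
    qed
    have "\<omega> c z (remove_nth i vs) = (-1) ^ length mid * \<omega> c z (remove_nth j vs)" for z
    proof -
      have "remove_nth i vs = us @ mid @ x # ws" by (simp add: vs i)
      moreover have "remove_nth j vs = us @ x # mid @ ws" by (simp add: vs j)
      moreover have "\<omega> c z ((us @ mid) @ x # ws) =
          (-1) ^ (length us + length mid) * \<omega> c z (x # (us @ mid) @ ws)"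
        using alternating_move[OF m alt, of c z "us @ mid" x ws] by simp
      moreover have "\<omega> c z (us @ x # mid @ ws) = (-1) ^ length us * \<omega> c z (x # us @ mid @ ws)"
        by (rule alternating_move[OF m alt])
      ultimately show ?thesis by (simp add: power_add)
    qed
    then have "(\<lambda>z. \<omega> c z (remove_nth i vs)) = (\<lambda>z. (-1) ^ length mid * \<omega> c z (remove_nth j vs))"
      by blast
    moreover have "frechet_derivative (\<lambda>z. (-1) ^ length mid * \<omega> c z (remove_nth j vs)) (at y) =
        (\<lambda>h. (-1) ^ length mid * frechet_derivative (\<lambda>z. \<omega> c z (remove_nth j vs)) (at y) h)"
      using frechet_derivative_at[OF has_derivative_mult_right[OF D]] by metis
    ultimately have "?t i + ?t j = 0"
      using eq by (simp add: i j power_add)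
    moreover have "(\<Sum>k<length vs. ?t k) = (\<Sum>k\<in>{i, j}. ?t k)"
      by (rule sum.mono_neutral_right) (use ij zero in auto)
    ultimately show ?thesis
      using ij True by (simp add: ext_d_def)
  qed
qed

lemma ext_d_smooth:
  assumes w: "\<omega> \<in> tensor_fields A p" and c: "c \<in> A"
  shows "smooth_on (chart_img c) (\<lambda>y. ext_d \<omega> c y vs)"
proof -
  note o = chart_img_open[OF c]
  have "smooth_on (chart_img c) (\<lambda>y. \<Sum>k<length vs. (-1) ^ k *
      frechet_derivative (\<lambda>z. \<omega> c z (remove_nth k vs)) (at y) (vs ! k))"
    by (intro smooth_on_sum smooth_on_mult smooth_on_const o smooth_on_frechet_derivative
        tensor_field_smooth[OF w c])
  then show ?thesis
    by (rule smooth_on_cong[OF o, rotated]) (simp add: ext_d_def)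
qed

text \<open>Differentiating the coordinate expression of the pullback gives the pulled back
  derivative of \<open>\<omega>\<close> together with terms in the second derivatives
  \<open>H\<close> of the map. As \<open>H\<close> is symmetric and \<open>\<omega>\<close>
  alternating, these terms cancel by \<open>alternating_symmetric_sum\<close>.\<close>

lemma ext_d_is_pullback:
  assumes f: "smooth_map X A f" and w: "\<omega> \<in> forms A p" and e: "\<eta> \<in> forms A p"
    and p: "is_pullback A f \<eta> \<omega>"
  shows "is_pullback A f (ext_d \<eta>) (ext_d \<omega>)"
  unfolding is_pullback_def
proof (intro ballI allI)
  fix c c' y and vs :: "(real ^ 'n) list"
  assume c: "c \<in> A" "c' \<in> A" and y: "y \<in> local_dom c f c'"
  define U where "U = local_dom c f c'"
  define \<phi> where "\<phi> = local_rep c f c'"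
  define D where "D = frechet_derivative \<phi> (at y)"
  define H where "H v h = frechet_derivative (\<lambda>z. frechet_derivative \<phi> (at z) v) (at y) h" for v h
  have U: "open U" "y \<in> U" using c y f unfolding U_def
    by (auto intro: local_dom_open smooth_map_continuous)
  have img: "y \<in> chart_img c" "\<phi> y \<in> chart_img c'"
    using y local_dom_subset[OF c(1)] local_rep_in_img[OF c(1)] unfolding \<phi>_def by blast+
  have smooth: "smooth_on U \<phi>" unfolding U_def \<phi>_def by (rule smooth_local_rep[OF f c])
  have D: "(\<phi> has_derivative D) (at y)" unfolding D_def by (rule smooth_on_has_derivative[OF smooth U])
  have DH: "((\<lambda>z. frechet_derivative \<phi> (at z) v) has_derivative H v) (at y)" for v
    using smooth_on_has_derivative[OF smooth_on_frechet_derivative[OF smooth] U] by (simp add: H_def[abs_def])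
  \<comment> \<open>Symmetry of second derivatives was shown for real functions, hence the passage
    to components.\<close>
  have H_sym: "H v h = H h v" for v h
  proof -
    have "H v h $ i = frechet_derivative (\<lambda>z. frechet_derivative (\<lambda>z. \<phi> z $ i) (at z) v) (at y) h" for v h i
    proof -
      have nth: "bounded_linear (\<lambda>x::real ^ 'n. x $ i)" by (rule bounded_linear_vec_nth)
      have 1: "frechet_derivative (\<lambda>z. \<phi> z $ i) (at z) v = frechet_derivative \<phi> (at z) v $ i" if "z \<in> U" for z v
        using frechet_derivative_at[OF bounded_linear.has_derivative[OF nth
              smooth_on_has_derivative[OF smooth U(1) that]]] by metis
      have "((\<lambda>z. frechet_derivative \<phi> (at z) v $ i) has_derivative (\<lambda>h. H v h $ i)) (at y)"
        by (rule bounded_linear.has_derivative[OF nth DH])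
      then have "((\<lambda>z. frechet_derivative (\<lambda>z. \<phi> z $ i) (at z) v) has_derivative (\<lambda>h. H v h $ i)) (at y)"
        by (rule has_derivative_transform_within_open[OF _ U]) (simp add: 1)
      from frechet_derivative_at[OF this] show ?thesis by metis
    qed
    moreover have "Ck_on 2 U (\<lambda>z. \<phi> z $ i)" for i
      using smooth_on_vec_nth[OF U(1) smooth] by (simp add: smooth_on_def)
    ultimately show ?thesis
      using frechet_derivative_symmetric[OF U(1) _ U(2)] by (simp add: vec_eq_iff)
  qed
  note wt = form_tensor_field[OF w]
  let ?D\<omega> = "\<lambda>ws h. frechet_derivative (\<lambda>z. \<omega> c' z ws) (at (\<phi> y)) h"
  have der: "frechet_derivative (\<lambda>z. \<eta> c z ws) (at y) h = ?D\<omega> (map D ws) (D h) +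
      (\<Sum>l<length ws. \<omega> c' (\<phi> y) ((map D ws)[l := H (ws ! l) h]))" for ws h
  proof -
    have "((\<lambda>z. \<omega> c' (\<phi> z) (map (\<lambda>v. frechet_derivative \<phi> (at z) v) ws)) has_derivative
      (\<lambda>h. ?D\<omega> (map (\<lambda>v. frechet_derivative \<phi> (at y) v) ws) (D h) +
       (\<Sum>l<length ws. \<omega> c' (\<phi> y) ((map (\<lambda>v. frechet_derivative \<phi> (at y) v) ws)[l := H (ws ! l) h])))) (at y)"
      by (rule has_derivative_multilinear[where T = "\<lambda>z. \<omega> c' (\<phi> z)" and T' = "\<lambda>ws h. ?D\<omega> ws (D h)"
            and U = "\<lambda>v z. frechet_derivative \<phi> (at z) v" and U' = H,
            OF tensor_field_multilinear[OF wt]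
            has_derivative_compose[OF D tensor_field_has_derivative[OF wt img(2)]] DH])
    then have "((\<lambda>z. \<eta> c z ws) has_derivative
      (\<lambda>h. ?D\<omega> (map D ws) (D h) + (\<Sum>l<length ws. \<omega> c' (\<phi> y) ((map D ws)[l := H (ws ! l) h])))) (at y)"
      unfolding D_def
      by (rule has_derivative_transform_within_open[OF _ U])
         (simp add: is_pullbackD[OF p c, folded U_def \<phi>_def])
    from frechet_derivative_at[OF this, symmetric] show ?thesis by (rule fun_cong)
  qed
  have len: "length (remove_nth k vs) = length vs - 1" if "k < length vs" for k
    using that by simp
  have "ext_d \<eta> c y vs = (\<Sum>k<length vs. (-1) ^ k * (?D\<omega> (map D (remove_nth k vs)) (D (vs ! k)) +
      (\<Sum>l<length vs - 1. \<omega> c' (\<phi> y) ((map D (remove_nth k vs))[l := H (remove_nth k vs ! l) (vs ! k)]))))"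
    unfolding ext_d_def der if_P[OF img(1)]
    by (intro sum.cong refl arg_cong2[where f = "(*)"] arg_cong2[where f = "(+)"])
       (simp_all only: len lessThan_iff)
  also have "\<dots> = (\<Sum>k<length vs. (-1) ^ k * ?D\<omega> (map D (remove_nth k vs)) (D (vs ! k))) +
    (\<Sum>k<length vs. (-1) ^ k * (\<Sum>l<length vs - 1.
        \<omega> c' (\<phi> y) ((remove_nth k (map D vs))[l := H (remove_nth k vs ! l) (vs ! k)])))"
    by (simp only: distrib_left sum.distrib map_remove_nth)
  also have "\<dots> = (\<Sum>k<length vs. (-1) ^ k * ?D\<omega> (remove_nth k (map D vs)) (map D vs ! k))"
    using alternating_symmetric_sum[OF tensor_field_multilinear[OF wt] form_alternating[OF w], of H] H_sym
    by (simp add: map_remove_nth del: map_append)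
  also have "\<dots> = ext_d \<omega> c' (\<phi> y) (map D vs)"
    using img(2) by (simp add: ext_d_def)
  finally show "ext_d \<eta> c y vs = ext_d \<omega> c' (local_rep c f c' y)
      (map (frechet_derivative (local_rep c f c') (at y)) vs)"
    by (simp add: D_def \<phi>_def)
qed

text \<open>Independence of the chart is the case of the identity map in
  \<open>ext_d_is_pullback\<close>.\<close>

lemma ext_d_forms:
  assumes w: "\<omega> \<in> forms A p"
  shows "ext_d \<omega> \<in> forms A (Suc p)"
proof -
  note t = form_tensor_field[OF w]
  have "ext_d \<omega> c y vs = 0" if "c \<notin> A \<or> y \<notin> chart_img c" for c y vs
  proof (cases "c \<in> A")
    case True
    then show ?thesis using that by (simp add: ext_d_outside)
  next
    case False
    then have "\<omega> c z ws = 0" for z ws using tensor_field_zero[OF t] by blast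
    then show ?thesis by (simp add: ext_d_def)
  qed
  moreover have "is_pullback A id (ext_d \<omega>) (ext_d \<omega>)"
    by (rule ext_d_is_pullback[OF smooth_map_id w w tensor_field_is_pullback[OF t]])
  ultimately show ?thesis
    using ext_d_multilinear[OF t] ext_d_alternating[OF w] ext_d_smooth[OF t]
    by (simp add: forms_def tensor_fields_def)
qed

lemma ext_d_pull:
  assumes f: "smooth_map X A f" and w: "\<omega> \<in> forms A p"
  shows "ext_d (pull f \<omega>) = pull f (ext_d \<omega>)"
proof -
  note t = form_tensor_field[OF w]
  note d = form_tensor_field[OF ext_d_forms]
  have "is_pullback A f (ext_d (pull f \<omega>)) (ext_d \<omega>)"
    by (rule ext_d_is_pullback[OF f w pull_forms[OF f w] is_pullback_pull[OF f tensor_field_is_pullback[OF t]]])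
  then show ?thesis
    using is_pullback_iff_pull[OF f tensor_field_is_pullback[OF d[OF w]]]
      tensor_field_zero[OF d[OF pull_forms[OF f w]]] by blast
qed

lemma ext_d_add:
  assumes "\<omega> \<in> forms A p" "\<eta> \<in> forms A p"
  shows "ext_d (\<omega> + \<eta>) = ext_d \<omega> + ext_d \<eta>"
proof (intro ext)
  fix c y vs
  note D = tensor_field_has_derivative[OF form_tensor_field]
  have "frechet_derivative (\<lambda>z. \<omega> c z ws + \<eta> c z ws) (at y) h =
      frechet_derivative (\<lambda>z. \<omega> c z ws) (at y) h + frechet_derivative (\<lambda>z. \<eta> c z ws) (at y) h"
    if "y \<in> chart_img c" for ws h
    by (rule fun_cong[OF frechet_derivative_at[OF
          has_derivative_add[OF D[OF assms(1) that] D[OF assms(2) that]], symmetric]])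
  then show "ext_d (\<omega> + \<eta>) c y vs = (ext_d \<omega> + ext_d \<eta>) c y vs"
    by (simp add: ext_d_def distrib_left sum.distrib)
qed

lemma ext_d_scale:
  assumes "\<omega> \<in> forms A p"
  shows "ext_d (tensor_scale r \<omega>) = tensor_scale r (ext_d \<omega>)"
proof (intro ext)
  fix c y vs
  note D = tensor_field_has_derivative[OF form_tensor_field]
  have "frechet_derivative (\<lambda>z. r * \<omega> c z ws) (at y) h = r * frechet_derivative (\<lambda>z. \<omega> c z ws) (at y) h"
    if "y \<in> chart_img c" for ws h
    by (rule fun_cong[OF frechet_derivative_at[OF has_derivative_mult_right[OF D[OF assms that]], symmetric]])
  then show "ext_d (tensor_scale r \<omega>) c y vs = tensor_scale r (ext_d \<omega>) c y vs"
    by (simp add: ext_d_def tensor_scale_def sum_distrib_left mult_ac)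
qed

end

section \<open>The Hodge star of a differential form\<close>

text \<open>Cramer's rule; it exhibits the entries as quotients of polynomials in the entries of
  \<open>M\<close>, from which smoothness is read off.\<close>

lemma matrix_inv_entry:
  fixes M :: "real ^ 'n::finite ^ 'n"
  assumes "spd M"
  shows "matrix_inv M $ i $ j =
    det (\<chi> k l. if l = i then axis j 1 $ k else M $ k $ l) * inverse (det M)"
proof -
  have "M *v (matrix_inv M *v axis j 1) = axis j 1"
    using spd_inverse(1)[OF assms] by (simp add: matrix_vector_mul_assoc)
  then have "matrix_inv M *v axis j 1 = (\<chi> i. det (\<chi> k l. if l = i then axis j 1 $ k else M $ k $ l) / det M)"
    using spd_det_pos[OF assms] by (intro iffD1[OF cramer]) simp_all
  then show ?thesis
    by (simp add: matrix_vector_mult_basis column_def vec_eq_iff divide_inverse)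
qed

lemma smooth_on_matrix_inv:
  fixes M :: "'a::real_normed_vector \<Rightarrow> real ^ 'n::finite ^ 'n"
  assumes "open S" "\<And>i j. smooth_on S (\<lambda>x. M x $ i $ j)" "\<And>x. x \<in> S \<Longrightarrow> spd (M x)"
  shows "smooth_on S (\<lambda>x. matrix_inv (M x) $ i $ j)"
proof -
  have "smooth_on S (\<lambda>x. (\<chi> k l. if l = i then axis j 1 $ k else M x $ k $ l) $ k $ l)" for k l
    by (cases "l = i") (auto intro: smooth_on_const assms)
  note entries = this
  have nz: "det (M x) \<noteq> 0" if "x \<in> S" for x
    using spd_det_pos[OF assms(3)[OF that]] by simp
  have "smooth_on S (\<lambda>x. det (\<chi> k l. if l = i then axis j 1 $ k else M x $ k $ l) * inverse (det (M x)))"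
    by (rule smooth_on_mult[OF assms(1) smooth_on_det[OF assms(1) entries]
          smooth_on_inverse[OF assms(1) smooth_on_det[OF assms(1,2)] nz]])
  then show ?thesis
    by (rule smooth_on_cong[OF assms(1), rotated]) (simp add: matrix_inv_entry assms(3))
qed

text \<open>Such a function is locally constant: the ball of radius 1 around one sign excludes the
  other.\<close>

lemma smooth_on_sign:
  fixes f :: "'a::real_normed_vector \<Rightarrow> real"
  assumes "open S" "continuous_on S f" "\<And>x. x \<in> S \<Longrightarrow> f x \<in> {1, - 1}"
  shows "smooth_on S f"
proof (rule smooth_on_local[OF assms(1)])
  fix x assume x: "x \<in> S"
  define U where "U = f -` ball (f x) 1 \<inter> S"
  have "open U" unfolding U_def using assms(1,2) by (metis continuous_on_open_vimage open_ball)
  moreover have "f z = f x" if "z \<in> U" for z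
    using assms(3)[OF x] assms(3)[of z] that by (auto simp: U_def dist_real_def)
  ultimately have "smooth_on U f"
    by (intro smooth_on_cong[OF _ _ smooth_on_const[of U "f x"]]) auto
  then show "\<exists>U. open U \<and> x \<in> U \<and> smooth_on U f" using \<open>open U\<close> x by (auto simp: U_def)
qed

locale oriented_riemannian = manifold X A
  for X :: "'a topology" and A :: "('a, 'n::finite) chart set" +
  fixes g :: "('a, 'n) tensor_field" and ori :: "('a, 'n) chart \<Rightarrow> real ^ 'n \<Rightarrow> real"
  assumes metric: "riemannian_metric A g" and orient: "orientation A ori"
begin

lemma metric_tensor_field: "g \<in> tensor_fields A 2"
  using metric by (simp add: riemannian_metric_def)

lemma metric_gram: "g c y [u, v] = u \<bullet> (gram g c y *v v)"
proof -
  note m = tensor_field_multilinear[OF metric_tensor_field]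
  have "g c y [u, v] = (\<Sum>i\<in>UNIV. u $ i * g c y [axis i 1, v])"
    by (rule linear_expand[OF multilinear_head[OF m]])
  also have "\<dots> = (\<Sum>i\<in>UNIV. u $ i * (\<Sum>j\<in>UNIV. v $ j * g c y [axis i 1, axis j 1]))"
  proof (intro sum.cong refl arg_cong2[where f = "(*)"])
    fix i
    have "linear (\<lambda>v. g c y [axis i 1, v])"
      using multilinear_middle[OF m, of c y "[axis i 1]" "[]"] by simp
    then show "g c y [axis i 1, v] = (\<Sum>j\<in>UNIV. v $ j * g c y [axis i 1, axis j 1])"
      by (rule linear_expand)
  qed
  finally show ?thesis
    by (simp add: inner_vec_def gram_def matrix_vector_mult_def mult.commute)
qed

lemma gram_spd:
  assumes "c \<in> A" "y \<in> chart_img c"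
  shows "spd (gram g c y)"
proof -
  have "gram g c y $ i $ j = gram g c y $ j $ i" for i j
    using metric assms by (simp add: gram_def riemannian_metric_def)
  moreover have "0 < v \<bullet> (gram g c y *v v)" if "v \<noteq> 0" for v
    using metric assms that by (simp add: riemannian_metric_def flip: metric_gram)
  ultimately show ?thesis by (simp add: spd_def transpose_def vec_eq_iff)
qed

lemma gram_smooth:
  "c \<in> A \<Longrightarrow> smooth_on (chart_img c) (\<lambda>y. gram g c y $ i $ j)"
  by (simp add: gram_def tensor_field_smooth[OF metric_tensor_field])

lemma gram_inv_smooth:
  "c \<in> A \<Longrightarrow> smooth_on (chart_img c) (\<lambda>y. matrix_inv (gram g c y) $ i $ j)"
  by (intro smooth_on_matrix_inv chart_img_open gram_smooth gram_spd)

lemma sqrt_det_gram_smooth: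
  "c \<in> A \<Longrightarrow> smooth_on (chart_img c) (\<lambda>y. sqrt (det (gram g c y)))"
  by (intro smooth_on_sqrt smooth_on_det chart_img_open gram_smooth spd_det_pos gram_spd)

text \<open>With the Jacobian matrix \<open>L\<close>, preservation of the metric takes the shape
  assumed by the pointwise lemmas on \<open>form_inner\<close> and \<open>star_at\<close>. It is
  used for changes of chart as well as for isometries.\<close>

lemma gram_pullback:
  assumes f: "smooth_map X A f" and p: "is_pullback A f g g"
    and c: "c \<in> A" "c' \<in> A" and y: "y \<in> local_dom c f c'"
  defines "L \<equiv> matrix (frechet_derivative (local_rep c f c') (at y))"
  shows "frechet_derivative (local_rep c f c') (at y) = (*v) L"
    and "gram g c y = transpose L ** gram g c' (local_rep c f c' y) ** L"
proof -
  have "linear (frechet_derivative (local_rep c f c') (at y))"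
    by (rule has_derivative_linear[OF local_rep_has_derivative[OF f c y]])
  then show 1: "frechet_derivative (local_rep c f c') (at y) = (*v) L"
    unfolding L_def by (intro ext) (simp add: matrix_works)
  let ?G = "gram g c' (local_rep c f c' y)"
  have entry: "M $ i $ j = axis i 1 \<bullet> (M *v axis j 1)" for M :: "real ^ 'n ^ 'n" and i j
    by (simp add: matrix_vector_mult_basis column_def inner_axis')
  have "gram g c y $ i $ j = (transpose L ** ?G ** L) $ i $ j" for i j
  proof -
    have "gram g c y $ i $ j = g c' (local_rep c f c' y) [L *v axis i 1, L *v axis j 1]"
      by (simp add: gram_def[of g c y] is_pullbackD[OF p c y] 1)
    also have "\<dots> = (L *v axis i 1) \<bullet> (?G *v (L *v axis j 1))" by (rule metric_gram)
    also have "\<dots> = axis i 1 \<bullet> (transpose L *v (?G *v (L *v axis j 1)))"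
      by (metis dot_lmul_matrix vector_transpose_matrix)
    finally show ?thesis unfolding entry[of "transpose L ** ?G ** L"]
      by (simp only: matrix_vector_mul_assoc matrix_mul_assoc)
  qed
  then show "gram g c y = transpose L ** ?G ** L" by (simp add: vec_eq_iff)
qed

lemma metric_is_pullback_id: "is_pullback A id g g"
  by (rule tensor_field_is_pullback[OF metric_tensor_field])

lemma orientation_sign: "c \<in> A \<Longrightarrow> y \<in> chart_img c \<Longrightarrow> ori c y \<in> {1, - 1}"
  using orient by (auto simp: orientation_def)

lemma orientation_square: "c \<in> A \<Longrightarrow> y \<in> chart_img c \<Longrightarrow> ori c y * ori c y = 1"
  using orientation_sign by fastforce

lemma orientation_smooth: "c \<in> A \<Longrightarrow> smooth_on (chart_img c) (ori c)"
  using orient by (intro smooth_on_sign chart_img_open orientation_sign) (auto simp: orientation_def)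

definition hstar :: "nat \<Rightarrow> ('a, 'n) tensor_field \<Rightarrow> ('a, 'n) tensor_field" where
  "hstar p \<omega> c y vs =
    (if c \<in> A \<and> y \<in> chart_img c then star_at p (gram g c y) (ori c y) (\<omega> c y) vs else 0)"

lemma raised_smooth:
  assumes w: "\<omega> \<in> tensor_fields A p" and c: "c \<in> A"
  shows "smooth_on (chart_img c) (\<lambda>y. \<omega> c y (map ((*v) (matrix_inv (gram g c y))) vs))"
proof -
  have "smooth_on (chart_img c) (\<lambda>y. (matrix_inv (gram g c y) *v v) $ j)" for v j
    unfolding matrix_vector_mult_def vec_lambda_beta
    by (intro smooth_on_sum smooth_on_mult smooth_on_const chart_img_open c gram_inv_smooth)
  then have "smooth_on (chart_img c) (\<lambda>y. \<omega> c y (map (\<lambda>v. matrix_inv (gram g c y) *v v) vs))"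
    by (intro smooth_on_multilinear[OF chart_img_open[OF c] tensor_field_multilinear[OF w]
          tensor_field_smooth[OF w c]])
  then show ?thesis by simp
qed

text \<open>Pointwise this is \<open>star_at_pullback\<close>. With \<open>\<epsilon>\<close> equal
  to 1 and the identity map it says that the star does not depend on the chart; the value -1 belongs
  to orientation reversing isometries.\<close>

lemma hstar_is_pullback:
  assumes f: "smooth_map X A f" "is_pullback A f g g"
    and o: "\<And>c c' y. c \<in> A \<Longrightarrow> c' \<in> A \<Longrightarrow> y \<in> local_dom c f c' \<Longrightarrow>
      ori c y = \<epsilon> * sgn (det (matrix (frechet_derivative (local_rep c f c') (at y)))) *
        ori c' (local_rep c f c' y)"
    and w: "\<omega> \<in> tensor_fields A p" and p: "is_pullback A f \<eta> \<omega>" and pq: "p + q = CARD('n)"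
  shows "is_pullback A f (hstar p \<eta>) (tensor_scale \<epsilon> (hstar p \<omega>))"
  unfolding is_pullback_def
proof (intro ballI allI)
  fix c c' y and vs :: "(real ^ 'n) list"
  assume c: "c \<in> A" "c' \<in> A" and y: "y \<in> local_dom c f c'"
  define L where "L = matrix (frechet_derivative (local_rep c f c') (at y))"
  let ?y = "local_rep c f c' y"
  note L = gram_pullback[OF f c y, folded L_def]
  have img: "y \<in> chart_img c" "?y \<in> chart_img c'"
    using y local_dom_subset[OF c(1)] local_rep_in_img[OF c(1)] by blast+
  have e: "\<eta> c y = (\<lambda>us. \<omega> c' ?y (map ((*v) L) us))"
    using is_pullbackD[OF p c y] L(1) by auto
  show "hstar p \<eta> c y vs = tensor_scale \<epsilon> (hstar p \<omega>) c' ?y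
      (map (frechet_derivative (local_rep c f c') (at y)) vs)"
  proof (cases "length vs = q")
    case True
    have "star_at p (gram g c y) (\<epsilon> * sgn (det L) * ori c' ?y) (\<lambda>us. \<omega> c' ?y (map ((*v) L) us)) vs =
        \<epsilon> * star_at p (gram g c' ?y) (ori c' ?y) (\<omega> c' ?y) (map ((*v) L) vs)"
      by (rule star_at_pullback[OF gram_spd[OF c(1) img(1)] gram_spd[OF c(2) img(2)] L(2) pq
            tensor_field_multilinear[OF w] True])
    then show ?thesis
      using c img by (simp add: hstar_def tensor_scale_def e L(1) o[OF c y, folded L_def])
  next
    case False
    note m = multilinear_length[OF multilinear_star_at[OF pq]]
    show ?thesis using False by (simp add: hstar_def tensor_scale_def m)
  qed
qed

lemma hstar_tensor_field:
  assumes w: "\<omega> \<in> tensor_fields A p" and pq: "p + q = CARD('n)"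
  shows "hstar p \<omega> \<in> forms A q"
proof -
  have "smooth_on (chart_img c) (\<lambda>y. hstar p \<omega> c y vs)" if c: "c \<in> A" for c vs
  proof -
    note o = chart_img_open[OF c]
    have "smooth_on (chart_img c) (\<lambda>y. ori c y * sqrt (det (gram g c y)) * (1 / fact p) *
        (\<Sum>I\<in>indices p. \<omega> c y (map ((*v) (matrix_inv (gram g c y))) (axes I)) * vdet (axes I @ vs)))"
      by (intro smooth_on_mult smooth_on_sum smooth_on_const o orientation_smooth sqrt_det_gram_smooth
          raised_smooth[OF w] c)
    then show ?thesis
      by (rule smooth_on_cong[OF o, rotated]) (simp add: hstar_def star_at_def c)
  qed
  moreover have "multilinear q (hstar p \<omega> c y)" if "c \<in> A" "y \<in> chart_img c" for c y
    using multilinear_star_at[OF pq] that by (simp add: hstar_def[abs_def])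
  moreover have "alternating (hstar p \<omega> c y)" if "c \<in> A" "y \<in> chart_img c" for c y
    using alternating_star_at that by (simp add: hstar_def[abs_def])
  moreover have "is_pullback A id (hstar p \<omega>) (hstar p \<omega>)"
  proof -
    have "is_pullback A id (hstar p \<omega>) (tensor_scale 1 (hstar p \<omega>))"
      using orient
      by (intro hstar_is_pullback[OF smooth_map_id metric_is_pullback_id _ w tensor_field_is_pullback[OF w] pq])
         (simp add: orientation_def)
    then show ?thesis by (simp add: tensor_scale_def)
  qed
  moreover have "hstar p \<omega> c y vs = 0" if "c \<notin> A \<or> y \<notin> chart_img c" for c y vs
    using that by (auto simp: hstar_def)
  ultimately show ?thesis
    by (simp add: forms_def tensor_fields_def)
qed

lemma hstar_forms: "\<omega> \<in> forms A p \<Longrightarrow> p + q = CARD('n) \<Longrightarrow> hstar p \<omega> \<in> forms A q"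
  by (rule hstar_tensor_field[OF form_tensor_field])

lemma hstar_hstar:
  assumes w: "\<omega> \<in> forms A p" and pq: "p + q = CARD('n)"
  shows "hstar q (hstar p \<omega>) = tensor_scale ((-1) ^ (p * q)) \<omega>"
proof (intro ext)
  fix c y vs
  note t = form_tensor_field[OF w]
  show "hstar q (hstar p \<omega>) c y vs = tensor_scale ((-1) ^ (p * q)) \<omega> c y vs"
  proof (cases "c \<in> A \<and> y \<in> chart_img c")
    case True
    then have "hstar p \<omega> c y = star_at p (gram g c y) (ori c y) (\<omega> c y)"
      by (simp add: hstar_def[abs_def])
    moreover have "star_at q (gram g c y) (ori c y) (star_at p (gram g c y) (ori c y) (\<omega> c y)) =
        (\<lambda>vs. (-1) ^ (p * q) * \<omega> c y vs)"
      using True by (intro star_at_star_at gram_spd pq orientation_square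
          tensor_field_multilinear[OF t] form_alternating[OF w]) auto
    ultimately show ?thesis using True by (simp add: hstar_def[of q] tensor_scale_def)
  next
    case False
    then have "\<omega> c y vs = 0" using tensor_field_zero[OF t] by blast
    then show ?thesis using False by (auto simp: hstar_def[of q] tensor_scale_def)
  qed
qed

lemma hstar_add: "hstar p (\<omega> + \<eta>) = hstar p \<omega> + hstar p \<eta>"
  by (intro ext) (simp add: hstar_def star_at_def distrib_left distrib_right sum.distrib)

lemma hstar_scale: "hstar p (tensor_scale r \<omega>) = tensor_scale r (hstar p \<omega>)"
  by (intro ext) (simp add: hstar_def star_at_def tensor_scale_def sum_distrib_left mult_ac)

lemma hstar_pull:
  assumes f: "smooth_map X A f" "is_pullback A f g g" "orientation_reversing A ori f"
    and w: "\<omega> \<in> forms A p" and pq: "p + q = CARD('n)"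
  shows "hstar p (pull f \<omega>) = tensor_scale (- 1) (pull f (hstar p \<omega>))"
proof -
  note t = form_tensor_field[OF w]
  let ?s = "tensor_scale (- 1) (hstar p \<omega>)"
  have s: "?s \<in> tensor_fields A q"
    by (rule form_tensor_field[OF forms_scale[OF hstar_forms[OF w pq]]])
  have "is_pullback A f (hstar p (pull f \<omega>)) ?s"
    using f(3)
    by (intro hstar_is_pullback[OF f(1,2) _ t is_pullback_pull[OF f(1) tensor_field_is_pullback[OF t]] pq])
       (simp add: orientation_reversing_def)
  then have "hstar p (pull f \<omega>) = pull f ?s"
    by (subst (asm) is_pullback_iff_pull[OF f(1) tensor_field_is_pullback[OF s]]) (auto simp: hstar_def)
  also have "\<dots> = tensor_scale (- 1) (pull f (hstar p \<omega>))"
    by (intro ext) (simp add: pull_def tensor_scale_def Let_def)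
  finally show ?thesis .
qed

section \<open>The pointwise inner product as a continuous function on the manifold\<close>

definition pt_inner :: "nat \<Rightarrow> ('a, 'n) tensor_field \<Rightarrow> ('a, 'n) tensor_field \<Rightarrow> 'a \<Rightarrow> real" where
  "pt_inner p \<alpha> \<beta> x = (let c = chart_at A x; y = chart_map c x
                   in form_inner p (gram g c y) (\<alpha> c y) (\<beta> c y))"

lemma L2_inner_eq: "L2_inner A g vol p \<alpha> \<beta> = (LINT x|vol. pt_inner p \<alpha> \<beta> x)"
  by (simp add: L2_inner_def pt_inner_def)

text \<open>The change from the chosen chart to \<open>c\<close> is a pullback along the identity,
  which preserves the metric, so \<open>form_inner_pullback\<close> applies.\<close>

lemma pt_inner_eq:
  assumes a: "\<alpha> \<in> tensor_fields A p" "\<beta> \<in> tensor_fields A p" and c: "c \<in> A" "x \<in> chart_dom c"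
  shows "pt_inner p \<alpha> \<beta> x = form_inner p (gram g c (chart_map c x)) (\<alpha> c (chart_map c x)) (\<beta> c (chart_map c x))"
proof -
  have "x \<in> topspace X" using c chart_dom_subset by blast
  note ca = chart_at[OF this]
  let ?c = "chart_at A x"
  let ?y = "chart_map ?c x"
  have y: "?y \<in> local_dom ?c id c" and rep: "local_rep ?c id c ?y = chart_map c x"
    using ca c by (auto simp: local_dom_eq local_rep_def)
  have cA: "?c \<in> A" using ca by simp
  define L where "L = matrix (frechet_derivative (local_rep ?c id c) (at ?y))"
  note L = gram_pullback[OF smooth_map_id metric_is_pullback_id cA c(1) y, folded L_def]
  have e: "\<omega> ?c ?y = (\<lambda>vs. \<omega> c (chart_map c x) (map ((*v) L) vs))" if "\<omega> \<in> tensor_fields A p" for \<omega>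
    using is_pullbackD[OF tensor_field_is_pullback[OF that] cA c(1) y] L(1) rep by auto
  have "form_inner p (gram g ?c ?y) (\<alpha> ?c ?y) (\<beta> ?c ?y) =
      form_inner p (gram g c (chart_map c x)) (\<alpha> c (chart_map c x)) (\<beta> c (chart_map c x))"
    unfolding e[OF a(1)] e[OF a(2)]
    using ca c L(2) rep by (intro form_inner_pullback tensor_field_multilinear[OF a(1)]
        tensor_field_multilinear[OF a(2)] gram_spd) auto
  then show ?thesis by (simp add: pt_inner_def Let_def)
qed

lemma form_inner_smooth:
  assumes a: "\<alpha> \<in> tensor_fields A p" "\<beta> \<in> tensor_fields A p" and c: "c \<in> A"
  shows "smooth_on (chart_img c) (\<lambda>y. form_inner p (gram g c y) (\<alpha> c y) (\<beta> c y))"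
  unfolding form_inner_def divide_inverse
  by (intro smooth_on_mult smooth_on_sum smooth_on_prod smooth_on_const chart_img_open c
      gram_inv_smooth tensor_field_smooth[OF a(1)] tensor_field_smooth[OF a(2)])

lemma continuous_map_local:
  fixes F :: "'a \<Rightarrow> real"
  assumes "\<And>c. c \<in> A \<Longrightarrow> continuous_on (chart_img c) (\<lambda>y. F (chart_inv c y))"
  shows "continuous_map X euclideanreal F"
  unfolding continuous_map_def
proof (intro conjI allI impI)
  fix U :: "real set" assume U: "openin euclideanreal U"
  have "{x \<in> topspace X. F x \<in> U} = (\<Union>c\<in>A. {x \<in> chart_dom c. chart_map c x \<in> (\<lambda>y. F (chart_inv c y)) -` U \<inter> chart_img c})"
    using chart_at chart_dom_subset by fastforce
  moreover have "openin X {x \<in> chart_dom c. chart_map c x \<in> (\<lambda>y. F (chart_inv c y)) -` U \<inter> chart_img c}"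
    if "c \<in> A" for c
    using U by (intro chart_vimage_openin[OF that] continuous_open_preimage[OF assms[OF that] chart_img_open[OF that], unfolded Int_commute[of "chart_img c"]]) auto
  ultimately show "openin X {x \<in> topspace X. F x \<in> U}" by auto
qed auto

lemma pt_inner_continuous:
  assumes a: "\<alpha> \<in> tensor_fields A p" "\<beta> \<in> tensor_fields A p"
  shows "continuous_map X euclideanreal (pt_inner p \<alpha> \<beta>)"
proof (rule continuous_map_local)
  fix c assume c: "c \<in> A"
  have "continuous_on (chart_img c) (\<lambda>y. form_inner p (gram g c y) (\<alpha> c y) (\<beta> c y))"
    by (rule smooth_on_continuous_on[OF form_inner_smooth[OF a c]])
  then show "continuous_on (chart_img c) (\<lambda>y. pt_inner p \<alpha> \<beta> (chart_inv c y))"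
    by (rule continuous_on_eq) (simp add: pt_inner_eq[OF a c])
qed

end

section \<open>Integration on the manifold\<close>

text \<open>By translation invariance the difference quotients have integral 0.\<close>

lemma integral_derivative_compact_support:
  fixes f :: "real ^ 'n::finite \<Rightarrow> real"
  assumes der: "\<And>x. (f has_derivative f' x) (at x)" and cont: "continuous_on UNIV (\<lambda>x. f' x v)"
    and supp: "\<And>x. x \<notin> cball a r \<Longrightarrow> f x = 0"
  shows "integrable lborel (\<lambda>x. f' x v)" "(LINT x|lborel. f' x v) = 0"
proof -
  have f_cont: "continuous_on UNIV f"
    using der has_derivative_continuous by (blast intro: continuous_at_imp_continuous_on)
  have f'0: "f' x v = 0" if "x \<notin> cball a r" for x
  proof -
    have "((\<lambda>_. 0) has_derivative (\<lambda>_. 0)) (at x)" by simp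
    then have "(f has_derivative (\<lambda>_. 0)) (at x)"
      by (rule has_derivative_transform_within_open[of _ _ _ _ "- cball a r"])
         (use that supp in auto)
    then show ?thesis using has_derivative_unique[OF der] by metis
  qed
  \<comment> \<open>The directional derivative is continuous on the compact ball and 0 outside; its
    bound also dominates the difference quotients, by the mean value theorem.\<close>
  obtain M where M: "\<And>x. \<bar>f' x v\<bar> \<le> M" "0 \<le> M"
  proof -
    have "bounded ((\<lambda>x. f' x v) ` cball a r)"
      by (intro compact_imp_bounded compact_continuous_image continuous_on_subset[OF cont]) auto
    then have "\<exists>B. \<forall>x\<in>cball a r. \<bar>f' x v\<bar> \<le> B" by (simp add: bounded_iff)
    then obtain B where B: "\<And>x. x \<in> cball a r \<Longrightarrow> \<bar>f' x v\<bar> \<le> B" by blast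
    have "\<bar>f' x v\<bar> \<le> max 0 B" for x
      using B[of x] f'0[of x] by (cases "x \<in> cball a r") auto
    then show thesis by (intro that[of "max 0 B"]) auto
  qed
  define h where "h n = 1 / real (Suc n)" for n
  have h: "0 < h n" "h n \<le> 1" for n by (auto simp: h_def)
  have h0: "h \<longlonglongrightarrow> 0" unfolding h_def by (rule LIMSEQ_Suc[OF lim_1_over_n])
  define q where "q n x = (f (h n *\<^sub>R v + x) - f x) / h n" for n x
  have dir: "((\<lambda>s. f (s *\<^sub>R v + x)) has_real_derivative f' (s *\<^sub>R v + x) v) (at s)" for s x
  proof -
    have "((\<lambda>s. s *\<^sub>R v + x) has_derivative (\<lambda>h. h *\<^sub>R v)) (at s)"
      by (auto intro!: derivative_eq_intros)
    from has_derivative_compose[OF this der]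
    have "((\<lambda>s. f (s *\<^sub>R v + x)) has_derivative (\<lambda>h. f' (s *\<^sub>R v + x) (h *\<^sub>R v))) (at s)" .
    moreover have "f' (s *\<^sub>R v + x) (h *\<^sub>R v) = f' (s *\<^sub>R v + x) v * h" for h
      using linear_scale[OF has_derivative_linear[OF der]] by simp
    ultimately show ?thesis by (simp add: has_field_derivative_def)
  qed
  have lim: "(\<lambda>n. q n x) \<longlonglongrightarrow> f' x v" for x
  proof -
    have "((\<lambda>k. (f (k *\<^sub>R v + x) - f x) / k) \<longlongrightarrow> f' x v) (at 0)"
      using dir[of x 0] by (simp add: DERIV_def)
    moreover have "filterlim h (at 0) sequentially"
      unfolding filterlim_at using h0 h(1) by (auto simp: less_imp_neq[symmetric])
    ultimately show ?thesis unfolding q_def by (rule filterlim_compose)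
  qed
  have mvt: "\<exists>s. 0 < s \<and> s < h n \<and> q n x = f' (s *\<^sub>R v + x) v" for n x
  proof -
    have "\<exists>s>0. s < h n \<and> f (h n *\<^sub>R v + x) - f (0 *\<^sub>R v + x) = (h n - 0) * f' (s *\<^sub>R v + x) v"
      by (rule MVT2[OF h(1)]) (rule dir)
    then show ?thesis using h(1)[of n] by (auto simp: q_def)
  qed
  \<comment> \<open>Since \<open>h n \<le> 1\<close>, the points met by the difference quotients are
    displaced by at most \<open>norm v\<close>, so all quotients vanish outside this larger
    ball.\<close>
  define K where "K = cball a (r + norm v)"
  have bound: "\<bar>q n x\<bar> \<le> M * indicator K x" for n x
  proof (cases "x \<in> K")
    case True
    then show ?thesis using mvt[of n x] M(1) by auto
  next
    case False
    obtain s where s: "0 < s" "s < h n" "q n x = f' (s *\<^sub>R v + x) v" using mvt by blast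
    have "s *\<^sub>R v + x \<notin> cball a r"
    proof
      assume "s *\<^sub>R v + x \<in> cball a r"
      moreover have "dist (s *\<^sub>R v + x) x \<le> norm v"
        using s h(2)[of n] mult_right_mono[of s 1 "norm v"] by (simp add: dist_norm)
      ultimately have "dist a x \<le> r + norm v" using dist_triangle[of a x "s *\<^sub>R v + x"] by simp
      then show False using False by (simp add: K_def)
    qed
    then show ?thesis using s False f'0 by simp
  qed
  have f_meas: "f \<in> borel_measurable lborel" using borel_measurable_continuous_onI[OF f_cont] by simp
  have f'_meas: "(\<lambda>x. f' x v) \<in> borel_measurable lborel" using borel_measurable_continuous_onI[OF cont] by simp
  have shift_meas: "(\<lambda>x. f (c + x)) \<in> borel_measurable lborel" for c
  proof -
    have "continuous_on UNIV (\<lambda>x. f (c + x))"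
      by (rule continuous_on_compose2[OF f_cont]) (auto intro!: continuous_intros)
    then show ?thesis using borel_measurable_continuous_onI by simp
  qed
  have q_meas: "q n \<in> borel_measurable lborel" for n
    unfolding q_def[abs_def] by (intro borel_measurable_divide borel_measurable_diff shift_meas f_meas) simp
  have w: "integrable lborel (\<lambda>x. M * indicator K x :: real)"
    using emeasure_lborel_cball_finite[of a "r + norm v"]
    by (intro integrable_mult_right) (simp add: K_def integrable_indicator_iff)
  have dom: "AE x in lborel. norm (q n x) \<le> M * indicator K x" for n
    using bound by simp
  have limAE: "AE x in lborel. (\<lambda>n. q n x) \<longlonglongrightarrow> f' x v" using lim by simp
  show "integrable lborel (\<lambda>x. f' x v)"
    by (rule integrable_dominated_convergence[OF f'_meas q_meas w limAE dom])
  have "(\<lambda>n. LINT x|lborel. q n x) \<longlonglongrightarrow> (LINT x|lborel. f' x v)"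
    by (rule integral_dominated_convergence[OF f'_meas q_meas w limAE dom])
  moreover have "(LINT x|lborel. q n x) = 0" for n
  proof -
    have int: "integrable lborel f"
    proof -
      obtain B where B: "\<And>x. x \<in> cball a r \<Longrightarrow> \<bar>f x\<bar> \<le> B"
      proof -
        have "bounded (f ` cball a r)"
          by (intro compact_imp_bounded compact_continuous_image continuous_on_subset[OF f_cont]) auto
        then have "\<exists>B. \<forall>x\<in>cball a r. \<bar>f x\<bar> \<le> B" by (simp add: bounded_iff)
        then show thesis using that by blast
      qed
      have "integrable lborel (\<lambda>x. B * indicator (cball a r) x :: real)"
        using emeasure_lborel_cball_finite[of a r]
        by (intro integrable_mult_right) (simp add: integrable_indicator_iff)
      then show ?thesis
        by (rule Bochner_Integration.integrable_bound[OF _ f_meas])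
           (use B supp in \<open>auto simp: indicator_def intro!: AE_I2 order_trans[OF B]\<close>)
    qed
    have f_borel: "f \<in> borel_measurable borel" using f_meas by simp
    have tr: "(+) c \<in> measurable lborel (borel :: (real ^ 'n) measure)" for c by simp
    have shift_int: "integrable lborel (\<lambda>x. f (c + x))" for c
      using int integrable_distr_eq[OF tr f_borel, of c] by (simp add: lborel_distr_plus)
    have "(LINT x|lborel. f (c + x)) = (LINT x|lborel. f x)" for c
      using integral_distr[OF tr f_borel, of c] by (simp add: lborel_distr_plus)
    then have "(LINT x|lborel. f (h n *\<^sub>R v + x) - f x) = 0"
      by (simp add: Bochner_Integration.integral_diff[OF shift_int int])
    then show ?thesis unfolding q_def by simp
  qed
  ultimately show "(LINT x|lborel. f' x v) = 0" by (simp add: LIMSEQ_const_iff)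
qed

context manifold begin

lemma chart_inv_continuous_map:
  assumes c: "c \<in> A"
  shows "continuous_map (top_of_set (chart_img c)) X (chart_inv c)"
  unfolding continuous_map_def
proof (intro conjI allI impI)
  show "chart_inv c \<in> topspace (top_of_set (chart_img c)) \<rightarrow> topspace X"
    using chart_inv_in_topspace[OF c] by auto
  fix U assume U: "openin X U"
  have "{y \<in> topspace (top_of_set (chart_img c)). chart_inv c y \<in> U} = chart_map c ` (U \<inter> chart_dom c)"
    using c by (force simp: image_iff)
  moreover have "open (chart_map c ` (U \<inter> chart_dom c))"
    using U chart_dom_openin[OF c] by (intro chart_image_open[OF c]) auto
  ultimately show "openin (top_of_set (chart_img c)) {y \<in> topspace (top_of_set (chart_img c)). chart_inv c y \<in> U}"
    using chart_img_open[OF c] by (auto simp: openin_open_eq)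
qed

text \<open>Besides covering by the open balls, compactness is arranged so that the closed balls
  stay inside the charts: continuous functions are bounded on them, and functions supported in them
  extend by 0.\<close>

lemma chart_ball_cover:
  obtains P where "finite P" "\<And>c y r. (c, y, r) \<in> P \<Longrightarrow> c \<in> A \<and> 0 < r \<and> cball y r \<subseteq> chart_img c"
    "topspace X \<subseteq> (\<Union>(c, y, r)\<in>P. chart_inv c ` ball y r)"
proof -
  let ?Q = "{(c, y, r). c \<in> A \<and> 0 < r \<and> cball y r \<subseteq> chart_img c}"
  let ?U = "\<lambda>(c, y, r). chart_inv c ` ball y r"
  have "openin X (?U t)" if "t \<in> ?Q" for t
  proof -
    obtain c y r where t: "t = (c, y, r)" by (cases t)
    have "ball y r \<subseteq> chart_img c" using that t ball_subset_cball[of y r] by auto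
    then show ?thesis using that t chart_inv_image_openin[of c "ball y r"] by auto
  qed
  moreover have "topspace X \<subseteq> \<Union> (?U ` ?Q)"
  proof
    fix x assume "x \<in> topspace X"
    then obtain c where c: "c \<in> A" "x \<in> chart_dom c" using chart_at by blast
    then obtain r where r: "0 < r" "cball (chart_map c x) r \<subseteq> chart_img c"
      using open_contains_cball[of "chart_img c"] chart_img_open[OF c(1)] chart_map_in_img[OF c(2)] by blast
    have "x \<in> ?U (c, chart_map c x, r)"
      using c r by (auto simp: image_iff intro!: bexI[of _ "chart_map c x"])
    moreover have "(c, chart_map c x, r) \<in> ?Q" using c r by simp
    ultimately show "x \<in> \<Union> (?U ` ?Q)" by blast
  qed
  moreover have "compact_space X" using closed_manifold by (simp add: closed_manifold_def)
  ultimately obtain F where F: "finite F" "F \<subseteq> ?U ` ?Q" "topspace X \<subseteq> \<Union>F"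
    unfolding compact_space_alt by (metis (no_types, lifting) imageE)
  obtain P where "P \<subseteq> ?Q" "finite P" "F = ?U ` P"
    using finite_subset_image[OF F(1,2)] by blast
  then show thesis using F(3) by (intro that[of P]) auto
qed

end

locale measured_riemannian = oriented_riemannian X A g ori
  for X :: "'a topology" and A :: "('a, 'n::finite) chart set"
    and g :: "('a, 'n) tensor_field" and ori :: "('a, 'n) chart \<Rightarrow> real ^ 'n \<Rightarrow> real" +
  fixes vol :: "'a measure"
  assumes vol: "riemannian_measure X A g vol"
begin

lemma space_vol: "space vol = topspace X"
  using vol by (simp add: riemannian_measure_def)

lemma openin_sets_vol: "openin X U \<Longrightarrow> U \<in> sets vol"
  using vol by (auto simp: riemannian_measure_def)

lemma emeasure_vol:
  "c \<in> A \<Longrightarrow> S \<in> sets vol \<Longrightarrow> S \<subseteq> chart_dom c \<Longrightarrow> emeasure vol S =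
    (\<integral>\<^sup>+y. ennreal (sqrt (det (gram g c y))) * indicator (chart_map c ` S) y \<partial>lborel)"
  using vol by (simp add: riemannian_measure_def)

lemma continuous_map_measurable:
  assumes "continuous_map X euclideanreal F"
  shows "F \<in> borel_measurable vol"
proof (rule borel_measurableI)
  fix S :: "real set" assume "open S"
  then have "openin X {x \<in> topspace X. F x \<in> S}"
    by (intro openin_continuous_map_preimage[OF assms]) simp
  moreover have "F -` S \<inter> space vol = {x \<in> topspace X. F x \<in> S}" by (auto simp: space_vol)
  ultimately show "F -` S \<inter> space vol \<in> sets vol" using openin_sets_vol by simp
qed

text \<open>The indicator turns a function continuous on an open set into a Borel function on the
  whole coordinate space.\<close>

definition dens :: "('a, 'n) chart \<Rightarrow> real ^ 'n \<Rightarrow> real" where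
  "dens c y = indicator (chart_img c) y * sqrt (det (gram g c y))"

lemma dens_measurable: "c \<in> A \<Longrightarrow> dens c \<in> borel_measurable borel"
  using borel_measurable_continuous_on_indicator[of "chart_img c" "\<lambda>y. sqrt (det (gram g c y))"]
    smooth_on_continuous_on[OF sqrt_det_gram_smooth] chart_img_open
  by (simp add: dens_def[abs_def])

lemma dens_nonneg: "c \<in> A \<Longrightarrow> 0 \<le> dens c y"
  using spd_det_pos[OF gram_spd, of c y] by (auto simp: dens_def indicator_def)

lemma chart_dom_sets: "c \<in> A \<Longrightarrow> chart_dom c \<inter> space vol \<in> sets vol"
  using openin_sets_vol[OF chart_dom_openin] by simp

lemma chart_map_measurable:
  assumes c: "c \<in> A"
  shows "chart_map c \<in> measurable (restrict_space vol (chart_dom c)) borel"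
proof (rule borel_measurableI)
  fix S :: "(real ^ 'n) set" assume "open S"
  have sp: "space (restrict_space vol (chart_dom c)) = chart_dom c"
    using chart_dom_subset[OF c] by (auto simp: space_restrict_space space_vol)
  have "{x \<in> chart_dom c. chart_map c x \<in> S} \<in> sets vol"
    by (intro openin_sets_vol chart_vimage_openin c \<open>open S\<close>)
  then show "chart_map c -` S \<inter> space (restrict_space vol (chart_dom c)) \<in> sets (restrict_space vol (chart_dom c))"
    unfolding sp
    by (subst sets_restrict_space_iff[OF chart_dom_sets[OF c]]) (auto simp: vimage_def Int_def conj_commute)
qed

text \<open>The defining property of the Riemannian measure concerns sets inside a chart; applied to
  preimages of Borel sets it becomes an equality of measures, and integrals can be
  transformed.\<close>

lemma distr_chart:
  assumes c: "c \<in> A"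
  shows "distr (restrict_space vol (chart_dom c)) borel (chart_map c) = density lborel (\<lambda>y. ennreal (dens c y))"
proof (rule measure_eqI)
  fix B :: "(real ^ 'n) set"
  assume "B \<in> sets (distr (restrict_space vol (chart_dom c)) borel (chart_map c))"
  then have B: "B \<in> sets borel" by simp
  have dom: "chart_dom c \<in> sets vol" by (rule openin_sets_vol[OF chart_dom_openin[OF c]])
  have sp: "space (restrict_space vol (chart_dom c)) = chart_dom c"
    using chart_dom_subset[OF c] by (auto simp: space_restrict_space space_vol)
  let ?S = "chart_map c -` B \<inter> chart_dom c"
  have "?S \<in> sets (restrict_space vol (chart_dom c))"
    using measurable_sets[OF chart_map_measurable[OF c] B] by (simp add: sp)
  then have S: "?S \<in> sets vol"
    by (subst (asm) sets_restrict_space_iff[OF chart_dom_sets[OF c]]) auto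
  have img: "chart_map c ` ?S = B \<inter> chart_img c" by (auto simp: chart_img_def)
  have "emeasure (distr (restrict_space vol (chart_dom c)) borel (chart_map c)) B =
      emeasure (restrict_space vol (chart_dom c)) ?S"
    by (simp add: emeasure_distr[OF chart_map_measurable[OF c] B] sp)
  also have "\<dots> = emeasure vol ?S"
    using dom by (intro emeasure_restrict_space) auto
  also have "\<dots> = (\<integral>\<^sup>+y. ennreal (sqrt (det (gram g c y))) * indicator (B \<inter> chart_img c) y \<partial>lborel)"
    using emeasure_vol[OF c S] img by simp
  also have "\<dots> = (\<integral>\<^sup>+y. ennreal (dens c y) * indicator B y \<partial>lborel)"
    by (intro nn_integral_cong) (auto simp: dens_def indicator_def)
  also have "\<dots> = emeasure (density lborel (\<lambda>y. ennreal (dens c y))) B"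
    using B dens_measurable[OF c] by (subst emeasure_density) auto
  finally show "emeasure (distr (restrict_space vol (chart_dom c)) borel (chart_map c)) B =
      emeasure (density lborel (\<lambda>y. ennreal (dens c y))) B" .
qed simp

text \<open>Brings integrals of functions supported in one chart to coordinate space, where the
  integral of a divergence can be evaluated.\<close>

lemma integral_chart:
  assumes c: "c \<in> A" and F: "continuous_map X euclideanreal F"
    and zero: "\<And>x. x \<in> topspace X \<Longrightarrow> x \<notin> chart_dom c \<Longrightarrow> F x = 0"
  shows "(LINT x|vol. F x) = (LINT y|lborel. dens c y * F (chart_inv c y))"
proof -
  define f where "f y = indicator (chart_img c) y *\<^sub>R F (chart_inv c y)" for y
  have dom: "chart_dom c \<inter> space vol \<in> sets vol"
    using openin_sets_vol[OF chart_dom_openin[OF c]] by simp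
  have "continuous_map (top_of_set (chart_img c)) euclideanreal (F \<circ> chart_inv c)"
    by (rule continuous_map_compose[OF chart_inv_continuous_map[OF c] F])
  then have "continuous_on (chart_img c) (\<lambda>y. F (chart_inv c y))" by (simp add: comp_def)
  then have f: "f \<in> borel_measurable borel"
    unfolding f_def using chart_img_open[OF c] by (intro borel_measurable_continuous_on_indicator) auto
  have "(LINT x|vol. F x) = (LINT x|vol. indicator (chart_dom c) x *\<^sub>R F x)"
    using zero by (intro Bochner_Integration.integral_cong) (auto simp: space_vol indicator_def)
  also have "\<dots> = (LINT x|restrict_space vol (chart_dom c). F x)"
    by (rule integral_restrict_space[OF dom, symmetric])
  also have "\<dots> = (LINT x|restrict_space vol (chart_dom c). f (chart_map c x))"
    using c by (intro Bochner_Integration.integral_cong) (auto simp: space_restrict_space f_def)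
  also have "\<dots> = (LINT y|density lborel (\<lambda>y. ennreal (dens c y)). f y)"
    by (simp add: integral_distr[OF chart_map_measurable[OF c] f, symmetric] distr_chart[OF c])
  also have "\<dots> = (LINT y|lborel. dens c y *\<^sub>R f y)"
    using f dens_measurable[OF c] dens_nonneg[OF c] by (intro integral_density) auto
  also have "\<dots> = (LINT y|lborel. dens c y * F (chart_inv c y))"
    by (intro Bochner_Integration.integral_cong) (auto simp: f_def dens_def indicator_def)
  finally show ?thesis .
qed

text \<open>Finitely many coordinate balls cover the manifold, and on each of the closed balls the
  density is bounded.\<close>

lemma finite_measure_vol: "finite_measure vol"
proof
  obtain P where P: "finite P" "\<And>c y r. (c, y, r) \<in> P \<Longrightarrow> c \<in> A \<and> 0 < r \<and> cball y r \<subseteq> chart_img c"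
    "topspace X \<subseteq> (\<Union>(c, y, r)\<in>P. chart_inv c ` ball y r)"
    by (rule chart_ball_cover) blast
  have *: "chart_inv c ` ball y r \<in> sets vol \<and> emeasure vol (chart_inv c ` ball y r) < \<infinity>"
    if t: "(c, y, r) \<in> P" for c y r
  proof -
    have c: "c \<in> A" and sub: "cball y r \<subseteq> chart_img c" using P(2)[OF t] by auto
    then have sub': "ball y r \<subseteq> chart_img c" using ball_subset_cball[of y r] by blast
    have S: "chart_inv c ` ball y r \<in> sets vol"
      by (intro openin_sets_vol chart_inv_image_openin c sub') simp
    have img: "chart_map c ` chart_inv c ` ball y r = ball y r"
      using sub' by (force simp: image_iff)
    have "bounded ((\<lambda>y. sqrt (det (gram g c y))) ` cball y r)"
      by (intro compact_imp_bounded compact_continuous_image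
          continuous_on_subset[OF smooth_on_continuous_on[OF sqrt_det_gram_smooth[OF c]] sub]) simp
    then have "\<exists>B. \<forall>z\<in>cball y r. \<bar>sqrt (det (gram g c z))\<bar> \<le> B" by (simp add: bounded_iff)
    then obtain B where B: "\<And>z. z \<in> cball y r \<Longrightarrow> \<bar>sqrt (det (gram g c z))\<bar> \<le> B" by blast
    have "emeasure vol (chart_inv c ` ball y r) =
        (\<integral>\<^sup>+z. ennreal (sqrt (det (gram g c z))) * indicator (ball y r) z \<partial>lborel)"
      using emeasure_vol[OF c S] sub' chart_inv_in_dom unfolding img by blast
    also have "\<dots> \<le> (\<integral>\<^sup>+z. ennreal B * indicator (cball y r) z \<partial>lborel)"
    proof (rule nn_integral_mono)
      fix z
      show "ennreal (sqrt (det (gram g c z))) * indicator (ball y r) z \<le> ennreal B * indicator (cball y r) z"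
        using B[of z] by (cases "z \<in> ball y r") (auto intro!: ennreal_leI)
    qed
    also have "\<dots> = ennreal B * emeasure lborel (cball y r)"
      by (simp add: nn_integral_cmult_indicator)
    also have "\<dots> < \<infinity>"
      using emeasure_lborel_cball_finite[of y r] by (simp add: ennreal_mult_less_top)
    finally show ?thesis using S by simp
  qed
  have "emeasure vol (space vol) \<le> emeasure vol (\<Union>t\<in>P. case t of (c, y, r) \<Rightarrow> chart_inv c ` ball y r)"
    using P(1,3) * by (intro emeasure_mono sets.finite_UN) (auto simp: space_vol)
  also have "\<dots> \<le> (\<Sum>t\<in>P. emeasure vol (case t of (c, y, r) \<Rightarrow> chart_inv c ` ball y r))"
    using P(1) * by (intro emeasure_subadditive_finite) auto
  also have "\<dots> < \<infinity>"
    using P(1) * by (auto simp: ennreal_sum_less_top)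
  finally show "emeasure vol (space vol) \<noteq> \<infinity>" by simp
qed

lemma continuous_map_integrable:
  assumes F: "continuous_map X euclideanreal F"
  shows "integrable vol F"
proof -
  have "compact_space X" using closed_manifold by (simp add: closed_manifold_def)
  then have "compactin euclideanreal (F ` topspace X)"
    using image_compactin[OF _ F] by (simp add: compact_space_def)
  then have "bounded (F ` topspace X)" by (simp add: compact_imp_bounded)
  then have "\<exists>B. \<forall>x\<in>topspace X. norm (F x) \<le> B" by (simp add: bounded_iff)
  then obtain B where "\<And>x. x \<in> topspace X \<Longrightarrow> norm (F x) \<le> B" by blast
  then show ?thesis
    by (intro finite_measure.integrable_const_bound[OF finite_measure_vol, of _ B]
        continuous_map_measurable F) (auto simp: space_vol)
qed

lemma pt_inner_integrable:
  "\<alpha> \<in> tensor_fields A p \<Longrightarrow> \<beta> \<in> tensor_fields A p \<Longrightarrow> integrable vol (pt_inner p \<alpha> \<beta>)"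
  by (intro continuous_map_integrable pt_inner_continuous)

lemma pt_inner_nonneg:
  assumes "\<gamma> \<in> tensor_fields A p" "x \<in> topspace X"
  shows "0 \<le> pt_inner p \<gamma> \<gamma> x"
  using chart_at[OF assms(2)] form_inner_pos(1)[OF gram_spd tensor_field_multilinear[OF assms(1)]]
  by (simp add: pt_inner_def Let_def)

text \<open>The pointwise norm vanishes almost everywhere. In a chart the set \<open>N\<close> where
  it is positive is open and, as the density is positive there, a Lebesgue null set; hence it is
  empty. This gives uniqueness of the codifferential.\<close>

lemma L2_definite:
  assumes w: "\<gamma> \<in> tensor_fields A p" and zero: "L2_inner A g vol p \<gamma> \<gamma> = 0"
  shows "\<gamma> = 0"
proof -
  have AE0: "AE x in vol. pt_inner p \<gamma> \<gamma> x = 0"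
    using zero pt_inner_nonneg[OF w] unfolding L2_inner_eq
    by (subst (asm) integral_nonneg_eq_0_iff_AE[OF pt_inner_integrable[OF w w]]) (auto simp: space_vol)
  have "\<gamma> c y vs = 0" for c y vs
  proof (cases "c \<in> A \<and> y \<in> chart_img c")
    case False
    then show ?thesis using tensor_field_zero[OF w] by blast
  next
    case True
    then have c: "c \<in> A" and y: "y \<in> chart_img c" by auto
    define \<phi> where "\<phi> z = form_inner p (gram g c z) (\<gamma> c z) (\<gamma> c z)" for z
    define N where "N = \<phi> -` {0<..} \<inter> chart_img c"
    have "continuous_on (chart_img c) \<phi>"
      unfolding \<phi>_def by (rule smooth_on_continuous_on[OF form_inner_smooth[OF w w c]])
    then have N: "open N" "N \<subseteq> chart_img c"
      unfolding N_def using chart_img_open[OF c] by (auto simp: continuous_on_open_vimage)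
    let ?S = "chart_inv c ` N"
    have S: "?S \<in> sets vol" by (intro openin_sets_vol chart_inv_image_openin c N)
    have Sdom: "?S \<subseteq> chart_dom c" using N by auto
    have img: "chart_map c ` ?S = N" using N by (force simp: image_iff)
    have "AE x in vol. x \<notin> ?S"
      using AE0
    proof eventually_elim
      case (elim x)
      show ?case
      proof
        assume "x \<in> ?S"
        then obtain z where z: "z \<in> N" "x = chart_inv c z" by blast
        then have "pt_inner p \<gamma> \<gamma> x = \<phi> z"
          using N c pt_inner_eq[OF w w c, of x] by (auto simp: \<phi>_def)
        then show False using elim z(1) by (simp add: N_def)
      qed
    qed
    then have "emeasure vol ?S = 0" using AE_iff_null_sets[OF S] by auto
    then have "(\<integral>\<^sup>+z. ennreal (sqrt (det (gram g c z))) * indicator N z \<partial>lborel) = 0"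
      using emeasure_vol[OF c S Sdom] img by simp
    moreover have "(\<lambda>z. ennreal (sqrt (det (gram g c z))) * indicator N z) = (\<lambda>z. ennreal (dens c z) * indicator N z)"
    proof
      fix z
      show "ennreal (sqrt (det (gram g c z))) * indicator N z = ennreal (dens c z) * indicator N z"
        using N(2) by (cases "z \<in> N") (auto simp: dens_def)
    qed
    moreover have "(\<lambda>z. ennreal (dens c z) * indicator N z) \<in> borel_measurable lborel"
      using dens_measurable[OF c] N by simp
    ultimately have "AE z in lborel. ennreal (dens c z) * indicator N z = 0"
      by (subst nn_integral_0_iff_AE[symmetric]) simp_all
    then have "AE z in lborel. z \<notin> N"
    proof eventually_elim
      case (elim z)
      show ?case
      proof
        assume "z \<in> N"
        then have "0 < dens c z" using N spd_det_pos[OF gram_spd[OF c]] by (auto simp: dens_def)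
        then show False using elim \<open>z \<in> N\<close> by simp
      qed
    qed
    then have "N \<in> null_sets lborel" using N AE_iff_null_sets[of N lborel] by simp
    then have "negligible N" by (simp add: negligible_iff_null_sets null_sets_completionI)
    then have "N = {}" using open_not_negligible N by blast
    then have "\<not> 0 < \<phi> y" using y by (auto simp: N_def)
    then have "\<phi> y = 0"
      using form_inner_pos(1)[OF gram_spd[OF c y] tensor_field_multilinear[OF w]] by (simp add: \<phi>_def not_less antisym)
    then have "\<gamma> c y = (\<lambda>_. 0)"
      by (intro form_inner_pos(2)[OF gram_spd[OF c y] tensor_field_multilinear[OF w]]) (simp add: \<phi>_def)
    then show ?thesis by simp
  qed
  then show ?thesis by (intro ext) simp
qed

end

section \<open>The codifferential\<close>

context manifold begin

text \<open>The closed ball is compact, and compact sets in a Hausdorff space are closed. Its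
  complement is therefore open, so extensions by 0 from a chart are smooth.\<close>

lemma chart_cball_closedin:
  assumes c: "c \<in> A" and sub: "cball y r \<subseteq> chart_img c"
  shows "closedin X (chart_inv c ` cball y r)"
proof -
  have "compactin (top_of_set (chart_img c)) (cball y r)"
    using sub by (simp add: compactin_subtopology)
  then have "compactin X (chart_inv c ` cball y r)"
    by (rule image_compactin[OF _ chart_inv_continuous_map[OF c]])
  then show ?thesis
    using closed_manifold by (intro compactin_imp_closedin) (auto simp: closed_manifold_def)
qed

lemma chart_complement_open:
  assumes c: "c \<in> A" and sub: "cball y r \<subseteq> chart_img c" and c': "c' \<in> A"
  shows "open {z \<in> chart_img c'. chart_inv c' z \<notin> chart_inv c ` cball y r}"
proof -
  let ?K = "chart_inv c ` cball y r"
  have "openin X (chart_dom c' - ?K)"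
    by (intro openin_diff chart_dom_openin c' chart_cball_closedin c sub)
  then have "open (chart_map c' ` (chart_dom c' - ?K))" by (intro chart_image_open c') auto
  moreover have "chart_map c' ` (chart_dom c' - ?K) = {z \<in> chart_img c'. chart_inv c' z \<notin> ?K}"
    using c' by (force simp: image_iff)
  ultimately show ?thesis by simp
qed

definition chart_bump :: "('a, 'n) chart \<Rightarrow> real ^ 'n \<Rightarrow> real \<Rightarrow> 'a \<Rightarrow> real" where
  "chart_bump c y r x = (if x \<in> chart_dom c then bump y r (chart_map c x) else 0)"

lemma chart_bump_nonneg: "0 \<le> chart_bump c y r x"
  by (simp add: chart_bump_def bump_nonneg)

lemma chart_bump_zero:
  assumes c: "c \<in> A" and r: "0 < r" and x: "x \<notin> chart_inv c ` cball y r"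
  shows "chart_bump c y r x = 0"
proof (cases "x \<in> chart_dom c")
  case True
  then have "chart_map c x \<notin> cball y r" using x c by (metis chart_inv_map imageI)
  then have "\<not> 0 < bump y r (chart_map c x)" using bump_pos_iff[OF r, of y "chart_map c x"] by auto
  then show ?thesis using True bump_nonneg[of y r "chart_map c x"] by (simp add: chart_bump_def)
qed (simp add: chart_bump_def)

lemma chart_bump_pos:
  assumes c: "c \<in> A" and r: "0 < r" and sub: "cball y r \<subseteq> chart_img c" and x: "x \<in> chart_inv c ` ball y r"
  shows "0 < chart_bump c y r x"
proof -
  obtain z where z: "z \<in> ball y r" "x = chart_inv c z" using x by blast
  then have "z \<in> chart_img c" using sub ball_subset_cball[of y r] by blast
  then show ?thesis using z bump_pos_iff[OF r] by (auto simp: chart_bump_def)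
qed

text \<open>Two open sets cover the manifold: the domain of \<open>c\<close>, where the function is
  a bump composed with a transition map, and the complement of the closed ball, where it is
  0.\<close>

lemma chart_bump_smooth:
  assumes c: "c \<in> A" and r: "0 < r" and sub: "cball y r \<subseteq> chart_img c" and c': "c' \<in> A"
  shows "smooth_on (chart_img c') (\<lambda>z. chart_bump c y r (chart_inv c' z))"
proof (rule smooth_on_local[OF chart_img_open[OF c']])
  fix z assume z: "z \<in> chart_img c'"
  show "\<exists>U. open U \<and> z \<in> U \<and> smooth_on U (\<lambda>z. chart_bump c y r (chart_inv c' z))"
  proof (cases "chart_inv c' z \<in> chart_dom c")
    case True
    let ?U = "local_dom c' id c"
    have U: "open ?U" "z \<in> ?U"
      using True z c c' local_dom_open[OF c' c smooth_map_continuous[OF smooth_map_id]]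
      by (auto simp: local_dom_eq)
    have "smooth_on ?U (\<lambda>z. bump y r (local_rep c' id c z))"
      by (rule smooth_on_compose[OF U(1) _ _ smooth_local_rep[OF smooth_map_id c' c] smooth_on_bump]) auto
    then have "smooth_on ?U (\<lambda>z. chart_bump c y r (chart_inv c' z))"
      by (rule smooth_on_cong[OF U(1), rotated]) (use c' in \<open>simp add: local_dom_eq chart_bump_def local_rep_def\<close>)
    then show ?thesis using U by blast
  next
    case False
    let ?U = "{z \<in> chart_img c'. chart_inv c' z \<notin> chart_inv c ` cball y r}"
    have U: "open ?U" by (rule chart_complement_open[OF c sub c'])
    have "z \<in> ?U" using False z sub by auto
    moreover have "smooth_on ?U (\<lambda>z. chart_bump c y r (chart_inv c' z))"
      by (rule smooth_on_cong[OF U _ smooth_on_const[OF U, of 0]])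
         (use chart_bump_zero[OF c r] in auto)
    ultimately show ?thesis using U by blast
  qed
qed

text \<open>The bumps are positive on the covering balls, so their sum has no zero and division by
  it is smooth.\<close>

lemma partition_of_unity:
  obtains P and \<rho> :: "('a, 'n) chart \<times> (real ^ 'n) \<times> real \<Rightarrow> 'a \<Rightarrow> real"
  where "finite P"
    and "\<And>c y r. (c, y, r) \<in> P \<Longrightarrow> c \<in> A \<and> 0 < r \<and> cball y r \<subseteq> chart_img c"
    and "\<And>c y r x. (c, y, r) \<in> P \<Longrightarrow> x \<notin> chart_inv c ` cball y r \<Longrightarrow> \<rho> (c, y, r) x = 0"
    and "\<And>t c. t \<in> P \<Longrightarrow> c \<in> A \<Longrightarrow> smooth_on (chart_img c) (\<lambda>z. \<rho> t (chart_inv c z))"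
    and "\<And>x. x \<in> topspace X \<Longrightarrow> (\<Sum>t\<in>P. \<rho> t x) = 1"
proof -
  obtain P where P: "finite P" "\<And>c y r. (c, y, r) \<in> P \<Longrightarrow> c \<in> A \<and> 0 < r \<and> cball y r \<subseteq> chart_img c"
    "topspace X \<subseteq> (\<Union>(c, y, r)\<in>P. chart_inv c ` ball y r)"
    by (rule chart_ball_cover) blast
  define u where "u t = (case t of (c, y, r) \<Rightarrow> chart_bump c y r)" for t
  define s where "s x = (\<Sum>t\<in>P. u t x)" for x
  have pos: "0 < s x" if x: "x \<in> topspace X" for x
  proof -
    obtain c y r where t: "(c, y, r) \<in> P" "x \<in> chart_inv c ` ball y r" using P(3) x by fastforce
    have "0 < u (c, y, r) x" using chart_bump_pos[OF _ _ _ t(2)] P(2)[OF t(1)] by (simp add: u_def)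
    then show ?thesis unfolding s_def
      by (intro sum_pos2[OF P(1) t(1)]) (auto simp: u_def chart_bump_nonneg split: prod.splits)
  qed
  have u: "smooth_on (chart_img c) (\<lambda>z. u t (chart_inv c z))" if "t \<in> P" "c \<in> A" for t c
    using that chart_bump_smooth P(2) by (cases t) (auto simp: u_def)
  have s: "smooth_on (chart_img c) (\<lambda>z. s (chart_inv c z))" if "c \<in> A" for c
    unfolding s_def by (intro smooth_on_sum chart_img_open that u)
  show thesis
  proof (rule that[of P "\<lambda>t x. u t x * inverse (s x)"])
    show "smooth_on (chart_img c) (\<lambda>z. u t (chart_inv c z) * inverse (s (chart_inv c z)))"
      if "t \<in> P" "c \<in> A" for t c
      by (intro smooth_on_mult smooth_on_inverse chart_img_open that u s)
         (use pos chart_inv_in_topspace[OF that(2)] in force)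
    show "(\<Sum>t\<in>P. u t x * inverse (s x)) = 1" if "x \<in> topspace X" for x
      using pos[OF that] by (simp add: s_def flip: sum_distrib_right)
    show "u (c, y, r) x * inverse (s x) = 0" if "(c, y, r) \<in> P" "x \<notin> chart_inv c ` cball y r" for c y r x
      using chart_bump_zero[OF _ _ that(2)] P(2)[OF that(1)] by (simp add: u_def)
  qed (use P in auto)
qed

end

section \<open>Integration by parts\<close>

context measured_riemannian begin

text \<open>In a chart the pointwise identity says that \<open>(\<langle>d \<alpha>, \<beta>\<rangle> + \<langle>\<alpha>, \<star> d \<star> \<beta>\<rangle>) sqrt (det g)\<close> is the
  divergence of the contraction of \<open>\<alpha>\<close> with the density \<open>raised \<beta>\<close>.\<close>

definition raised :: "('a, 'n) tensor_field \<Rightarrow> ('a, 'n) chart \<Rightarrow> real ^ 'n \<Rightarrow> (real ^ 'n) list \<Rightarrow> real" where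
  "raised \<beta> c z vs = sqrt (det (gram g c z)) * \<beta> c z (map ((*v) (matrix_inv (gram g c z))) vs)"

text \<open>In index notation this is the vector density sqrt(det g) \<alpha>_I \<beta>^iI / p!. It
  is set to 0 off the chart so that it becomes a function on the whole coordinate space, smooth
  there if \<open>\<alpha>\<close> is supported in a ball inside the chart.\<close>

definition contraction ::
  "nat \<Rightarrow> ('a, 'n) tensor_field \<Rightarrow> ('a, 'n) tensor_field \<Rightarrow> ('a, 'n) chart \<Rightarrow> 'n \<Rightarrow> real ^ 'n \<Rightarrow> real" where
  "contraction p \<alpha> \<beta> c i z = (if z \<in> chart_img c
     then (\<Sum>I\<in>indices p. \<alpha> c z (axes I) * raised \<beta> c z (axes (i # I))) * (1 / fact p) else 0)"

lemma raised_smooth_on: "\<beta> \<in> tensor_fields A p \<Longrightarrow> c \<in> A \<Longrightarrow> smooth_on (chart_img c) (\<lambda>z. raised \<beta> c z vs)"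
  unfolding raised_def by (intro smooth_on_mult chart_img_open sqrt_det_gram_smooth raised_smooth)

lemma raised_multilinear: "\<beta> \<in> tensor_fields A p \<Longrightarrow> multilinear p (raised \<beta> c z)"
  unfolding raised_def[abs_def]
  by (intro multilinear_scale multilinear_map[OF tensor_field_multilinear] matrix_vector_mul_linear)

lemma raised_alternating: "\<beta> \<in> forms A p \<Longrightarrow> alternating (raised \<beta> c z)"
  unfolding raised_def[abs_def] by (intro alternating_scale alternating_map form_alternating)

lemma contraction_smooth:
  assumes "\<alpha> \<in> tensor_fields A p" "\<beta> \<in> tensor_fields A (Suc p)" "c \<in> A"
  shows "smooth_on (chart_img c) (contraction p \<alpha> \<beta> c i)"
proof -
  have "smooth_on (chart_img c) (\<lambda>z. (\<Sum>I\<in>indices p. \<alpha> c z (axes I) * raised \<beta> c z (axes (i # I))) * (1 / fact p))"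
    by (intro smooth_on_mult smooth_on_sum smooth_on_const chart_img_open assms(3)
        raised_smooth_on[OF assms(2)] tensor_field_smooth[OF assms(1)])
  then show ?thesis
    by (rule smooth_on_cong[OF chart_img_open[OF assms(3)], rotated]) (simp add: contraction_def)
qed

text \<open>The product rule splits the divergence. Derivatives of \<open>\<alpha>\<close> give the
  term with \<open>ext_d \<alpha>\<close>; derivatives of \<open>raised \<beta>\<close> give, by
  \<open>star_d_star_divergence\<close>, the term with \<open>\<sigma>\<close>.\<close>

lemma divergence_identity:
  assumes a: "\<alpha> \<in> forms A p" and b: "\<beta> \<in> forms A (Suc p)"
    and pq: "Suc p + q = CARD('n)" and ev: "even CARD('n)" and c: "c \<in> A" and z: "z \<in> chart_img c"
  defines "\<sigma> \<equiv> hstar (Suc q) (ext_d (hstar (Suc p) \<beta>))"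
  shows "sqrt (det (gram g c z)) * (form_inner (Suc p) (gram g c z) (ext_d \<alpha> c z) (\<beta> c z) +
      form_inner p (gram g c z) (\<alpha> c z) (\<sigma> c z)) =
    (\<Sum>i\<in>UNIV. frechet_derivative (contraction p \<alpha> \<beta> c i) (at z) (axis i 1))"
proof -
  note at = form_tensor_field[OF a] and bt = form_tensor_field[OF b]
  note o = chart_img_open[OF c]
  note G = gram_spd[OF c z]
  define s where "s = ori c z"
  define \<xi> where "\<xi> = hstar (Suc p) \<beta>"
  have \<xi>: "\<xi> \<in> forms A q" unfolding \<xi>_def by (rule hstar_forms[OF b pq])
  define w where "w i vs = frechet_derivative (\<lambda>z. raised \<beta> c z vs) (at z) (axis i 1)" for i vs
  define xi where "xi i J = frechet_derivative (\<lambda>z. \<xi> c z (axes J)) (at z) (axis i 1)" for i and J :: "'n list"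
  define da where "da i J = frechet_derivative (\<lambda>z. \<alpha> c z (axes J)) (at z) (axis i 1)" for i and J :: "'n list"
  note Dr = smooth_on_has_derivative[OF raised_smooth_on[OF bt c] o z]
  note Da = tensor_field_has_derivative[OF at z]
  have w_multi: "multilinear (Suc p) (w i)" for i
    unfolding w_def[abs_def] by (rule multilinear_derivative[OF raised_multilinear[OF bt] Dr])
  have w_alt: "alternating (w i)" for i
    unfolding alternating_def
  proof (intro allI impI)
    fix vs :: "(real ^ 'n) list" and k l assume "k < l" "l < length vs" "vs ! k = vs ! l"
    then have "(\<lambda>z. raised \<beta> c z vs) = (\<lambda>z. 0)"
      using raised_alternating[OF b] unfolding alternating_def by blast
    then show "w i vs = 0" by (simp add: w_def)
  qed
  have xi: "xi i J = s / fact (Suc p) * (\<Sum>K\<in>indices (Suc p). w i (axes K) * vdet (axes K @ axes J))" for i J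
  proof -
    \<comment> \<open>Near \<open>z\<close> the orientation sign is the constant \<open>s\<close>,
      so in the derivative of the star only \<open>raised \<beta>\<close> is differentiated.\<close>
    define U where "U = ori c -` ball s 1 \<inter> chart_img c"
    have "continuous_on (chart_img c) (ori c)" using orient c by (simp add: orientation_def)
    then have U: "open U" unfolding U_def using o by (metis continuous_on_open_vimage open_ball)
    have zU: "z \<in> U" using z by (simp add: U_def s_def)
    have const: "ori c y = s" if "y \<in> U" for y
      using orientation_sign[OF c, of y] orientation_sign[OF c z] that
      by (auto simp: U_def dist_real_def s_def)
    have "((\<lambda>z. s / fact (Suc p) * (\<Sum>K\<in>indices (Suc p). raised \<beta> c z (axes K) * vdet (axes K @ axes J)))
        has_derivative (\<lambda>h. s / fact (Suc p) * (\<Sum>K\<in>indices (Suc p).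
          frechet_derivative (\<lambda>z. raised \<beta> c z (axes K)) (at z) h * vdet (axes K @ axes J)))) (at z)"
      by (intro has_derivative_mult_right has_derivative_sum has_derivative_mult_left Dr)
    then have "((\<lambda>z. \<xi> c z (axes J)) has_derivative (\<lambda>h. s / fact (Suc p) * (\<Sum>K\<in>indices (Suc p).
          frechet_derivative (\<lambda>z. raised \<beta> c z (axes K)) (at z) h * vdet (axes K @ axes J)))) (at z)"
    proof (rule has_derivative_transform_within_open[OF _ U zU])
      fix y assume "y \<in> U"
      then have "y \<in> chart_img c" by (simp add: U_def)
      then show "s / fact (Suc p) * (\<Sum>K\<in>indices (Suc p). raised \<beta> c y (axes K) * vdet (axes K @ axes J)) =
          \<xi> c y (axes J)"
        using const[OF \<open>y \<in> U\<close>] c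
        by (simp add: \<xi>_def hstar_def star_at_def raised_def sum_distrib_left mult_ac del: fact_Suc)
    qed
    from fun_cong[OF frechet_derivative_at[OF this, symmetric]] show ?thesis
      unfolding xi_def w_def .
  qed
  have e: "ext_d \<xi> c z (axes L) = (\<Sum>k<Suc q. (-1) ^ k * xi (L ! k) (remove_nth k L))"
    if "length L = Suc q" for L
    unfolding ext_d_def xi_def using z that by (simp add: take_map drop_map del: sum.lessThan_Suc)
  have s: "s * s = 1" unfolding s_def by (rule orientation_square[OF c z])
  have qp: "Suc q + p = CARD('n)" using pq by simp
  have part1: "sqrt (det (gram g c z)) * form_inner p (gram g c z) (\<alpha> c z) (\<sigma> c z) =
      (\<Sum>I\<in>indices p. \<Sum>i\<in>UNIV. \<alpha> c z (axes I) * w i (axis i 1 # axes I)) / fact p"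
  proof -
    have "\<sigma> c z = star_at (Suc q) (gram g c z) s (ext_d \<xi> c z)"
      using c z by (simp add: \<sigma>_def hstar_def[abs_def] \<xi>_def s_def)
    then show ?thesis
      using form_inner_star_at[OF G qp tensor_field_multilinear[OF at] ext_d_multilinear[OF form_tensor_field[OF \<xi>]], of c z s c z]
        star_d_star_divergence[OF w_multi w_alt pq ev s xi e, of "\<alpha> c z"]
      by simp
  qed
  have part2: "sqrt (det (gram g c z)) * form_inner (Suc p) (gram g c z) (ext_d \<alpha> c z) (\<beta> c z) =
      (\<Sum>i\<in>UNIV. \<Sum>J\<in>indices p. da i J * raised \<beta> c z (axis i 1 # axes J)) / fact p"
  proof -
    have "sqrt (det (gram g c z)) * form_inner (Suc p) (gram g c z) (ext_d \<alpha> c z) (\<beta> c z) =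
        (\<Sum>L\<in>indices (Suc p). ext_d \<alpha> c z (axes L) * raised \<beta> c z (axes L)) / fact (Suc p)"
      unfolding form_inner_eq[OF G tensor_field_multilinear[OF bt]] raised_def
      by (simp add: sum_distrib_left mult_ac del: fact_Suc)
    also have "(\<Sum>L\<in>indices (Suc p). ext_d \<alpha> c z (axes L) * raised \<beta> c z (axes L)) =
        (\<Sum>L\<in>indices (Suc p). (\<Sum>k<Suc p. (-1) ^ k * da (L ! k) (remove_nth k L)) * raised \<beta> c z (axes L @ []))"
      unfolding ext_d_def da_def using z
      by (intro sum.cong refl) (simp add: take_map drop_map del: sum.lessThan_Suc)
    \<comment> \<open>The factor \<open>Suc p\<close> reduces the normalisation
      \<open>fact (Suc p)\<close> to \<open>fact p\<close>.\<close>
    also have "\<dots> = real (Suc p) * (\<Sum>i\<in>UNIV. \<Sum>J\<in>indices p. da i J * raised \<beta> c z (axis i 1 # axes J @ []))"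
      by (rule alternating_sum_remove[OF raised_multilinear[OF bt] raised_alternating[OF b]])
    finally show ?thesis
      by (simp only: append_Nil2 fact_Suc mult_divide_mult_cancel_left_if of_nat_eq_0_iff
          nat.distinct if_False)
  qed
  have D: "frechet_derivative (contraction p \<alpha> \<beta> c i) (at z) (axis i 1) =
    (\<Sum>I\<in>indices p. \<alpha> c z (axes I) * w i (axis i 1 # axes I) + da i I * raised \<beta> c z (axis i 1 # axes I)) * (1 / fact p)" for i
  proof -
    have "((\<lambda>z. (\<Sum>I\<in>indices p. \<alpha> c z (axes I) * raised \<beta> c z (axes (i # I))) * (1 / fact p)) has_derivative
      (\<lambda>h. (\<Sum>I\<in>indices p. \<alpha> c z (axes I) * frechet_derivative (\<lambda>z. raised \<beta> c z (axes (i # I))) (at z) h +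
        frechet_derivative (\<lambda>z. \<alpha> c z (axes I)) (at z) h * raised \<beta> c z (axes (i # I))) * (1 / fact p))) (at z)"
      by (intro has_derivative_mult_left has_derivative_sum has_derivative_mult Da Dr)
    then have "(contraction p \<alpha> \<beta> c i has_derivative
      (\<lambda>h. (\<Sum>I\<in>indices p. \<alpha> c z (axes I) * frechet_derivative (\<lambda>z. raised \<beta> c z (axes (i # I))) (at z) h +
        frechet_derivative (\<lambda>z. \<alpha> c z (axes I)) (at z) h * raised \<beta> c z (axes (i # I))) * (1 / fact p))) (at z)"
      by (rule has_derivative_transform_within_open[OF _ o z]) (simp add: contraction_def)
    from fun_cong[OF frechet_derivative_at[OF this, symmetric]] show ?thesis
      unfolding w_def da_def by simp
  qed
  show ?thesis
    unfolding D distrib_left part1 part2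
    by (simp add: sum.distrib sum_divide_distrib add_divide_distrib sum.swap[of _ UNIV])
qed

lemma ext_d_locally_zero:
  assumes "open U" "z \<in> U" "\<And>y vs. y \<in> U \<Longrightarrow> \<alpha> c y vs = 0"
  shows "ext_d \<alpha> c z vs = 0"
proof -
  have "frechet_derivative (\<lambda>y. \<alpha> c y ws) (at z) = (\<lambda>_. 0)" for ws
  proof -
    have "((\<lambda>_. 0) has_derivative (\<lambda>_. 0)) (at z)" by simp
    then have "((\<lambda>y. \<alpha> c y ws) has_derivative (\<lambda>_. 0)) (at z)"
      by (rule has_derivative_transform_within_open[OF _ assms(1,2)]) (simp add: assms(3))
    then show ?thesis by (rule frechet_derivative_at[symmetric])
  qed
  then show ?thesis by (simp add: ext_d_def)
qed

text \<open>For \<open>\<alpha>\<close> supported in one coordinate ball the integral becomes that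
  of a divergence of compactly supported functions, which is 0.\<close>

lemma L2_adjoint_local:
  assumes a: "\<alpha> \<in> forms A p" and b: "\<beta> \<in> forms A (Suc p)"
    and pq: "Suc p + q = CARD('n)" and ev: "even CARD('n)"
    and c: "c \<in> A" and sub: "cball y r \<subseteq> chart_img c"
    and supp: "\<And>c' z vs. c' \<in> A \<Longrightarrow> z \<in> chart_img c' \<Longrightarrow> chart_inv c' z \<notin> chart_inv c ` cball y r \<Longrightarrow> \<alpha> c' z vs = 0"
  shows "L2_inner A g vol (Suc p) (ext_d \<alpha>) \<beta> +
    L2_inner A g vol p \<alpha> (hstar (Suc q) (ext_d (hstar (Suc p) \<beta>))) = 0"
proof -
  define \<sigma> where "\<sigma> = hstar (Suc q) (ext_d (hstar (Suc p) \<beta>))"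
  have "Suc q + p = CARD('n)" using pq by simp
  then have \<sigma>: "\<sigma> \<in> tensor_fields A p"
    unfolding \<sigma>_def by (intro form_tensor_field hstar_forms ext_d_forms b pq)
  note at = form_tensor_field[OF a] and bt = form_tensor_field[OF b]
  note dt = form_tensor_field[OF ext_d_forms[OF a]]
  define F where "F x = pt_inner (Suc p) (ext_d \<alpha>) \<beta> x + pt_inner p \<alpha> \<sigma> x" for x
  have F_cont: "continuous_map X euclideanreal F"
    unfolding F_def by (intro continuous_map_add pt_inner_continuous at bt dt \<sigma>)
  \<comment> \<open>The complement of the closed ball is open, so there \<open>\<alpha>\<close>
    vanishes together with its exterior derivative.\<close>
  have F0: "F x = 0" if x: "x \<in> topspace X" "x \<notin> chart_inv c ` cball y r" for x
  proof -
    define c1 where "c1 = chart_at A x"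
    have c1: "c1 \<in> A" "x \<in> chart_dom c1" using chart_at[OF x(1)] by (auto simp: c1_def)
    define U where "U = {z \<in> chart_img c1. chart_inv c1 z \<notin> chart_inv c ` cball y r}"
    have U: "open U" unfolding U_def by (rule chart_complement_open[OF c sub c1(1)])
    have xU: "chart_map c1 x \<in> U" using c1 x by (simp add: U_def)
    have 0: "\<alpha> c1 z vs = 0" if "z \<in> U" for z vs using supp c1(1) that by (simp add: U_def)
    have 1: "ext_d \<alpha> c1 (chart_map c1 x) vs = 0" for vs by (rule ext_d_locally_zero[OF U xU]) (rule 0)
    show ?thesis
      unfolding F_def pt_inner_eq[OF dt bt c1] pt_inner_eq[OF at \<sigma> c1]
      by (simp add: form_inner_zero 1 0[OF xU])
  qed
  have F_out: "F x = 0" if "x \<in> topspace X" "x \<notin> chart_dom c" for x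
    using F0[OF that(1)] that(2) sub by (metis chart_inv_in_dom imageE subsetD)
  define W where "W i = contraction p \<alpha> \<beta> c i" for i
  have W0: "W i z = 0" if "z \<notin> cball y r" for i z
  proof (cases "z \<in> chart_img c")
    case True
    have "chart_inv c z \<notin> chart_inv c ` cball y r"
    proof
      assume "chart_inv c z \<in> chart_inv c ` cball y r"
      then obtain z' where "z' \<in> cball y r" "chart_inv c z = chart_inv c z'" by blast
      then show False using that True sub by (metis chart_map_inv subsetD)
    qed
    then show ?thesis using supp[OF c True] by (simp add: W_def contraction_def)
  qed (simp add: W_def contraction_def)
  \<comment> \<open>The chart image and the complement of the closed ball are open and cover the
    coordinate space; on the latter \<open>W i\<close> is 0.\<close>
  have W_smooth: "smooth_on UNIV (W i)" for i
  proof (rule smooth_on_local)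
    fix z
    show "\<exists>U. open U \<and> z \<in> U \<and> smooth_on U (W i)"
    proof (cases "z \<in> chart_img c")
      case True
      then show ?thesis using contraction_smooth[OF at bt c] chart_img_open[OF c] by (auto simp: W_def)
    next
      case False
      have "open (- cball y r)" by auto
      moreover have "smooth_on (- cball y r) (W i)"
        by (rule smooth_on_cong[OF _ _ smooth_on_const[of _ 0]]) (use W0 in auto)
      ultimately show ?thesis using False sub by blast
    qed
  qed simp
  have W_der: "(W i has_derivative frechet_derivative (W i) (at z)) (at z)" for i z
    by (rule smooth_on_has_derivative[OF W_smooth]) auto
  note stokes = integral_derivative_compact_support[OF W_der
      smooth_on_continuous_on[OF smooth_on_frechet_derivative[OF W_smooth]] W0]
  have point: "dens c z * F (chart_inv c z) = (\<Sum>i\<in>UNIV. frechet_derivative (W i) (at z) (axis i 1))" for z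
  proof (cases "z \<in> chart_img c")
    case True
    then have "F (chart_inv c z) = form_inner (Suc p) (gram g c z) (ext_d \<alpha> c z) (\<beta> c z) +
        form_inner p (gram g c z) (\<alpha> c z) (\<sigma> c z)"
      unfolding F_def using pt_inner_eq[OF dt bt c, of "chart_inv c z"] pt_inner_eq[OF at \<sigma> c, of "chart_inv c z"]
      by simp
    then show ?thesis
      using divergence_identity[OF a b pq ev c True] True by (simp add: dens_def W_def \<sigma>_def)
  next
    case False
    have "frechet_derivative (W i) (at z) = (\<lambda>_. 0)" for i
    proof -
      have "((\<lambda>_. 0) has_derivative (\<lambda>_. 0)) (at z)" by simp
      then have "(W i has_derivative (\<lambda>_. 0)) (at z)"
        by (rule has_derivative_transform_within_open[of _ _ _ _ "- cball y r"]) (use W0 False sub in auto)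
      then show ?thesis by (rule frechet_derivative_at[symmetric])
    qed
    then show ?thesis using False by (simp add: dens_def)
  qed
  have "(LINT x|vol. F x) = (LINT z|lborel. dens c z * F (chart_inv c z))"
    by (rule integral_chart[OF c F_cont F_out])
  also have "\<dots> = 0" unfolding point using stokes by (simp add: Bochner_Integration.integral_sum)
  finally have "(LINT x|vol. F x) = 0" .
  then show ?thesis
    unfolding F_def L2_inner_eq \<sigma>_def[symmetric]
    by (simp add: Bochner_Integration.integral_add pt_inner_integrable at bt dt \<sigma>)
qed

lemma pt_inner_add_left: "pt_inner p (\<alpha> + \<alpha>') \<beta> x = pt_inner p \<alpha> \<beta> x + pt_inner p \<alpha>' \<beta> x"
  by (simp add: pt_inner_def Let_def plus_fun_def form_inner_add_left)

lemma pt_inner_add_right: "pt_inner p \<alpha> (\<beta> + \<beta>') x = pt_inner p \<alpha> \<beta> x + pt_inner p \<alpha> \<beta>' x"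
  by (simp add: pt_inner_def Let_def plus_fun_def form_inner_add_right)

lemma L2_add_left:
  assumes "\<alpha> \<in> forms A p" "\<alpha>' \<in> forms A p" "\<beta> \<in> forms A p"
  shows "L2_inner A g vol p (\<alpha> + \<alpha>') \<beta> = L2_inner A g vol p \<alpha> \<beta> + L2_inner A g vol p \<alpha>' \<beta>"
  unfolding L2_inner_eq pt_inner_add_left
  by (intro Bochner_Integration.integral_add pt_inner_integrable form_tensor_field assms)

lemma L2_add_right:
  assumes "\<alpha> \<in> forms A p" "\<beta> \<in> forms A p" "\<beta>' \<in> forms A p"
  shows "L2_inner A g vol p \<alpha> (\<beta> + \<beta>') = L2_inner A g vol p \<alpha> \<beta> + L2_inner A g vol p \<alpha> \<beta>'"
  unfolding L2_inner_eq pt_inner_add_right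
  by (intro Bochner_Integration.integral_add pt_inner_integrable form_tensor_field assms)

lemma L2_scale_right: "L2_inner A g vol p \<alpha> (tensor_scale r \<beta>) = r * L2_inner A g vol p \<alpha> \<beta>"
  by (simp add: L2_inner_def Let_def tensor_scale_def form_inner_scale_right)

text \<open>A partition of unity writes \<open>\<alpha>\<close> as a finite sum of forms to which
  \<open>L2_adjoint_local\<close> applies, and the left side is additive in
  \<open>\<alpha>\<close>.\<close>

lemma L2_adjoint:
  assumes a: "\<alpha> \<in> forms A p" and b: "\<beta> \<in> forms A (Suc p)"
    and pq: "Suc p + q = CARD('n)" and ev: "even CARD('n)"
  shows "L2_inner A g vol (Suc p) (ext_d \<alpha>) \<beta> +
    L2_inner A g vol p \<alpha> (hstar (Suc q) (ext_d (hstar (Suc p) \<beta>))) = 0"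
proof -
  define \<sigma> where "\<sigma> = hstar (Suc q) (ext_d (hstar (Suc p) \<beta>))"
  have "Suc q + p = CARD('n)" using pq by simp
  then have \<sigma>: "\<sigma> \<in> forms A p"
    unfolding \<sigma>_def by (intro hstar_forms ext_d_forms b pq)
  define \<Phi> where "\<Phi> \<alpha> = L2_inner A g vol (Suc p) (ext_d \<alpha>) \<beta> + L2_inner A g vol p \<alpha> \<sigma>" for \<alpha>
  have \<Phi>_add: "\<Phi> (\<alpha> + \<alpha>') = \<Phi> \<alpha> + \<Phi> \<alpha>'" if "\<alpha> \<in> forms A p" "\<alpha>' \<in> forms A p" for \<alpha> \<alpha>'
    unfolding \<Phi>_def ext_d_add[OF that]
    by (simp add: L2_add_left[OF ext_d_forms[OF that(1)] ext_d_forms[OF that(2)] b] L2_add_left[OF that \<sigma>])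
  obtain P and \<rho> :: "('a, 'n) chart \<times> (real ^ 'n) \<times> real \<Rightarrow> 'a \<Rightarrow> real"
    where P: "finite P"
      "\<And>c y r. (c, y, r) \<in> P \<Longrightarrow> c \<in> A \<and> 0 < r \<and> cball y r \<subseteq> chart_img c"
      "\<And>c y r x. (c, y, r) \<in> P \<Longrightarrow> x \<notin> chart_inv c ` cball y r \<Longrightarrow> \<rho> (c, y, r) x = 0"
      "\<And>t c. t \<in> P \<Longrightarrow> c \<in> A \<Longrightarrow> smooth_on (chart_img c) (\<lambda>z. \<rho> t (chart_inv c z))"
      "\<And>x. x \<in> topspace X \<Longrightarrow> (\<Sum>t\<in>P. \<rho> t x) = 1"
    by (rule partition_of_unity) blast
  define mul where "mul u = (\<lambda>c y vs. u (chart_inv c y) * \<alpha> c y vs)" for u :: "'a \<Rightarrow> real"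
  have mul: "mul u \<in> forms A p" if "\<And>c. c \<in> A \<Longrightarrow> smooth_on (chart_img c) (\<lambda>y. u (chart_inv c y))" for u
    unfolding mul_def by (rule forms_mult[OF a that])
  have each: "\<Phi> (mul (\<rho> t)) = 0" if t: "t \<in> P" for t
  proof -
    obtain c y r where ct: "t = (c, y, r)" by (cases t)
    have "L2_inner A g vol (Suc p) (ext_d (mul (\<rho> t))) \<beta> +
        L2_inner A g vol p (mul (\<rho> t)) (hstar (Suc q) (ext_d (hstar (Suc p) \<beta>))) = 0"
      by (rule L2_adjoint_local[OF mul b pq ev, of "\<rho> t" c y r])
         (use P(2-4) t ct in \<open>auto simp: mul_def\<close>)
    then show ?thesis by (simp add: \<Phi>_def \<sigma>_def)
  qed
  have "\<Phi> (mul (\<lambda>x. \<Sum>t\<in>Q. \<rho> t x)) = 0" if "finite Q" "Q \<subseteq> P" for Q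
    using that
  proof (induction Q)
    case empty
    have "mul (\<lambda>x. \<Sum>t\<in>{}. \<rho> t x) = 0" by (intro ext) (simp add: mul_def)
    moreover have "\<Phi> 0 = 0" using \<Phi>_add[OF forms_zero forms_zero] by simp
    ultimately show ?case by (simp only:)
  next
    case (insert t Q)
    have "mul (\<lambda>x. \<Sum>t\<in>insert t Q. \<rho> t x) = mul (\<rho> t) + mul (\<lambda>x. \<Sum>t\<in>Q. \<rho> t x)"
      using insert.hyps by (intro ext) (simp add: mul_def distrib_right)
    moreover have "mul (\<rho> t) \<in> forms A p" using insert.prems P(4) by (intro mul) auto
    moreover have "mul (\<lambda>x. \<Sum>t\<in>Q. \<rho> t x) \<in> forms A p"
      using insert.prems P(4) by (intro mul smooth_on_sum chart_img_open) auto
    moreover have "\<Phi> (mul (\<rho> t)) = 0" using insert.prems by (intro each) auto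
    moreover have "\<Phi> (mul (\<lambda>x. \<Sum>t\<in>Q. \<rho> t x)) = 0" using insert by auto
    ultimately show ?case using \<Phi>_add[of "mul (\<rho> t)" "mul (\<lambda>x. \<Sum>t\<in>Q. \<rho> t x)"] by (simp only:)
  qed
  from this[OF P(1) order_refl] have "\<Phi> (mul (\<lambda>x. \<Sum>t\<in>P. \<rho> t x)) = 0" .
  moreover have "mul (\<lambda>x. \<Sum>t\<in>P. \<rho> t x) = \<alpha>"
  proof (intro ext)
    fix c y vs
    show "mul (\<lambda>x. \<Sum>t\<in>P. \<rho> t x) c y vs = \<alpha> c y vs"
    proof (cases "c \<in> A \<and> y \<in> chart_img c")
      case True
      then show ?thesis using P(5) chart_inv_in_topspace by (simp add: mul_def)
    next
      case False
      then have "\<alpha> c y vs = 0" using tensor_field_zero[OF form_tensor_field[OF a]] by blast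
      then show ?thesis by (simp add: mul_def)
    qed
  qed
  ultimately show ?thesis by (simp add: \<Phi>_def \<sigma>_def)
qed

text \<open>\<open>L2_adjoint\<close> provides a form with the defining property, and definiteness
  of the L2 product excludes any other.\<close>

lemma codiff_eq:
  assumes b: "\<beta> \<in> forms A (Suc p)" and pq: "Suc p + q = CARD('n)" and ev: "even CARD('n)"
  shows "codiff A g vol p \<beta> = tensor_scale (- 1) (hstar (Suc q) (ext_d (hstar (Suc p) \<beta>)))"
  unfolding codiff_def
proof (rule the_equality)
  let ?\<sigma> = "tensor_scale (- 1) (hstar (Suc q) (ext_d (hstar (Suc p) \<beta>)))"
  have "Suc q + p = CARD('n)" using pq by simp
  then have \<sigma>: "?\<sigma> \<in> forms A p"
    by (intro forms_scale hstar_forms ext_d_forms b pq)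
  have adj: "L2_inner A g vol (Suc p) (ext_d \<alpha>) \<beta> = L2_inner A g vol p \<alpha> ?\<sigma>" if "\<alpha> \<in> forms A p" for \<alpha>
    using L2_adjoint[OF that b pq ev] unfolding L2_scale_right by simp
  then show "?\<sigma> \<in> forms A p \<and> (\<forall>\<alpha>\<in>forms A p. L2_inner A g vol (Suc p) (ext_d \<alpha>) \<beta> = L2_inner A g vol p \<alpha> ?\<sigma>)"
    using \<sigma> by blast
  fix \<gamma> assume \<gamma>: "\<gamma> \<in> forms A p \<and> (\<forall>\<alpha>\<in>forms A p. L2_inner A g vol (Suc p) (ext_d \<alpha>) \<beta> = L2_inner A g vol p \<alpha> \<gamma>)"
  \<comment> \<open>The difference of two candidates is tested against itself.\<close>
  let ?\<delta> = "\<gamma> + tensor_scale (- 1) ?\<sigma>"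
  have s: "tensor_scale (- 1) ?\<sigma> \<in> forms A p" by (rule forms_scale[OF \<sigma>])
  have \<delta>: "?\<delta> \<in> forms A p" using \<gamma> by (intro forms_add s) auto
  have "L2_inner A g vol p ?\<delta> ?\<delta> = L2_inner A g vol p ?\<delta> \<gamma> + (- 1) * L2_inner A g vol p ?\<delta> ?\<sigma>"
    using L2_add_right[OF \<delta> _ s, of \<gamma>] \<gamma> by (simp only: L2_scale_right)
  also have "\<dots> = 0" using \<gamma> adj[OF \<delta>] \<delta> by auto
  finally have "?\<delta> = 0" by (rule L2_definite[OF form_tensor_field[OF \<delta>]])
  then have "?\<delta> c y vs = 0" for c y vs by simp
  then have eq: "\<gamma> c y vs - ?\<sigma> c y vs = 0" for c y vs by (simp add: tensor_scale_def)
  show "\<gamma> = ?\<sigma>"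
  proof (intro ext)
    fix c y vs show "\<gamma> c y vs = ?\<sigma> c y vs" using eq[of c y vs] by linarith
  qed
qed

end

section \<open>Symmetry of the spectrum\<close>

text \<open>\<open>T\<close> splits \<open>E\<close> into its eigenspaces for 1 and -1. By
  anticommutation \<open>S\<close> maps each into the other, injectively because its square is
  multiplication by \<open>e \<noteq> 0\<close>. A basis of \<open>P\<close> together with its image
  under \<open>S\<close> is thus a basis of \<open>E\<close>. The factor \<open>e\<close>
  accommodates a star whose square is -1.\<close>

lemma (in vector_space) anticommuting_involution:
  assumes two: "(2 :: 'a) \<noteq> 0" and e: "e \<noteq> 0" and E: "subspace E"
    and T: "\<And>x y. T (x + y) = T x + T y" "\<And>c x. T (scale c x) = scale c (T x)"
      "\<And>x. x \<in> E \<Longrightarrow> T x \<in> E" "\<And>x. x \<in> E \<Longrightarrow> T (T x) = x"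
    and S: "\<And>x y. S (x + y) = S x + S y" "\<And>c x. S (scale c x) = scale c (S x)"
      "\<And>x. x \<in> E \<Longrightarrow> S x \<in> E" "\<And>x. x \<in> E \<Longrightarrow> S (S x) = scale e x"
    and anti: "\<And>x. x \<in> E \<Longrightarrow> S (T x) = - T (S x)"
  defines "P \<equiv> {x \<in> E. T x = x}"
  shows "(\<exists>x\<in>P. x \<noteq> 0) \<longleftrightarrow> (\<exists>x\<in>E. x \<noteq> 0)"
    and "(\<exists>B. finite B \<and> P \<subseteq> span B) \<longleftrightarrow> (\<exists>B. finite B \<and> E \<subseteq> span B)"
    and "\<exists>B. finite B \<and> P \<subseteq> span B \<Longrightarrow> dim E = 2 * dim P"
proof -
  have T_neg: "T (- x) = - T x" and S_neg: "S (- x) = - S x" for x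
    using T(2)[of "- 1" x] S(2)[of "- 1" x] by simp_all
  have S0: "S 0 = 0" using S(2)[of 0 0] by simp
  have S_inj: "x = 0" if "x \<in> E" "S x = 0" for x
    using S(4)[OF that(1)] that(2) S0 e by simp
  have plus_P: "x + T x \<in> P" if "x \<in> E" for x
    using that subspace_add[OF E that T(3)[OF that]] by (simp add: P_def T add.commute)
  have S_minus: "S y \<in> P" if "y \<in> E" "T y = - y" for y
    using anti[OF that(1)] that S(3) S_neg by (simp add: P_def)
  have S_plus: "T (S x) = - S x" if "x \<in> P" for x
  proof -
    have "S x = - T (S x)" using anti[of x] that by (simp add: P_def)
    then show ?thesis by (metis minus_minus)
  qed
  have P_sub: "subspace P"
    using E T unfolding P_def subspace_def by (auto simp: T(2)[of 0 0, simplified])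
  have minus_E: "x - T x \<in> E" "T (x - T x) = - (x - T x)" if "x \<in> E" for x
    using that subspace_diff[OF E that T(3)[OF that]] T(1)[of x "- T x"] T(4)[OF that]
    by (simp_all add: T_neg)
  show "(\<exists>x\<in>P. x \<noteq> 0) \<longleftrightarrow> (\<exists>x\<in>E. x \<noteq> 0)"
  proof
    assume "\<exists>x\<in>E. x \<noteq> 0"
    then obtain x where x: "x \<in> E" "x \<noteq> 0" by blast
    show "\<exists>x\<in>P. x \<noteq> 0"
    proof (cases "x + T x = 0")
      case True
      then have "T x = - x" by (simp add: eq_neg_iff_add_eq_0 add.commute)
      then show ?thesis using S_minus[OF x(1)] S_inj[OF x(1)] x(2) by blast
    next
      case False
      then show ?thesis using plus_P[OF x(1)] by blast
    qed
  qed (auto simp: P_def)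
  obtain B where B: "B \<subseteq> P" "independent B" "P \<subseteq> span B" "card B = dim P"
    by (rule basis_exists)
  have span_B: "span B \<subseteq> P" by (rule span_minimal[OF B(1) P_sub])
  have BE: "B \<subseteq> E" using B(1) by (auto simp: P_def)
  interpret S: Vector_Spaces.linear scale scale S by standard (simp_all add: S)
  have E_span: "E \<subseteq> span (B \<union> S ` B)"
  proof
    fix x assume x: "x \<in> E"
    have 1: "x + T x \<in> span (B \<union> S ` B)"
      using plus_P[OF x] B(3) span_mono[of B "B \<union> S ` B"] by blast
    have "S (x - T x) \<in> span B" using S_minus[OF minus_E[OF x]] B(3) by blast
    then have "S (S (x - T x)) \<in> span (S ` B)" by (simp add: S.span_image)
    \<comment> \<open>\<open>x - T x\<close> belongs to the eigenvalue -1. \<open>S\<close> sends it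
      into \<open>P\<close>, and a second application returns it up to the factor
      \<open>e\<close>.\<close>
    then have "scale (inverse e) (scale e (x - T x)) \<in> span (S ` B)"
      unfolding S(4)[OF minus_E(1)[OF x]] by (rule span_scale)
    then have "x - T x \<in> span (S ` B)" using e by simp
    then have 2: "x - T x \<in> span (B \<union> S ` B)" using span_mono[of "S ` B" "B \<union> S ` B"] by blast
    have "x = scale (inverse 2) ((x + T x) + (x - T x))"
    proof -
      have "(x + T x) + (x - T x) = scale 2 x"
        using scale_left_distrib[of 1 1 x] by simp
      then show ?thesis using two by simp
    qed
    then show "x \<in> span (B \<union> S ` B)" using span_scale[OF span_add[OF 1 2]] by metis
  qed
  have fin: "finite B" if "\<exists>B. finite B \<and> P \<subseteq> span B"
    using that independent_span_bound[OF _ B(2)] B(1) by blast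
  show "(\<exists>B. finite B \<and> P \<subseteq> span B) \<longleftrightarrow> (\<exists>B. finite B \<and> E \<subseteq> span B)"
  proof
    assume "\<exists>B. finite B \<and> P \<subseteq> span B"
    then show "\<exists>B. finite B \<and> E \<subseteq> span B" using fin E_span by blast
  next
    assume "\<exists>B. finite B \<and> E \<subseteq> span B"
    then show "\<exists>B. finite B \<and> P \<subseteq> span B" unfolding P_def by blast
  qed
  assume "\<exists>B. finite B \<and> P \<subseteq> span B"
  then have fB: "finite B" by (rule fin)
  have inj: "inj_on S B"
  proof (rule inj_onI)
    fix x y assume xy: "x \<in> B" "y \<in> B" "S x = S y"
    then have "x - y \<in> E" using BE subspace_diff[OF E] by blast
    moreover have "S (x - y) = 0" using xy by (simp add: S.diff)
    ultimately show "x = y" using S_inj by fastforce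
  qed
  have PN: "x = 0" if "x \<in> P" "T x = - x" for x
  proof -
    have "x = - x" using that by (simp add: P_def)
    then have "x + x = 0" by (metis right_minus)
    then have "scale 2 x = 0" using scale_left_distrib[of 1 1 x] by simp
    then show ?thesis using two by simp
  qed
  have zero_notin: "0 \<notin> B" using B(2) dependent_zero by blast
  have disj: "B \<inter> S ` B = {}"
  proof -
    have False if "x \<in> B" "S x \<in> B" for x
    proof -
      have "S x = 0" using PN[of "S x"] S_plus[of x] that B(1) by blast
      then show False using that zero_notin by simp
    qed
    then show ?thesis by blast
  qed
  have "independent (B \<union> S ` B)"
  proof (subst dependent_finite, simp add: fB, clarify)
    fix u v assume v: "v \<in> B \<union> S ` B" "u v \<noteq> 0" and sum: "(\<Sum>v\<in>B \<union> S ` B. scale (u v) v) = 0"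
    \<comment> \<open>\<open>x\<close> and \<open>S y\<close> are the parts of the vanishing
      combination for the eigenvalues 1 and -1. From \<open>x = - S y\<close> both lie in both
      eigenspaces, hence are 0, and injectivity of \<open>S\<close> gives
      \<open>y = 0\<close>.\<close>
    define x where "x = (\<Sum>b\<in>B. scale (u b) b)"
    define y where "y = (\<Sum>b\<in>B. scale (u (S b)) b)"
    have xP: "x \<in> P" and yP: "y \<in> P"
      unfolding x_def y_def using B(1) by (auto intro!: subspace_sum[OF P_sub] subspace_scale[OF P_sub])
    have "x + S y = 0"
      using sum by (simp add: sum.union_disjoint[OF fB finite_imageI[OF fB] disj] sum.reindex[OF inj]
          x_def y_def S.sum S.scale)
    then have xSy: "x = - S y" by (simp add: eq_neg_iff_add_eq_0)
    then have "T x = - x" using S_plus[OF yP] by (simp add: T_neg)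
    then have x0: "x = 0" by (rule PN[OF xP])
    then have y0: "y = 0" using xSy S_inj[of y] yP by (simp add: P_def)
    have "u b = 0" "u (S b) = 0" if "b \<in> B" for b
      using independentD[OF B(2) fB order_refl x0[unfolded x_def] that]
        independentD[OF B(2) fB order_refl y0[unfolded y_def] that] by auto
    then show False using v by blast
  qed
  then have "dim E = card (B \<union> S ` B)"
    using E_span BE S(3) by (intro dim_unique) auto
  also have "\<dots> = 2 * dim P"
    using card_Un_disjoint[OF fB finite_imageI[OF fB] disj] card_image[OF inj] B(4) by simp
  finally show "dim E = 2 * dim P" .
qed

section \<open>The pullback as a linear operator\<close>

context manifold begin

lemma pull_add: "pull f (\<omega> + \<eta>) = pull f \<omega> + pull f \<eta>"
  by (intro ext) (simp add: pull_def Let_def)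

lemma pull_scale: "pull f (tensor_scale r \<omega>) = tensor_scale r (pull f \<omega>)"
  by (intro ext) (simp add: pull_def Let_def tensor_scale_def)

lemma invariant_forms_eq:
  assumes "smooth_map X A f"
  shows "invariant_forms A f p = {\<omega> \<in> forms A p. pull f \<omega> = \<omega>}"
proof -
  have "is_pullback A f \<omega> \<omega> \<longleftrightarrow> pull f \<omega> = \<omega>" if "\<omega> \<in> forms A p" for \<omega>
  proof -
    note t = form_tensor_field[OF that]
    show ?thesis
      using is_pullback_iff_pull[OF assms tensor_field_is_pullback[OF t], of \<omega>] tensor_field_zero[OF t]
      by metis
  qed
  then show ?thesis unfolding invariant_forms_def by blast
qed

end

section \<open>The Laplacian in the middle degree\<close>

locale even_dimensional_riemannian = measured_riemannian X A g ori vol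
  for X :: "'a topology" and A :: "('a, 'n::finite) chart set"
    and g :: "('a, 'n) tensor_field" and ori :: "('a, 'n) chart \<Rightarrow> real ^ 'n \<Rightarrow> real"
    and vol :: "'a measure" +
  fixes m :: nat
  assumes dimension: "CARD('n) = 2 * m"
begin

abbreviation laplacian :: "('a, 'n) tensor_field \<Rightarrow> ('a, 'n) tensor_field" where
  "laplacian \<equiv> hodge_laplacian A g vol m"

text \<open>On m-forms the degrees pass from m through m + 1 and m - 1 back to m, so this operator
  can be composed with the star of m-forms on either side.\<close>

definition dsd :: "('a, 'n) tensor_field \<Rightarrow> ('a, 'n) tensor_field" where
  "dsd \<omega> = ext_d (hstar (Suc m) (ext_d \<omega>))"

text \<open>The index type of the coordinates is nonempty. Positivity selects the second branch in
  \<open>hodge_laplacian\<close> and makes \<open>m - 1\<close> a true predecessor.\<close>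

lemma m_pos: "0 < m"
  using dimension zero_less_card_finite[where 'a = 'n] by linarith

lemma dims: "m + m = CARD('n)" "Suc m + (m - 1) = CARD('n)" "Suc (m - 1) = m"
  using dimension m_pos by auto

lemma star_forms: "\<omega> \<in> forms A m \<Longrightarrow> hstar m \<omega> \<in> forms A m"
  by (rule hstar_forms[OF _ dims(1)])

lemma star_ext_d_forms: "\<omega> \<in> forms A m \<Longrightarrow> hstar (Suc m) (ext_d \<omega>) \<in> forms A (m - 1)"
  by (rule hstar_forms[OF ext_d_forms dims(2)])

lemma dsd_forms: "\<omega> \<in> forms A m \<Longrightarrow> dsd \<omega> \<in> forms A m"
  using ext_d_forms[OF star_ext_d_forms] dims(3) by (simp add: dsd_def)

text \<open>\<open>codiff_eq\<close> is used in the degrees \<open>m - 1\<close> and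
  \<open>m\<close>; its sign is the same in both, so a single sign remains in front.\<close>

lemma laplacian_eq:
  assumes w: "\<omega> \<in> forms A m"
  shows "laplacian \<omega> = tensor_scale (- 1) (dsd (hstar m \<omega>) + hstar m (dsd \<omega>))"
proof -
  have ev: "even CARD('n)" using dimension by simp
  have w': "\<omega> \<in> forms A (Suc (m - 1))" using w dims(3) by simp
  have pq: "Suc (m - 1) + m = CARD('n)" using dims by simp
  have 1: "codiff A g vol (m - 1) \<omega> = tensor_scale (- 1) (hstar (Suc m) (ext_d (hstar m \<omega>)))"
    using codiff_eq[OF w' pq ev] dims(3) by simp
  have 2: "codiff A g vol m (ext_d \<omega>) = tensor_scale (- 1) (hstar m (dsd \<omega>))"
    using codiff_eq[OF ext_d_forms[OF w] dims(2) ev] dims(3) by (simp add: dsd_def)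
  have "ext_d (tensor_scale (- 1) (hstar (Suc m) (ext_d (hstar m \<omega>)))) = tensor_scale (- 1) (dsd (hstar m \<omega>))"
    unfolding dsd_def by (rule ext_d_scale[OF star_ext_d_forms[OF star_forms[OF w]]])
  then show ?thesis
    unfolding hodge_laplacian_def 1 2 using m_pos by (simp add: tensor.scale_right_distrib)
qed

lemma dsd_add: "\<omega> \<in> forms A m \<Longrightarrow> \<eta> \<in> forms A m \<Longrightarrow> dsd (\<omega> + \<eta>) = dsd \<omega> + dsd \<eta>"
  by (simp add: dsd_def ext_d_add hstar_add ext_d_add[OF star_ext_d_forms star_ext_d_forms])

lemma dsd_scale: "\<omega> \<in> forms A m \<Longrightarrow> dsd (tensor_scale r \<omega>) = tensor_scale r (dsd \<omega>)"
  by (simp add: dsd_def ext_d_scale hstar_scale ext_d_scale[OF star_ext_d_forms])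

lemma laplacian_add:
  assumes "\<omega> \<in> forms A m" "\<eta> \<in> forms A m"
  shows "laplacian (\<omega> + \<eta>) = laplacian \<omega> + laplacian \<eta>"
  unfolding laplacian_eq[OF forms_add[OF assms]] laplacian_eq[OF assms(1)] laplacian_eq[OF assms(2)]
    hstar_add dsd_add[OF assms] dsd_add[OF star_forms[OF assms(1)] star_forms[OF assms(2)]]
    tensor.scale_right_distrib
  by (simp only: add_ac)

lemma laplacian_scale:
  assumes "\<omega> \<in> forms A m"
  shows "laplacian (tensor_scale r \<omega>) = tensor_scale r (laplacian \<omega>)"
  unfolding laplacian_eq[OF forms_scale[OF assms]] laplacian_eq[OF assms]
    hstar_scale dsd_scale[OF assms] dsd_scale[OF star_forms[OF assms]]
    tensor.scale_right_distrib tensor.scale_left_commute[of "- 1" r] ..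

lemma star_star: "\<omega> \<in> forms A m \<Longrightarrow> hstar m (hstar m \<omega>) = tensor_scale ((- 1) ^ (m * m)) \<omega>"
  by (rule hstar_hstar[OF _ dims(1)])

text \<open>On m-forms the square of the star is a scalar and commutes with \<open>dsd\<close>, so
  the star only exchanges the two summands of the Laplacian.\<close>

lemma laplacian_star:
  assumes w: "\<omega> \<in> forms A m"
  shows "laplacian (hstar m \<omega>) = hstar m (laplacian \<omega>)"
  unfolding laplacian_eq[OF star_forms[OF w]] laplacian_eq[OF w] hstar_scale hstar_add
    star_star[OF w] star_star[OF dsd_forms[OF w]] dsd_scale[OF w]
  by (simp only: add.commute)

lemma eigenspace_subspace: "tensor.subspace (eigenspace (forms A m) laplacian lam)"
proof -
  have "laplacian 0 = 0" using laplacian_scale[OF forms_zero, of 0] by simp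
  then show ?thesis
    unfolding tensor.subspace_def eigenspace_def
    by (auto simp: forms_zero forms_add forms_scale laplacian_add laplacian_scale
        tensor.scale_right_distrib tensor.scale_left_commute)
qed

section \<open>The action of the isometry on eigenspaces\<close>

context
  fixes \<tau> :: "'a \<Rightarrow> 'a"
  assumes smooth: "smooth_map X A \<tau>" and isometric: "is_pullback A \<tau> g g"
    and involution: "\<And>x. x \<in> topspace X \<Longrightarrow> \<tau> (\<tau> x) = x"
    and reversing: "orientation_reversing A ori \<tau>"
begin

lemma star_pull: "\<omega> \<in> forms A p \<Longrightarrow> p + q = CARD('n) \<Longrightarrow>
    hstar p (pull \<tau> \<omega>) = - pull \<tau> (hstar p \<omega>)"
  using hstar_pull[OF smooth isometric reversing] by simp

lemma dsd_pull:
  assumes w: "\<omega> \<in> forms A m"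
  shows "dsd (pull \<tau> \<omega>) = - pull \<tau> (dsd \<omega>)"
proof -
  have "dsd (pull \<tau> \<omega>) = ext_d (tensor_scale (- 1) (pull \<tau> (hstar (Suc m) (ext_d \<omega>))))"
    unfolding dsd_def ext_d_pull[OF smooth w] hstar_pull[OF smooth isometric reversing ext_d_forms[OF w] dims(2)] ..
  also have "\<dots> = tensor_scale (- 1) (pull \<tau> (dsd \<omega>))"
    unfolding ext_d_scale[OF pull_forms[OF smooth star_ext_d_forms[OF w]]]
      ext_d_pull[OF smooth star_ext_d_forms[OF w]] dsd_def ..
  finally show ?thesis by simp
qed

text \<open>Each summand contains the star twice, and each star contributes a factor -1 when the
  pullback passes it.\<close>

lemma laplacian_pull:
  assumes w: "\<omega> \<in> forms A m"
  shows "laplacian (pull \<tau> \<omega>) = pull \<tau> (laplacian \<omega>)"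
proof -
  note sw = star_forms[OF w]
  have "hstar m (pull \<tau> \<omega>) = tensor_scale (- 1) (pull \<tau> (hstar m \<omega>))"
    by (rule hstar_pull[OF smooth isometric reversing w dims(1)])
  then have 1: "dsd (hstar m (pull \<tau> \<omega>)) = pull \<tau> (dsd (hstar m \<omega>))"
    using dsd_scale[OF pull_forms[OF smooth sw], of "- 1"] dsd_pull[OF sw] by simp
  have "dsd (pull \<tau> \<omega>) = tensor_scale (- 1) (pull \<tau> (dsd \<omega>))" using dsd_pull[OF w] by simp
  then have 2: "hstar m (dsd (pull \<tau> \<omega>)) = pull \<tau> (hstar m (dsd \<omega>))"
    using hstar_scale[of m "- 1" "pull \<tau> (dsd \<omega>)"] star_pull[OF dsd_forms[OF w] dims(1)] by simp
  show ?thesis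
    unfolding laplacian_eq[OF pull_forms[OF smooth w]] laplacian_eq[OF w] 1 2 pull_scale pull_add ..
qed

lemma invariant_eigenspace:
  "eigenspace (invariant_forms A \<tau> m) laplacian lam =
    {\<omega> \<in> eigenspace (forms A m) laplacian lam. pull \<tau> \<omega> = \<omega>}"
  by (auto simp: eigenspace_def invariant_forms_eq[OF smooth])

lemma eigenspace_halving:
  fixes lam :: real
  defines "E \<equiv> eigenspace (forms A m) laplacian lam"
    and "P \<equiv> eigenspace (invariant_forms A \<tau> m) laplacian lam"
  shows "(\<exists>x\<in>P. x \<noteq> 0) \<longleftrightarrow> (\<exists>x\<in>E. x \<noteq> 0)"
    and "(\<exists>B. finite B \<and> P \<subseteq> tensor.span B) \<longleftrightarrow> (\<exists>B. finite B \<and> E \<subseteq> tensor.span B)"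
    and "\<exists>B. finite B \<and> P \<subseteq> tensor.span B \<Longrightarrow> tensor.dim E = 2 * tensor.dim P"
proof -
  have E: "\<omega> \<in> forms A m" "laplacian \<omega> = tensor_scale lam \<omega>" if "\<omega> \<in> E" for \<omega>
    using that by (auto simp: E_def eigenspace_def)
  have T: "pull \<tau> \<omega> \<in> E" if "\<omega> \<in> E" for \<omega>
    using E[OF that] laplacian_pull[OF E(1)[OF that]] pull_forms[OF smooth]
    by (simp add: E_def eigenspace_def pull_scale)
  have S: "hstar m \<omega> \<in> E" if "\<omega> \<in> E" for \<omega>
    using E[OF that] laplacian_star[OF E(1)[OF that]] star_forms
    by (simp add: E_def eigenspace_def hstar_scale)
  have P: "P = {\<omega> \<in> E. pull \<tau> \<omega> = \<omega>}" unfolding P_def E_def by (rule invariant_eigenspace)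
  have e: "(- 1) ^ (m * m) \<noteq> (0 :: real)" by simp
  have sub: "tensor.subspace E" unfolding E_def by (rule eigenspace_subspace)
  have inv: "pull \<tau> (pull \<tau> \<omega>) = \<omega>" if "\<omega> \<in> E" for \<omega>
    using pull_involution[OF smooth involution form_tensor_field[OF E(1)[OF that]]] .
  have anti: "hstar m (pull \<tau> \<omega>) = - pull \<tau> (hstar m \<omega>)" if "\<omega> \<in> E" for \<omega>
    by (rule star_pull[OF E(1)[OF that] dims(1)])
  have two: "(2::real) \<noteq> 0" by simp
  \<comment> \<open>The involution is the pullback, the anticommuting map is the star, and
    \<open>e\<close> is \<open>(- 1) ^ (m * m)\<close>.\<close>
  note * = tensor.anticommuting_involution[OF two e sub pull_add pull_scale T inv hstar_add hstar_scale S
      star_star[OF E(1)] anti, folded P]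
  show "(\<exists>x\<in>P. x \<noteq> 0) \<longleftrightarrow> (\<exists>x\<in>E. x \<noteq> 0)" by (rule *(1))
  show "(\<exists>B. finite B \<and> P \<subseteq> tensor.span B) \<longleftrightarrow> (\<exists>B. finite B \<and> E \<subseteq> tensor.span B)" by (rule *(2))
  show "\<exists>B. finite B \<and> P \<subseteq> tensor.span B \<Longrightarrow> tensor.dim E = 2 * tensor.dim P" by (rule *(3))
qed

lemma eigenvalues_invariant:
  "eigenvalues (invariant_forms A \<tau> m) laplacian = eigenvalues (forms A m) laplacian"
  unfolding eigenvalues_def using eigenspace_halving(1) by blast

text \<open>Finite spanning sets exist for both eigenspaces or for neither; in the latter case the
  equation reads twice infinity is infinity.\<close>

lemma eigen_multiplicity_invariant:
  "2 * eigen_multiplicity (invariant_forms A \<tau> m) laplacian lam = eigen_multiplicity (forms A m) laplacian lam"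
proof (cases "\<exists>B. finite B \<and> eigenspace (invariant_forms A \<tau> m) laplacian lam \<subseteq> tensor.span B")
  case True
  then show ?thesis
    using eigenspace_halving(2,3)[of lam] by (simp add: eigen_multiplicity_def numeral_eq_enat)
next
  case False
  then have "\<not> (\<exists>B. finite B \<and> eigenspace (forms A m) laplacian lam \<subseteq> tensor.span B)"
    using eigenspace_halving(2)[of lam] by blast
  then show ?thesis
    unfolding eigen_multiplicity_def if_not_P[OF False] by (simp only: if_False) (simp add: numeral_eq_enat)
qed

end

end

theorem theorem1p3:
  fixes X :: "'a topology"
    and A :: "('a, 'n::finite) chart set"
    and g :: "('a, 'n) tensor_field"
    and vol :: "'a measure"
    and ori :: "('a, 'n) chart \<Rightarrow> real ^ 'n \<Rightarrow> real"
    and \<tau> :: "'a \<Rightarrow> 'a"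
    and m :: nat
  assumes "CARD('n) = 2 * m"
    and "closed_manifold X A"
    and "riemannian_metric A g"
    and "riemannian_measure X A g vol"
    and "orientation A ori"
    and "isometry X A g \<tau>"
    and "\<forall>x\<in>topspace X. \<tau> (\<tau> x) = x"
    and "orientation_reversing A ori \<tau>"
  shows "eigenvalues (invariant_forms A \<tau> m) (hodge_laplacian A g vol m) =
           eigenvalues (forms A m) (hodge_laplacian A g vol m) \<and>
         (\<forall>lam\<in>eigenvalues (forms A m) (hodge_laplacian A g vol m).
            2 * eigen_multiplicity (invariant_forms A \<tau> m) (hodge_laplacian A g vol m) lam =
            eigen_multiplicity (forms A m) (hodge_laplacian A g vol m) lam)"
proof -
  interpret even_dimensional_riemannian X A g ori vol m
    by unfold_locales (use assms in auto)
  have \<tau>: "smooth_map X A \<tau>" "is_pullback A \<tau> g g"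
    using assms(6) by (auto simp: isometry_def diffeomorphism_def)
  have inv: "\<tau> (\<tau> x) = x" if "x \<in> topspace X" for x using assms(7) that by blast
  show ?thesis
    using eigenvalues_invariant[OF \<tau> inv assms(8)] eigen_multiplicity_invariant[OF \<tau> inv assms(8)]
    by blast
qed

end
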